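(* Let $F$ be a $C_{2,q'}$-finely closed set contained in $B_1(0)$ and $D=B_2(0)\setminus F$. (i) If $u$ is a nonnegative measurable function on $D$ such that $u\in L^q(D;\phi^{2q'})$ for every nonnegative $\phi\in W^{2,q'}_{0,\infty}(D)$, then $u\,\Delta(\phi^{2q'})\in L^1(D)$ for every such $\phi$. (ii) There is a constant $c=c(N,q)$ such that if $u$ is a very weak subsolution of $-\Delta u+|u|^{q-1}u=0$ in $D$, then for every nonnegative $\phi\in W^{2,q'}_{0,\infty}(D)$, with $\zeta=\phi^{2q'}$ and $L=\|\phi\|_{L^\infty(D)}$, $$\int_D u\,|\Delta\zeta|\,dx+\int_D u^q\zeta\,dx\le c\big(L\,\|D^2\phi\|_{L^{q'}(D)}\big)^{q'}.$$
   Context: $N\ge 3$, $q\ge N/(N-2)$, $q'=q/(q-1)$; $C_{2,q'}$ is the Bessel capacity of order $(2,q')$ in $\mathbb R^N$ and "finely" refers to the $C_{2,q'}$-fine topology. For $f\in W^{2,q'}(\mathbb R^N)$, $\mathrm{supp}_{(2,q')}f$ is the intersection of all finely closed sets $E$ with $f=0$ a.e. outside $E$. $W^{2,q'}_{0,\infty}(D)=\{h|_D: h\in W^{2,q'}(\mathbb R^N)\cap L^\infty(\mathbb R^N),\ \overline{\mathrm{supp}_{(2,q')}h}\text{ is a compact subset of }D\}$. $L^q(D;\zeta)$ is the set of measurable $u$ with $\int_D|u|^q\zeta\,dx<\infty$. A very weak subsolution of $-\Delta u+|u|^{q-1}u=0$ in $D$ is a nonnegative measurable $u$ such that for every nonnegative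 $\phi\in W^{2,q'}_{0,\infty}(D)$, with $\zeta=\phi^{2q'}$: $u\in L^q(D;\zeta)$ and $-\int_Du\Delta\zeta\,dx+\int_Du^q\zeta\,dx\le0$. $D^2\phi$ denotes the collection of second derivatives, $|D^2\phi|=\sum_{|\alpha|=2}|D^\alpha\phi|$. *)

theory Defs
  imports "HOL-Analysis.Analysis"
begin

definition pd :: "'n::finite \<Rightarrow> (real^'n \<Rightarrow> real) \<Rightarrow> real^'n \<Rightarrow> real" where
  "pd i f x = deriv (\<lambda>t. f (x + t *\<^sub>R axis i 1)) 0"

fun iter_pd :: "'n::finite list \<Rightarrow> (real^'n \<Rightarrow> real) \<Rightarrow> real^'n \<Rightarrow> real" where
  "iter_pd [] f = f"
| "iter_pd (i # is) f = pd i (iter_pd is f)"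

definition smooth_fun :: "(real^'n::finite \<Rightarrow> real) \<Rightarrow> bool" where
  "smooth_fun f \<longleftrightarrow> (\<forall>is. continuous_on UNIV (iter_pd is f) \<and>
      (\<forall>i x. (\<lambda>t. iter_pd is f (x + t *\<^sub>R axis i 1)) differentiable (at 0)))"

definition test_fun :: "(real^'n::finite \<Rightarrow> real) \<Rightarrow> bool" where
  "test_fun \<psi> \<longleftrightarrow> smooth_fun \<psi> \<and> compact (closure {x. \<psi> x \<noteq> 0})"

definition loc_integrable :: "(real^'n::finite \<Rightarrow> real) \<Rightarrow> bool" where
  "loc_integrable f \<longleftrightarrow> (\<forall>K. compact K \<longrightarrow> set_integrable lebesgue K f)"

text \<open>g is the weak derivative of f in R^N along the list of directions ks
  (i.e. for the multi-index counting the entries of ks).\<close>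
definition weak_deriv :: "(real^'n::finite \<Rightarrow> real) \<Rightarrow> 'n list \<Rightarrow> (real^'n \<Rightarrow> real) \<Rightarrow> bool" where
  "weak_deriv f ks g \<longleftrightarrow> loc_integrable f \<and> loc_integrable g \<and>
     (\<forall>\<psi>. test_fun \<psi> \<longrightarrow>
        (\<integral>x. f x * iter_pd ks \<psi> x \<partial>lebesgue) = (-1) ^ length ks * (\<integral>x. g x * \<psi> x \<partial>lebesgue))"

definition wd :: "'n::finite list \<Rightarrow> (real^'n \<Rightarrow> real) \<Rightarrow> real^'n \<Rightarrow> real" where
  "wd ks f = (SOME g. weak_deriv f ks g)"

definition multi_idx2 :: "('n::finite \<Rightarrow> nat) set" where
  "multi_idx2 = {\<alpha>. (\<Sum>i\<in>UNIV. \<alpha> i) = 2}"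

definition ks_of :: "('n::finite \<Rightarrow> nat) \<Rightarrow> 'n list" where
  "ks_of \<alpha> = (SOME ks. \<forall>i. count_list ks i = \<alpha> i)"

definition Dalpha :: "('n::finite \<Rightarrow> nat) \<Rightarrow> (real^'n \<Rightarrow> real) \<Rightarrow> real^'n \<Rightarrow> real" where
  "Dalpha \<alpha> f = wd (ks_of \<alpha>) f"

definition absD2 :: "(real^'n::finite \<Rightarrow> real) \<Rightarrow> real^'n \<Rightarrow> real" where
  "absD2 f x = (\<Sum>\<alpha>\<in>multi_idx2. \<bar>Dalpha \<alpha> f x\<bar>)"

definition wlap :: "(real^'n::finite \<Rightarrow> real) \<Rightarrow> real^'n \<Rightarrow> real" where
  "wlap f x = (\<Sum>i\<in>UNIV. wd [i, i] f x)"

definition in_Lp :: "real \<Rightarrow> (real^'n::finite) measure \<Rightarrow> (real^'n \<Rightarrow> real) \<Rightarrow> bool" where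
  "in_Lp p M f \<longleftrightarrow> f \<in> borel_measurable M \<and> integrable M (\<lambda>x. \<bar>f x\<bar> powr p)"

definition Lp_norm :: "real \<Rightarrow> (real^'n::finite) measure \<Rightarrow> (real^'n \<Rightarrow> real) \<Rightarrow> real" where
  "Lp_norm p M f = (\<integral>x. \<bar>f x\<bar> powr p \<partial>M) powr (1 / p)"

definition in_Linf :: "(real^'n::finite \<Rightarrow> real) \<Rightarrow> bool" where
  "in_Linf f \<longleftrightarrow> f \<in> borel_measurable lebesgue \<and> (\<exists>M. AE x in lebesgue. \<bar>f x\<bar> \<le> M)"

definition Linf_norm_on :: "(real^'n::finite) set \<Rightarrow> (real^'n \<Rightarrow> real) \<Rightarrow> real" where
  "Linf_norm_on D f = Inf {M. 0 \<le> M \<and> (AE x in lebesgue. x \<in> D \<longrightarrow> \<bar>f x\<bar> \<le> M)}"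

definition sobolev2 :: "real \<Rightarrow> (real^'n::finite \<Rightarrow> real) \<Rightarrow> bool" where
  "sobolev2 p f \<longleftrightarrow> in_Lp p lebesgue f \<and>
     (\<forall>ks::'n list. length ks \<le> 2 \<longrightarrow> (\<exists>g. weak_deriv f ks g \<and> in_Lp p lebesgue g))"

text \<open>Bessel kernel G_2 (Stein's normalisation, Fourier transform (1+4pi^2|xi|^2)^{-1}).\<close>
definition bessel_G2 :: "real^'n::finite \<Rightarrow> ennreal" where
  "bessel_G2 x = (\<integral>\<^sup>+ d. indicator {0<..} d *
      ennreal (1 / (4 * pi) * exp (- pi * (norm x)\<^sup>2 / d) * exp (- d / (4 * pi))
               * d powr (- real CARD('n) / 2)) \<partial>lborel)"

definition bessel_pot2 :: "(real^'n::finite \<Rightarrow> real) \<Rightarrow> real^'n \<Rightarrow> ennreal" where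
  "bessel_pot2 f x = (\<integral>\<^sup>+ y. bessel_G2 (x - y) * ennreal (f y) \<partial>lebesgue)"

definition bessel_cap2 :: "real \<Rightarrow> (real^'n::finite) set \<Rightarrow> ennreal" where
  "bessel_cap2 p E = (INF f \<in> {f. f \<in> borel_measurable lebesgue \<and> (\<forall>x. 0 \<le> f x) \<and>
                                    (\<forall>x\<in>E. 1 \<le> bessel_pot2 f x)}.
                        \<integral>\<^sup>+ x. ennreal (f x powr p) \<partial>lebesgue)"

text \<open>Wiener-type integral (Adams--Hedberg): E is (2,p)-thin at x iff
  int_0^1 (C_{2,p}(E cap B(x,t)) / t^{N-2p})^{1/(p-1)} dt/t < infinity.
  (Capacities of bounded sets are finite, so enn2real is harmless.)\<close>
definition wiener2 :: "real \<Rightarrow> (real^'n::finite) set \<Rightarrow> real^'n \<Rightarrow> ennreal" where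
  "wiener2 p E x = (\<integral>\<^sup>+ t. indicator {0<..<1} t *
      ennreal ((enn2real (bessel_cap2 p (E \<inter> ball x t)) / t powr (real CARD('n) - 2 * p))
               powr (1 / (p - 1)) / t) \<partial>lborel)"

definition thin2 :: "real \<Rightarrow> (real^'n::finite) set \<Rightarrow> real^'n \<Rightarrow> bool" where
  "thin2 p E x \<longleftrightarrow> wiener2 p E x < \<infinity>"

definition finely_open :: "real \<Rightarrow> (real^'n::finite) set \<Rightarrow> bool" where
  "finely_open p A \<longleftrightarrow> (\<forall>x\<in>A. thin2 p (- A) x)"

definition finely_closed :: "real \<Rightarrow> (real^'n::finite) set \<Rightarrow> bool" where
  "finely_closed p F \<longleftrightarrow> finely_open p (- F)"

definition fine_supp :: "real \<Rightarrow> (real^'n::finite \<Rightarrow> real) \<Rightarrow> (real^'n) set" where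
  "fine_supp p f = \<Inter> {E. finely_closed p E \<and> (AE x in lebesgue. x \<notin> E \<longrightarrow> f x = 0)}"

text \<open>h represents an element h|_D of W^{2,p}_{0,infty}(D).\<close>
definition W0inf :: "real \<Rightarrow> (real^'n::finite) set \<Rightarrow> (real^'n \<Rightarrow> real) \<Rightarrow> bool" where
  "W0inf p D h \<longleftrightarrow> sobolev2 p h \<and> in_Linf h \<and>
      compact (closure (fine_supp p h)) \<and> closure (fine_supp p h) \<subseteq> D"

text \<open>Nonnegative elements phi = h|_D, and zeta = phi^{2p'}; we use |h| so that
  zeta is defined on all of R^N (it equals h^{2p'} on D).\<close>
definition nonneg_W0inf :: "real \<Rightarrow> (real^'n::finite) set \<Rightarrow> (real^'n \<Rightarrow> real) \<Rightarrow> bool" where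
  "nonneg_W0inf p D h \<longleftrightarrow> W0inf p D h \<and> (\<forall>x\<in>D. 0 \<le> h x)"

definition zeta_of :: "real \<Rightarrow> (real^'n::finite \<Rightarrow> real) \<Rightarrow> real^'n \<Rightarrow> real" where
  "zeta_of p' h x = \<bar>h x\<bar> powr (2 * p')"

definition very_weak_subsol :: "real \<Rightarrow> (real^'n::finite) set \<Rightarrow> (real^'n \<Rightarrow> real) \<Rightarrow> bool" where
  "very_weak_subsol q D u \<longleftrightarrow>
     u \<in> borel_measurable (lebesgue_on D) \<and> (\<forall>x\<in>D. 0 \<le> u x) \<and>
     (\<forall>h. nonneg_W0inf (q / (q - 1)) D h \<longrightarrow>
        (let \<zeta> = zeta_of (q / (q - 1)) h in
          integrable (lebesgue_on D) (\<lambda>x. u x powr q * \<zeta> x) \<and>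
          - (\<integral>x. u x * wlap \<zeta> x \<partial>lebesgue_on D) + (\<integral>x. u x powr q * \<zeta> x \<partial>lebesgue_on D) \<le> 0))"

end

theory Submission
  imports Defs "HOL-Real_Asymp.Real_Asymp"
begin

text \<open>
  Write \<open>p = q'\<close>. With \<open>\<zeta> = \<phi> powr (2 * p)\<close> one has
  \<open>\<bar>\<Delta> \<zeta>\<bar> \<le> c * \<zeta> powr (1/q) * (\<phi> * \<bar>D\<^sup>2 \<phi>\<bar> + \<bar>\<nabla> \<phi>\<bar>\<^sup>2)\<close>, because \<open>2 * p - 2 = 2 * p / q\<close>. By Young's
  inequality \<open>u * \<bar>\<Delta> \<zeta>\<bar>\<close> is at most half of \<open>u powr q * \<zeta>\<close> plus a multiple of the \<open>p\<close>-th power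
  of the bracket, and the bracket is controlled in \<open>L\<^sup>p\<close> by the interpolation inequality
  \<open>\<integral> \<bar>\<partial>\<^sub>i \<phi>\<bar> powr (2 * p) \<le> ((2 * p - 1) * L) powr p * \<integral> \<bar>\<partial>\<^sub>i \<partial>\<^sub>i \<phi>\<bar> powr p\<close>. Only pure second derivatives
  occur, so everything is done in one coordinate direction at a time, first for mollifications
  and then in the limit; for a bounded function, integrating by parts in \<open>\<integral> \<bar>\<partial>\<^sub>i v\<bar>\<^sup>2 = - \<integral> v * \<partial>\<^sub>i \<partial>\<^sub>i v\<close> turns
  \<open>L\<^sup>1\<close> convergence of the second derivatives into \<open>L\<^sup>2\<close> convergence of the first ones.

  The fine topology enters twice: \<open>D\<close> has to be Lebesgue measurable, and \<open>\<phi>\<close> has to vanish almost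
  everywhere off the closure of its fine support, although the latter is an uncountable
  intersection. Both follow from Lebesgue's density theorem, since a duality estimate for the
  capacity shows that a set which is thin at a point does not have positive lower density there.
\<close>

section \<open>Decay of the Bessel kernel\<close>

text \<open>Thinness enters only in contrapositive form: if a set occupies a fixed fraction of every
  small ball about a point, its Wiener integral there diverges. A thin set is therefore coverable
  with small relative measure in some arbitrarily small balls, which says nothing about its
  measurability but is already the hypothesis of the density criterion for null sets. It is applied
  to the difference between a set and a measurable hull, and to the set of points where a function
  misbehaves. Boundedness of the function repairs this. Derivatives in the statement are picked by
  \<open>SOME\<close>. Every identity is proved for an explicit weak derivative first and carried
  over by uniqueness almost everywhere. All constants depend on the dimension and \<open>q\<close>
  alone, never on \<open>F\<close>.\<close>

lemma norm_powr_layer_cake: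
  fixes w :: "'a::euclidean_space"
  assumes "a > 0"
  shows "ennreal (norm w powr (-a)) \<le> (\<integral>\<^sup>+r. ennreal (a * r powr (-a-1)) * indicator {norm w..} r \<partial>lborel)"
\<comment> \<open>At the origin \<open>0 powr (-a)\<close> is 0 by convention while the integral
  diverges, which is why the lemma claims only an inequality.\<close>
proof (cases "w = 0")
  case False
  have "((\<lambda>r. - (r powr (-a))) has_real_derivative a * r powr (-a-1)) (at r)" if "norm w \<le> r" for r :: real
  proof -
    have "r > 0" using that False by (smt (verit) zero_less_norm_iff)
    then show ?thesis by (auto intro!: derivative_eq_intros)
  qed
  moreover have "((\<lambda>r::real. - (r powr (-a))) \<longlongrightarrow> - 0) at_top"
    using assms by (intro tendsto_minus tendsto_neg_powr filterlim_ident) auto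
  ultimately have "(\<integral>\<^sup>+r. ennreal (a * r powr (-a-1)) * indicator {norm w..} r \<partial>lborel)
      = ennreal (- 0 - (- (norm w powr (-a))))"
    using assms by (intro nn_integral_FTC_atLeast) auto
  then show ?thesis by simp
qed simp

text \<open>Exchanging the integrals in the layer-cake formula reduces radial integrals to volumes
  of balls, so that polar coordinates are avoided.\<close>

lemma nn_integral_norm_powr_le:
  fixes S :: "'a::euclidean_space set"
  assumes a: "a > 0" and S[measurable]: "S \<in> sets borel"
  shows "(\<integral>\<^sup>+w. ennreal (norm w powr (-a)) * indicator S w \<partial>lborel)
     \<le> (\<integral>\<^sup>+r. ennreal (a * r powr (-a-1)) * emeasure lborel (S \<inter> cball 0 r) \<partial>lborel)"
proof -
  have [measurable]: "Measurable.pred (borel \<Otimes>\<^sub>M borel) (\<lambda>x. snd x \<in> {norm (fst x :: 'a)..})"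
    unfolding atLeast_iff by measurable
  have "(\<integral>\<^sup>+w. ennreal (norm w powr (-a)) * indicator S w \<partial>lborel)
    \<le> (\<integral>\<^sup>+w. (\<integral>\<^sup>+r. ennreal (a * r powr (-a-1)) * indicator {norm w..} r * indicator S w \<partial>lborel) \<partial>lborel)"
    by (intro nn_integral_mono) (auto simp: nn_integral_multc intro!: mult_right_mono norm_powr_layer_cake a)
  also have "\<dots> = (\<integral>\<^sup>+r. (\<integral>\<^sup>+w. ennreal (a * r powr (-a-1)) * indicator {norm w..} r * indicator S w \<partial>lborel) \<partial>lborel)"
    by (rule lborel_pair.Fubini'[symmetric]) measurable
  also have "\<dots> = (\<integral>\<^sup>+r. (\<integral>\<^sup>+w. ennreal (a * r powr (-a-1)) * indicator (S \<inter> cball 0 r) w \<partial>lborel) \<partial>lborel)"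
    by (intro nn_integral_cong) (auto split: split_indicator)
  also have "\<dots> = (\<integral>\<^sup>+r. ennreal (a * r powr (-a-1)) * emeasure lborel (S \<inter> cball 0 r) \<partial>lborel)"
    by (intro nn_integral_cong, subst nn_integral_cmult_indicator) auto
  finally show ?thesis .
qed

lemma nn_integral_powr_atLeast:
  fixes a b :: real
  assumes "b > 0" "a > 0"
  shows "(\<integral>\<^sup>+r. ennreal (r powr (-b-1)) * indicator {a..} r \<partial>lborel) = ennreal (a powr (-b) / b)"
proof -
  have "((\<lambda>r. - (r powr (-b)) / b) has_real_derivative r powr (-b-1)) (at r)" if "a \<le> r" for r :: real
    using that assms by (auto intro!: derivative_eq_intros)
  moreover have "((\<lambda>r::real. - (r powr (-b)) / b) \<longlongrightarrow> - 0 / b) at_top"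
    using assms by (intro tendsto_minus tendsto_divide tendsto_const tendsto_neg_powr filterlim_ident) auto
  ultimately have "(\<integral>\<^sup>+r. ennreal (r powr (-b-1)) * indicator {a..} r \<partial>lborel)
      = ennreal (- 0 / b - (- (a powr (-b)) / b))"
    using assms by (intro nn_integral_FTC_atLeast) auto
  then show ?thesis by simp
qed

text \<open>The growth like \<open>1 / b\<close> as \<open>b\<close> tends to 0 is what matters:
  with \<open>b = 1 / ln (1/t)\<close> it becomes the logarithm of
  \<open>bessel_pot_ball_bound\<close>.\<close>

lemma nn_integral_norm_powr_outside:
  fixes t b :: real
  assumes t: "t > 0" and b: "b > 0"
  defines "N \<equiv> real DIM('a::euclidean_space)"
  shows "(\<integral>\<^sup>+w. ennreal (norm (w::'a) powr (-(N + b))) * indicator {w. t \<le> norm w} w \<partial>lborel)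
     \<le> ennreal ((N + b) * unit_ball_vol N * t powr (-b) / b)"
proof -
  define V where "V = unit_ball_vol N"
  have V: "V \<ge> 0" by (simp add: V_def N_def)
  have N: "N > 0" by (simp add: N_def)
  have "(\<integral>\<^sup>+w. ennreal (norm (w::'a) powr (-(N + b))) * indicator {w. t \<le> norm w} w \<partial>lborel)
    \<le> (\<integral>\<^sup>+r. ennreal ((N+b) * r powr (-(N+b)-1)) * emeasure lborel ({w::'a. t \<le> norm w} \<inter> cball 0 r) \<partial>lborel)"
    using N b by (intro nn_integral_norm_powr_le) auto
  also have "\<dots> \<le> (\<integral>\<^sup>+r. ennreal ((N+b) * V) * (ennreal (r powr (-b-1)) * indicator {t..} r) \<partial>lborel)"
  proof (rule nn_integral_mono)
    fix r :: real
    show "ennreal ((N+b) * r powr (-(N+b)-1)) * emeasure lborel ({w::'a. t \<le> norm w} \<inter> cball 0 r)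
        \<le> ennreal ((N+b) * V) * (ennreal (r powr (-b-1)) * indicator {t..} r)"
    proof (cases "t \<le> r")
      case True
      have r: "r > 0" using True t by simp
      have "emeasure lborel ({w::'a. t \<le> norm w} \<inter> cball 0 r) \<le> emeasure lborel (cball (0::'a) r)"
        by (intro emeasure_mono) auto
      also have "\<dots> = ennreal (V * r powr N)"
        using r by (simp add: emeasure_cball V_def N_def powr_realpow)
      finally have "ennreal ((N+b) * r powr (-(N+b)-1)) * emeasure lborel ({w::'a. t \<le> norm w} \<inter> cball 0 r)
        \<le> ennreal ((N+b) * r powr (-(N+b)-1)) * ennreal (V * r powr N)"
        by (intro mult_left_mono) auto
      also have "\<dots> = ennreal ((N+b) * V * (r powr (-(N+b)-1) * r powr N))"
        using N b V by (simp flip: ennreal_mult add: ac_simps)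
      also have "r powr (-(N+b)-1) * r powr N = r powr (-b-1)"
        using r by (simp flip: powr_add)
      finally show ?thesis using True N b V by (simp add: ennreal_mult)
    next
      case False
      then have "{w::'a. t \<le> norm w} \<inter> cball 0 r = {}" by auto
      then show ?thesis by simp
    qed
  qed
  also have "\<dots> = ennreal ((N+b) * V) * ennreal (t powr (-b) / b)"
    using nn_integral_powr_atLeast[OF b t] by (subst nn_integral_cmult) auto
  also have "\<dots> = ennreal ((N + b) * V * t powr (-b) / b)"
    using N b V by (simp flip: ennreal_mult)
  finally show ?thesis by (simp add: V_def)
qed

lemma nn_integral_norm_powr_inside:
  fixes R :: real
  assumes R: "R > 0"
  defines "N \<equiv> real DIM('a::euclidean_space)"
  assumes N2: "N > 2"
  shows "(\<integral>\<^sup>+w. ennreal (norm (w::'a) powr (-(N - 2))) * indicator (cball 0 R) w \<partial>lborel)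
     \<le> ennreal (N * unit_ball_vol N * R\<^sup>2)"
proof -
  define V where "V = unit_ball_vol N"
  have V: "V \<ge> 0" by (simp add: V_def N_def)
  \<comment> \<open>The intersection of two concentric balls is bounded by the smaller one: radius
    \<open>r\<close> up to \<open>R\<close>, radius \<open>R\<close> from there on.\<close>
  define g where "g = (\<lambda>r. ennreal ((N-2) * V) * (ennreal r * indicator {0..R} r)
       + ennreal ((N-2) * V * R powr N) * (ennreal (r powr (-(N-2)-1)) * indicator {R..} r))"
  have "(\<integral>\<^sup>+w. ennreal (norm (w::'a) powr (-(N - 2))) * indicator (cball 0 R) w \<partial>lborel)
    \<le> (\<integral>\<^sup>+r. ennreal ((N-2) * r powr (-(N-2)-1)) * emeasure lborel (cball (0::'a) R \<inter> cball 0 r) \<partial>lborel)"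
    using N2 by (intro nn_integral_norm_powr_le) auto
  also have "\<dots> \<le> (\<integral>\<^sup>+r. g r \<partial>lborel)"
  proof (rule nn_integral_mono)
    fix r :: real
    show "ennreal ((N-2) * r powr (-(N-2)-1)) * emeasure lborel (cball (0::'a) R \<inter> cball 0 r) \<le> g r"
    proof (cases "r \<le> 0")
      case True
      show ?thesis
      proof (cases "r = 0")
        case False
        then have "cball (0::'a) R \<inter> cball 0 r = {}" using True by auto
        then show ?thesis by simp
      qed simp
    next
      case False
      then have r: "r > 0" by simp
      have em: "emeasure lborel (cball (0::'a) R \<inter> cball 0 r) \<le> ennreal (V * m powr N)" if "m = r \<or> m = R" for m
      proof -
        have "emeasure lborel (cball (0::'a) R \<inter> cball 0 r) \<le> emeasure lborel (cball (0::'a) m)"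
          using that by (intro emeasure_mono) auto
        also have "\<dots> = ennreal (V * m powr N)"
          using r R that by (auto simp: emeasure_cball V_def N_def powr_realpow)
        finally show ?thesis .
      qed
      show ?thesis
      proof (cases "r \<le> R")
        case True
        have "ennreal ((N-2) * r powr (-(N-2)-1)) * emeasure lborel (cball (0::'a) R \<inter> cball 0 r)
          \<le> ennreal ((N-2) * r powr (-(N-2)-1)) * ennreal (V * r powr N)"
          by (intro mult_left_mono em) auto
        also have "\<dots> = ennreal ((N-2) * V * (r powr (-(N-2)-1) * r powr N))"
          using N2 V by (simp flip: ennreal_mult add: ac_simps)
        also have "r powr (-(N-2)-1) * r powr N = r" using r by (simp flip: powr_add)
        also have "ennreal ((N-2) * V * r) \<le> g r"
          using True r N2 V by (simp add: g_def ennreal_mult)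
        finally show ?thesis .
      next
        case False
        have "ennreal ((N-2) * r powr (-(N-2)-1)) * emeasure lborel (cball (0::'a) R \<inter> cball 0 r)
          \<le> ennreal ((N-2) * r powr (-(N-2)-1)) * ennreal (V * R powr N)"
          by (intro mult_left_mono em) auto
        also have "\<dots> = ennreal ((N-2) * V * R powr N * r powr (-(N-2)-1))"
          using N2 V by (simp flip: ennreal_mult add: ac_simps)
        also have "\<dots> \<le> g r"
          using False r R N2 V by (simp add: g_def flip: ennreal_mult)
        finally show ?thesis .
      qed
    qed
  qed
  also have "\<dots> = ennreal ((N-2) * V) * (\<integral>\<^sup>+r. ennreal r * indicator {0..R} r \<partial>lborel)
     + ennreal ((N-2) * V * R powr N) * (\<integral>\<^sup>+r. ennreal (r powr (-(N-2)-1)) * indicator {R..} r \<partial>lborel)"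
    unfolding g_def by (subst nn_integral_add) (auto simp: nn_integral_cmult)
  also have "(\<integral>\<^sup>+r. ennreal r * indicator {0..R} r \<partial>lborel) = ennreal (R\<^sup>2/2 - 0\<^sup>2/2)"
    using R by (intro nn_integral_FTC_Icc) (auto intro!: derivative_eq_intros)
  also have "(\<integral>\<^sup>+r. ennreal (r powr (-(N-2)-1)) * indicator {R..} r \<partial>lborel) = ennreal (R powr (-(N-2)) / (N-2))"
    using N2 R by (intro nn_integral_powr_atLeast) auto
  also have "ennreal ((N-2) * V) * ennreal (R\<^sup>2/2 - 0\<^sup>2/2) + ennreal ((N-2) * V * R powr N) * ennreal (R powr (-(N-2)) / (N-2))
     = ennreal ((N-2) * V * (R\<^sup>2/2) + V * (R powr N * R powr (-(N-2))))"
    using N2 V R by (simp flip: ennreal_mult ennreal_plus add: ac_simps)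
  also have "R powr N * R powr (-(N-2)) = R\<^sup>2"
    using R by (simp flip: powr_add add: powr_numeral)
  also have "(N-2) * V * (R\<^sup>2/2) + V * R\<^sup>2 = N * V * R\<^sup>2 / 2" by (simp add: field_simps)
  also have "ennreal \<dots> \<le> ennreal (N * V * R\<^sup>2)"
    using N2 V by (intro ennreal_leI) simp
  finally show ?thesis by (simp add: V_def)
qed

section \<open>Pointwise bounds for the Bessel kernel\<close>

lemma powr_le_exp:
  fixes x m :: real
  assumes "x \<ge> 0" "m > 0"
  shows "x powr m \<le> m powr m * exp x"
proof -
  have "x / m \<le> exp (x / m)" using exp_ge_add_one_self[of "x/m"] by linarith
  then have "(x / m) powr m \<le> exp (x / m) powr m" using assms by (intro powr_mono2) auto
  also have "\<dots> = exp x" using assms by (simp add: exp_powr_real)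
  finally show ?thesis using assms by (simp add: powr_divide field_simps)
qed

text \<open>The Gaussian factor absorbs any negative power of the time \<open>d\<close> at the price
  of the parabolically matching power of \<open>s\<close>. This is \<open>powr_le_exp\<close> at
  \<open>x = pi * s\<^sup>2 / d\<close>.\<close>

lemma exp_heat_le:
  fixes s d m :: real
  assumes "s > 0" "d > 0" "m > 0"
  shows "exp (- pi * s\<^sup>2 / d) * d powr (-m) \<le> (m / pi) powr m * s powr (-(2*m))"
proof -
  have "(pi * s\<^sup>2 / d) powr m \<le> m powr m * exp (pi * s\<^sup>2 / d)"
    using assms by (intro powr_le_exp) auto
  moreover have "(pi * s\<^sup>2 / d) powr m = pi powr m * s powr (2*m) * d powr (-m)"
    using assms by (simp add: powr_divide powr_mult powr_minus field_simps powr_powr flip: powr_numeral)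
  ultimately show ?thesis
    using assms by (simp add: powr_divide powr_minus exp_minus field_simps)
qed

lemma nn_integral_exp_decay:
  fixes c :: real
  assumes "c > 0"
  shows "(\<integral>\<^sup>+d. ennreal (exp (- d / c)) * indicator {0..} d \<partial>lborel) = ennreal c"
proof -
  have "((\<lambda>d. - c * exp (- d / c)) has_real_derivative exp (- r / c)) (at r)" for r :: real
    using assms by (auto intro!: derivative_eq_intros)
  moreover have "((\<lambda>d. - c * exp (- d / c)) \<longlongrightarrow> - c * 0) at_top"
    using assms by (intro tendsto_mult tendsto_const filterlim_compose[OF exp_at_bot]) real_asymp
  ultimately have "(\<integral>\<^sup>+d. ennreal (exp (- d / c)) * indicator {0..} d \<partial>lborel)
      = ennreal (- c * 0 - (- c * exp (- 0 / c)))"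
    by (intro nn_integral_FTC_atLeast) auto
  then show ?thesis by simp
qed

lemma bessel_G2_measurable [measurable]: "bessel_G2 \<in> borel_measurable borel"
  unfolding bessel_G2_def by measurable

text \<open>With \<open>m = N / 2\<close> in \<open>exp_heat_le\<close> the power of
  \<open>d\<close> disappears, and the remaining exponential integrates to \<open>4 * pi\<close>,
  which cancels the prefactor. This decay is far from sharp at infinity, but its \<open>q\<close>-th
  power is integrable there because \<open>q > 1\<close>.\<close>

lemma bessel_G2_far:
  defines "N \<equiv> real CARD('n::finite)"
  obtains C where "C > 0" "\<And>w::real^'n. w \<noteq> 0 \<Longrightarrow> bessel_G2 w \<le> ennreal (C * norm w powr (-N))"
proof
  let ?C = "(N / 2 / pi) powr (N/2)"
  have N: "N > 0" by (simp add: N_def)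
  show "?C > 0" using N by simp
  fix w :: "real^'n" assume w: "w \<noteq> 0"
  have "bessel_G2 w \<le> (\<integral>\<^sup>+d. ennreal (1/(4*pi) * ?C * norm w powr (-N)) *
      (ennreal (exp (- d / (4*pi))) * indicator {0..} d) \<partial>lborel)"
    unfolding bessel_G2_def
  proof (rule nn_integral_mono)
    fix d :: real
    have "1 / (4 * pi) * exp (- pi * (norm w)\<^sup>2 / d) * exp (- d / (4 * pi)) * d powr (- N / 2)
       \<le> 1/(4*pi) * ?C * norm w powr (-N) * exp (- d / (4*pi))" if "d > 0"
    proof -
      have "exp (- pi * (norm w)\<^sup>2 / d) * d powr (- (N/2)) \<le> ?C * norm w powr (- (2 * (N/2)))"
        using w that N by (intro exp_heat_le) auto
      then have "1 / (4 * pi) * exp (- d / (4 * pi)) * (exp (- pi * (norm w)\<^sup>2 / d) * d powr (- (N/2)))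
         \<le> 1 / (4 * pi) * exp (- d / (4 * pi)) * (?C * norm w powr (- (2 * (N/2))))"
        by (intro mult_left_mono) auto
      then show ?thesis by (simp add: ac_simps)
    qed
    then show "indicator {0<..} d * ennreal (1 / (4 * pi) * exp (- pi * (norm w)\<^sup>2 / d) * exp (- d / (4 * pi)) * d powr (- real CARD('n) / 2))
       \<le> ennreal (1/(4*pi) * ?C * norm w powr (-N)) * (ennreal (exp (- d / (4*pi))) * indicator {0..} d)"
      by (auto simp: N_def split: split_indicator simp flip: ennreal_mult intro!: ennreal_leI)
  qed
  also have "\<dots> = ennreal (1/(4*pi) * ?C * norm w powr (-N)) * ennreal (4 * pi)"
    using nn_integral_exp_decay[of "4*pi"] by (subst nn_integral_cmult) auto
  also have "\<dots> = ennreal (?C * norm w powr (-N))"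
    by (subst ennreal_mult[symmetric]) auto
  finally show "bessel_G2 w \<le> ennreal (?C * norm w powr (-N))" .
qed

text \<open>The integral is split at the diffusive scale \<open>d = s\<^sup>2\<close>. Below it the
  Gaussian yields the constant \<open>s powr (-N)\<close> on an interval of length
  \<open>s\<^sup>2\<close>; above it the exponentials are dropped, and the power of \<open>d\<close>
  is integrable at infinity since \<open>N > 2\<close>.\<close>

lemma bessel_G2_near:
  defines "N \<equiv> real CARD('n::finite)"
  assumes N2: "N > 2"
  obtains C where "C > 0" "\<And>w::real^'n. w \<noteq> 0 \<Longrightarrow> bessel_G2 w \<le> ennreal (C * norm w powr (-(N-2)))"
proof
  let ?C = "(N / 2 / pi) powr (N/2)"
  show "?C + 1 / (N/2-1) > 0" using N2 by (auto intro!: add_pos_pos)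
  fix w :: "real^'n" assume w: "w \<noteq> 0"
  define s where "s = norm w"
  have s: "s > 0" using w by (simp add: s_def)
  have "bessel_G2 w \<le> (\<integral>\<^sup>+d. ennreal (?C * s powr (-N)) * indicator {0..s\<^sup>2} d +
      ennreal (d powr (-(N/2-1)-1)) * indicator {s\<^sup>2..} d \<partial>lborel)"
    unfolding bessel_G2_def
  proof (rule nn_integral_mono)
    fix d :: real
    have 4: "1 / (4*pi) \<le> 1" using pi_gt3 by simp
    have e1: "exp (- pi * s\<^sup>2 / d) * d powr (- (N/2)) \<le> ?C * s powr (-N)" if "d > 0"
      using exp_heat_le[of s d "N/2"] s that N2 by auto
    have e2: "exp (- pi * s\<^sup>2 / d) * d powr (- (N/2)) \<le> d powr (-(N/2-1)-1)" if "d > 0"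
      using that by (auto simp: mult_le_cancel_right1)
    have e3: "1 / (4 * pi) * exp (- pi * s\<^sup>2 / d) * exp (- d / (4 * pi)) * d powr (- N / 2) \<le> exp (- pi * s\<^sup>2 / d) * d powr (- (N/2))" if "d > 0"
    proof -
      have "(1 / (4 * pi) * exp (- d / (4 * pi))) * (exp (- pi * s\<^sup>2 / d) * d powr (- (N/2))) \<le> 1 * (exp (- pi * s\<^sup>2 / d) * d powr (- (N/2)))"
        using that 4 by (intro mult_right_mono mult_le_one) auto
      then show ?thesis by (simp add: ac_simps)
    qed
    show "indicator {0<..} d * ennreal (1 / (4 * pi) * exp (- pi * (norm w)\<^sup>2 / d) * exp (- d / (4 * pi)) * d powr (- real CARD('n) / 2))
       \<le> ennreal (?C * s powr (-N)) * indicator {0..s\<^sup>2} d + ennreal (d powr (-(N/2-1)-1)) * indicator {s\<^sup>2..} d"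
    proof (cases "d > 0")
      case True
      have "ennreal (1 / (4 * pi) * exp (- pi * s\<^sup>2 / d) * exp (- d / (4 * pi)) * d powr (- N / 2)) \<le> ennreal (?C * s powr (-N))"
        "ennreal (1 / (4 * pi) * exp (- pi * s\<^sup>2 / d) * exp (- d / (4 * pi)) * d powr (- N / 2)) \<le> ennreal (d powr (-(N/2-1)-1))"
        using e1 e2 e3 True by (meson ennreal_leI order_trans)+
      then show ?thesis using True
        by (cases "d \<le> s\<^sup>2") (auto simp: N_def s_def intro: order_trans add_increasing2)
    qed auto
  qed
  also have "\<dots> = ennreal (?C * s powr (-N)) * ennreal (s\<^sup>2) + ennreal ((s\<^sup>2) powr (-(N/2-1)) / (N/2-1))"
    using nn_integral_powr_atLeast[of "N/2-1" "s\<^sup>2"] N2 s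
    by (subst nn_integral_add) (auto simp: nn_integral_cmult_indicator)
  also have "\<dots> = ennreal (?C * (s powr (-N) * s\<^sup>2) + (s\<^sup>2) powr (-(N/2-1)) / (N/2-1))"
    using N2 by (simp flip: ennreal_mult ennreal_plus add: ac_simps)
  also have "s powr (-N) * s\<^sup>2 = s powr (-(N-2))"
    using s by (simp flip: powr_numeral powr_add)
  also have "(s\<^sup>2) powr (-(N/2-1)) = s powr (-(N-2))"
    using s by (simp flip: powr_numeral add: powr_powr)
  finally show "bessel_G2 w \<le> ennreal ((?C + 1 / (N/2-1)) * norm w powr (-(N-2)))"
    by (simp add: s_def distrib_right)
qed

section \<open>Potentials of balls\<close>

abbreviation bessel_ball_pot :: "real^'n::finite \<Rightarrow> real \<Rightarrow> real^'n \<Rightarrow> ennreal" where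
  "bessel_ball_pot x t z \<equiv> (\<integral>\<^sup>+y. bessel_G2 (y - z) * indicator (ball x t) y \<partial>lborel)"

lemma nn_integral_lborel_shift:
  fixes f :: "'a::euclidean_space \<Rightarrow> ennreal"
  assumes [measurable]: "f \<in> borel_measurable borel"
  shows "(\<integral>\<^sup>+y. f (c + y) \<partial>lborel) = (\<integral>\<^sup>+y. f y \<partial>lborel)"
  by (subst (2) lborel_distr_plus[symmetric, of c], subst nn_integral_distr) auto

text \<open>The ball lies within distance \<open>3 * t\<close> of \<open>z\<close>, so the integral
  is at most that of the singularity over a ball centred at \<open>z\<close>.\<close>

lemma nn_integral_bessel_G2_ball_near:
  fixes x z :: "real^'n::finite"
  defines "N \<equiv> real CARD('n)"
  assumes N2: "N > 2" and C: "C > 0" "\<And>w::real^'n. w \<noteq> 0 \<Longrightarrow> bessel_G2 w \<le> ennreal (C * norm w powr (-(N-2)))"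
    and t: "t > 0" and z: "norm (z - x) \<le> 2 * t"
  shows "bessel_ball_pot x t z \<le> ennreal (C * (N * unit_ball_vol N * (3 * t)\<^sup>2))"
proof -
  have "bessel_ball_pot x t z
     \<le> (\<integral>\<^sup>+y. ennreal C * (ennreal (norm (-z+y) powr (-(N-2))) * indicator (cball 0 (3*t)) (-z+y)) \<partial>lborel)"
  proof (rule nn_integral_mono_AE)
    \<comment> \<open>The kernel bound is available only off the origin, hence the exceptional
      point.\<close>
    have "AE y in lborel. y \<noteq> z" by (rule AE_lborel_singleton)
    then show "AE y in lborel. bessel_G2 (y - z) * indicator (ball x t) y \<le> 
       ennreal C * (ennreal (norm (-z+y) powr (-(N-2))) * indicator (cball 0 (3*t)) (-z+y))"
    proof eventually_elim
      case (elim y)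
      show ?case
      proof (cases "y \<in> ball x t")
        case True
        then have "norm (-z+y) \<le> 3 * t"
          using z norm_triangle_ineq[of "y - x" "x - z"] by (auto simp: dist_norm norm_minus_commute)
        then show ?thesis using True C(2)[of "y - z"] C(1) elim
          by (auto simp: ennreal_mult)
      qed simp
    qed
  qed
  also have "\<dots> = ennreal C * (\<integral>\<^sup>+y. ennreal (norm (y::real^'n) powr (-(N-2))) * indicator (cball 0 (3*t)) y \<partial>lborel)"
  proof -
    define G where "G y = ennreal (norm (y::real^'n) powr (-(N-2))) * indicator (cball 0 (3*t)) y" for y
    have G: "G \<in> borel_measurable borel"
      unfolding G_def by (intro borel_measurable_times_ennreal borel_measurable_indicator measurable_compose[OF _ measurable_ennreal]
        powr_real_measurable borel_measurable_norm borel_measurable_const measurable_ident) auto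
    then have "(\<lambda>y. G (-z+y)) \<in> borel_measurable lborel"
      by (intro measurable_compose[OF _ G]) measurable
    then show ?thesis using nn_integral_lborel_shift[OF G, of "-z"]
      unfolding G_def[symmetric] by (simp add: nn_integral_cmult)
  qed
  also have "\<dots> \<le> ennreal C * ennreal (N * unit_ball_vol N * (3 * t)\<^sup>2)"
    using nn_integral_norm_powr_inside[where 'a="real^'n", of "3*t"] t N2 unfolding N_def
    by (intro mult_left_mono) auto
  also have "\<dots> = ennreal (C * (N * unit_ball_vol N * (3 * t)\<^sup>2))"
    using C(1) N2 by (simp add: ennreal_mult)
  finally show ?thesis .
qed

text \<open>Every point of the ball is at least half as far from \<open>z\<close> as the centre is.
  The exponent is left open because the lemma serves both kernel bounds, with
  \<open>a = N - 2\<close> and \<open>a = N\<close>.\<close>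

lemma nn_integral_bessel_G2_ball_far:
  fixes x z :: "real^'n::finite"
  defines "N \<equiv> real CARD('n)"
  assumes a: "a \<ge> 0" and C: "C > 0" "\<And>w::real^'n. w \<noteq> 0 \<Longrightarrow> bessel_G2 w \<le> ennreal (C * norm w powr (-a))"
    and t: "t > 0" and z: "2 * t \<le> norm (z - x)"
  shows "bessel_ball_pot x t z
     \<le> ennreal (C * 2 powr a * unit_ball_vol N * t powr N * norm (z - x) powr (-a))"
proof -
  have "bessel_ball_pot x t z
     \<le> (\<integral>\<^sup>+y. ennreal (C * (norm (z - x) / 2) powr (-a)) * indicator (ball x t) y \<partial>lborel)"
  proof (rule nn_integral_mono)
    fix y
    show "bessel_G2 (y - z) * indicator (ball x t) y \<le> ennreal (C * (norm (z - x) / 2) powr (-a)) * indicator (ball x t) y"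
    proof (cases "y \<in> ball x t")
      case True
      then have *: "norm (y - z) \<ge> norm (z - x) / 2"
        using z norm_triangle_ineq[of "z - y" "y - x"] by (auto simp: dist_norm norm_minus_commute)
      with z t have nz: "y - z \<noteq> 0" by auto
      have "norm (y - z) powr (-a) \<le> (norm (z - x) / 2) powr (-a)"
        using * a z t by (intro powr_mono2') auto
      then have "bessel_G2 (y - z) \<le> ennreal (C * (norm (z - x) / 2) powr (-a))"
        using C(2)[OF nz] C(1) by (meson ennreal_leI mult_left_mono less_imp_le order_trans)
      then show ?thesis using True by simp
    qed simp
  qed
  also have "\<dots> = ennreal (C * (norm (z - x) / 2) powr (-a)) * ennreal (unit_ball_vol N * t powr N)"
    using t by (subst nn_integral_cmult_indicator) (auto simp: emeasure_ball N_def powr_realpow)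
  also have "\<dots> = ennreal (C * 2 powr a * unit_ball_vol N * t powr N * norm (z - x) powr (-a))"
    using C(1) by (simp add: powr_divide powr_minus N_def field_simps flip: ennreal_mult)
  finally show ?thesis .
qed

text \<open>Both regimes are merged into one barely integrable power. For \<open>s \<le> 1\<close>
  the exponent \<open>N - (N-2)*q\<close> is not positive, so that power of \<open>s\<close> is
  largest at \<open>s = t\<close>; for \<open>s > 1\<close> the far decay \<open>N * q\<close> is at
  least \<open>N + \<delta>\<close>.\<close>

lemma bessel_decay_powr_le:
  fixes s t N q \<delta> :: real
  assumes "N > 2" "N \<le> (N-2) * q" "0 < \<delta>" "\<delta> \<le> N * (q-1)" "0 < t" "t < 1" "t \<le> s" "q > 1"
  shows "(min (s powr (-(N-2))) (s powr (-N))) powr q \<le> t powr (N - (N-2)*q) * s powr (-(N+\<delta>))"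
proof (cases "s \<le> 1")
  case True
  have "(min (s powr (-(N-2))) (s powr (-N))) powr q \<le> (s powr (-(N-2))) powr q"
    using assms by (intro powr_mono2) auto
  also have "\<dots> = s powr (N - (N-2)*q) * s powr (-N)"
    by (simp add: powr_powr flip: powr_add) (simp add: algebra_simps)
  also have "\<dots> \<le> t powr (N - (N-2)*q) * s powr (-(N+\<delta>))"
    using assms True by (intro mult_mono powr_mono2' powr_mono') auto
  finally show ?thesis .
next
  case False
  have "(min (s powr (-(N-2))) (s powr (-N))) powr q \<le> (s powr (-N)) powr q"
    using assms by (intro powr_mono2) auto
  also have "\<dots> = 1 * s powr (-N*q)" by (simp add: powr_powr)
  also have "\<dots> \<le> t powr (N - (N-2)*q) * s powr (-(N+\<delta>))"
  proof (intro mult_mono powr_mono)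
    show "1 \<le> t powr (N - (N-2)*q)"
      using assms powr_mono2'[of "N - (N-2)*q" t 1] by (cases "N = (N-2)*q") auto
    show "- N * q \<le> - (N + \<delta>)" using assms by (simp add: algebra_simps)
  qed (use False in auto)
  finally show ?thesis .
qed

text \<open>The potential is of order \<open>t\<^sup>2\<close> near the ball and
  \<open>t powr N\<close> times the kernel away from it. The \<open>q\<close>-th power of the far
  part carries \<open>t powr (N*q)\<close> times \<open>t powr (N - (N-2)*q)\<close>, that is
  \<open>t powr (2*q+N)\<close>. The logarithm is the price of the critical case
  \<open>q = N / (N-2)\<close>. A real-valued majorant \<open>b\<close> is returned so that Young's
  inequality can be applied to it pointwise.\<close>

lemma bessel_pot_ball_bound:
  fixes q :: real
  defines "N \<equiv> real CARD('n::finite)"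
  assumes N2: "N > 2" and q: "q \<ge> N / (N-2)"
  obtains C t0 where "C > 0" "0 < t0" "t0 < 1" 
    "\<And>(x::real^'n) t. 0 < t \<Longrightarrow> t < t0 \<Longrightarrow> \<exists>b. b \<in> borel_measurable borel \<and> (\<forall>z. 0 \<le> b z) \<and> 
      (\<forall>z. bessel_ball_pot x t z \<le> ennreal (b z)) \<and>
      (\<integral>\<^sup>+z. ennreal (b z powr q) \<partial>lborel) \<le> ennreal (C * t powr (2*q+N) * ln (1/t))"
proof -
  have qN: "N \<le> (N-2) * q" using q N2 by (simp add: field_simps)
  have q1: "q > 1"
  proof -
    have "N/(N-2) > 1" using N2 by simp
    with q show ?thesis by linarith
  qed
  define V where "V = unit_ball_vol N"
  have V: "V > 0" by (simp add: V_def N_def)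
  obtain Ca where Ca: "Ca > 0" "\<And>w::real^'n. w \<noteq> 0 \<Longrightarrow> bessel_G2 w \<le> ennreal (Ca * norm w powr (-(N-2)))"
    using bessel_G2_near[where 'n='n] N2 unfolding N_def by blast
  obtain Cb where Cb: "Cb > 0" "\<And>w::real^'n. w \<noteq> 0 \<Longrightarrow> bessel_G2 w \<le> ennreal (Cb * norm w powr (-N))"
    using bessel_G2_far[where 'n='n] unfolding N_def by blast
  define C1 where "C1 = max (Ca * (N * V * 9)) (max (Ca * 2 powr (N-2) * V) (Cb * 2 powr N * V))"
  have C1: "C1 > 0" "Ca * (N * V * 9) \<le> C1" "Ca * 2 powr (N-2) * V \<le> C1" "Cb * 2 powr N * V \<le> C1"
    using Ca Cb V N2 by (auto simp: C1_def less_max_iff_disj)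
  define C where "C = C1 powr q * V * (2 powr N + (N+1) * exp 1)"
  \<comment> \<open>For \<open>t < exp (-m)\<close> the number \<open>l = ln (1/t)\<close> exceeds 1
    and \<open>1 / (N*(q-1))\<close>, so that \<open>1 / l\<close> satisfies the constraints on
    \<open>\<delta>\<close> in \<open>bessel_decay_powr_le\<close>.\<close>
  define m where "m = max 1 (1 / (N*(q-1)))"
  have Nq: "N*(q-1) > 0" using N2 q1 by simp
  have m: "m \<ge> 1" "1 / (N*(q-1)) \<le> m" by (auto simp: m_def)
  show ?thesis
  proof
    show "C > 0" using C1 V N2 by (auto simp: C_def intro!: mult_pos_pos add_pos_pos)
    show "0 < exp (-m)" "exp (-m) < 1" using m by auto
    fix x :: "real^'n" and t :: real assume t: "0 < t" "t < exp (-m)"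
    define l where "l = ln (1/t)"
    have "ln t < -m" using t by (metis exp_gt_zero ln_exp ln_less_cancel_iff)
    then have "l > m" using t by (simp add: l_def ln_div)
    then have l: "l > 1" "1/(N*(q-1)) < l" using m by auto
    have t1: "t < 1" using t m by (meson exp_le_one_iff less_le_trans le_minus_iff neg_le_0_iff_le order.trans zero_le_one less_imp_le)
    \<comment> \<open>With this exponent the integral of \<open>norm w powr (-(N+\<delta>))\<close> over \<open>norm w \<ge> t\<close> is of order \<open>ln (1/t)\<close>.\<close>
    define \<delta> where "\<delta> = 1 / l"
    have d: "0 < \<delta>" "\<delta> \<le> N*(q-1)" "\<delta> \<le> 1" using l Nq by (auto simp: \<delta>_def field_simps)
    \<comment> \<open>The remaining factor of the outer integral thus does not depend on
      \<open>t\<close>.\<close>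
    have td: "t powr (-\<delta>) = exp 1"
    proof -
      have "ln t = - l" using t by (simp add: l_def ln_div)
      then have "- \<delta> * ln t = 1" using l by (simp add: \<delta>_def)
      then show ?thesis using t by (simp add: powr_def)
    qed
    define b where "b z = (if norm (z - x) < 2 * t then C1 * t\<^sup>2
       else C1 * t powr N * min (norm (z - x) powr (-(N-2))) (norm (z - x) powr (-N)))" for z
    have meas: "b \<in> borel_measurable borel" unfolding b_def by measurable
    have nonneg: "0 \<le> b z" for z using C1 by (auto simp: b_def)
    have bound: "bessel_ball_pot x t z \<le> ennreal (b z)" for z
    proof (cases "norm (z - x) < 2 * t")
      case True
      have "Ca * (N * V * (3 * t)\<^sup>2) = Ca * (N * V * 9) * t\<^sup>2" by (simp add: power_mult_distrib)
      also have "\<dots> \<le> b z" using True C1 by (simp add: b_def mult_right_mono)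
      finally show ?thesis
        using nn_integral_bessel_G2_ball_near[of Ca t z x] N2 Ca t True unfolding N_def V_def
        by (meson ennreal_leI order_trans less_imp_le)
    next
      case False
      have "bessel_ball_pot x t z
        \<le> ennreal (Ca * 2 powr (N-2) * V * t powr N * norm (z - x) powr (-(N-2)))"
        using nn_integral_bessel_G2_ball_far[of "N-2" Ca t z x] N2 Ca t False unfolding N_def V_def by auto
      also have "\<dots> \<le> ennreal (C1 * (t powr N * norm (z - x) powr (-(N-2))))"
        using mult_right_mono[OF C1(3), of "t powr N * norm (z - x) powr (-(N-2))"]
        by (intro ennreal_leI) (simp add: ac_simps)
      finally have 1: "bessel_ball_pot x t z
        \<le> ennreal (C1 * (t powr N * norm (z - x) powr (-(N-2))))" .
      have "bessel_ball_pot x t z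
        \<le> ennreal (Cb * 2 powr N * V * t powr N * norm (z - x) powr (-N))"
        using nn_integral_bessel_G2_ball_far[of "N" Cb t z x] N2 Cb t False unfolding N_def V_def by auto
      also have "\<dots> \<le> ennreal (C1 * (t powr N * norm (z - x) powr (-N)))"
        using mult_right_mono[OF C1(4), of "t powr N * norm (z - x) powr (-N)"]
        by (intro ennreal_leI) (simp add: ac_simps)
      finally show ?thesis using 1 False by (auto simp: b_def min_def mult.assoc)
    qed
    define g where "g w = ennreal (C1 powr q * t powr (2*q)) * indicator (ball 0 (2*t)) w
       + ennreal (C1 powr q * t powr (2*q+N)) * (ennreal (norm w powr (-(N+\<delta>))) * indicator {w. t \<le> norm w} w)" for w :: "real^'n"
    have set_m: "{w::real^'n. t \<le> norm w} \<in> sets borel"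
      by (intro borel_closed closed_Collect_le continuous_intros)
    have n_m: "(\<lambda>w::real^'n. norm w powr (-(N+\<delta>))) \<in> borel_measurable borel"
      by (intro powr_real_measurable borel_measurable_norm borel_measurable_const measurable_ident)
    have h_m: "(\<lambda>w::real^'n. ennreal (norm w powr (-(N+\<delta>))) * indicator {w. t \<le> norm w} w) \<in> borel_measurable lborel" unfolding measurable_lborel2
      by (intro borel_measurable_times_ennreal borel_measurable_indicator[OF set_m] measurable_compose[OF n_m measurable_ennreal])
    have i_m: "(indicator (ball (0::real^'n) (2*t)) :: _ \<Rightarrow> ennreal) \<in> borel_measurable borel"
      by (intro borel_measurable_indicator borel_open open_ball)
    have m1: "(\<lambda>w::real^'n. ennreal (C1 powr q * t powr (2*q)) * indicator (ball 0 (2*t)) w) \<in> borel_measurable lborel" unfolding measurable_lborel2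
      by (intro borel_measurable_times_ennreal borel_measurable_const i_m)
    have m2: "(\<lambda>w::real^'n. ennreal (C1 powr q * t powr (2*q+N)) * (ennreal (norm w powr (-(N+\<delta>))) * indicator {w. t \<le> norm w} w)) \<in> borel_measurable lborel" unfolding measurable_lborel2
      by (intro borel_measurable_times_ennreal borel_measurable_const h_m[unfolded measurable_lborel2])
    have g_m: "g \<in> borel_measurable borel" unfolding g_def
      by (intro borel_measurable_add m1[unfolded measurable_lborel2] m2[unfolded measurable_lborel2])
    have "(\<integral>\<^sup>+z. ennreal (b z powr q) \<partial>lborel) \<le> (\<integral>\<^sup>+z. g (-x + z) \<partial>lborel)"
    proof (rule nn_integral_mono)
      fix z
      show "ennreal (b z powr q) \<le> g (-x + z)"
      proof (cases "norm (z - x) < 2 * t")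
        case True
        have "t\<^sup>2 = t powr 2" using t by simp
        then have "b z powr q = C1 powr q * (t powr 2) powr q"
          using True C1 t by (simp only: b_def powr_mult if_True)
        then have "b z powr q = C1 powr q * t powr (2*q)" by (simp only: powr_powr)
        moreover have "indicator (ball 0 (2*t)) (-x+z) = (1::ennreal)" using True by simp
        ultimately show ?thesis unfolding g_def by (auto intro: add_increasing2)
      next
        case False
        define s where "s = norm (z - x)"
        have s: "t \<le> s" using False t by (simp add: s_def)
        have "b z powr q = C1 powr q * (t powr N) powr q * (min (s powr (-(N-2))) (s powr (-N))) powr q"
          using False C1 by (simp add: b_def s_def powr_mult)
        also have "\<dots> \<le> C1 powr q * (t powr N) powr q * (t powr (N - (N-2)*q) * s powr (-(N+\<delta>)))"
          using bessel_decay_powr_le[OF N2 qN d(1,2) t(1) t1 s q1] by (intro mult_left_mono) auto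
        also have "\<dots> = C1 powr q * t powr (2*q+N) * s powr (-(N+\<delta>))"
          by (simp add: powr_powr flip: powr_add) (simp add: algebra_simps)
        finally have "ennreal (b z powr q) \<le> ennreal (C1 powr q * t powr (2*q+N)) * ennreal (s powr (-(N+\<delta>)))"
          by (simp flip: ennreal_mult add: ennreal_leI)
        moreover have "indicator {w. t \<le> norm w} (-x+z) = (1::ennreal)" using s by (simp add: s_def)
        moreover have "norm (-x+z) = s" by (simp add: s_def)
        ultimately show ?thesis unfolding g_def by (auto intro: add_increasing)
      qed
    qed
    also have "\<dots> = (\<integral>\<^sup>+z. g z \<partial>lborel)" by (rule nn_integral_lborel_shift[OF g_m])
    also have "\<dots> = ennreal (C1 powr q * t powr (2*q)) * emeasure lborel (ball (0::real^'n) (2*t)) +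
       ennreal (C1 powr q * t powr (2*q+N)) * (\<integral>\<^sup>+w. ennreal (norm (w::real^'n) powr (-(N+\<delta>))) * indicator {w. t \<le> norm w} w \<partial>lborel)"
    proof -
      have "(\<integral>\<^sup>+z. g z \<partial>lborel) = (\<integral>\<^sup>+w. ennreal (C1 powr q * t powr (2*q)) * indicator (ball 0 (2*t)) (w::real^'n) \<partial>lborel)
        + (\<integral>\<^sup>+w. ennreal (C1 powr q * t powr (2*q+N)) * (ennreal (norm (w::real^'n) powr (-(N+\<delta>))) * indicator {w. t \<le> norm w} w) \<partial>lborel)"
        unfolding g_def by (rule nn_integral_add[OF m1 m2])
      also have "(\<integral>\<^sup>+w. ennreal (C1 powr q * t powr (2*q+N)) * (ennreal (norm (w::real^'n) powr (-(N+\<delta>))) * indicator {w. t \<le> norm w} w) \<partial>lborel)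
        = ennreal (C1 powr q * t powr (2*q+N)) * (\<integral>\<^sup>+w. ennreal (norm (w::real^'n) powr (-(N+\<delta>))) * indicator {w. t \<le> norm w} w \<partial>lborel)"
        by (rule nn_integral_cmult[OF h_m])
      also have "(\<integral>\<^sup>+w. ennreal (C1 powr q * t powr (2*q)) * indicator (ball 0 (2*t)) (w::real^'n) \<partial>lborel)
        = ennreal (C1 powr q * t powr (2*q)) * emeasure lborel (ball (0::real^'n) (2*t))"
        by (rule nn_integral_cmult_indicator) simp
      finally show ?thesis .
    qed
    also have "\<dots> \<le> ennreal (C1 powr q * t powr (2*q)) * ennreal (V * (2*t) powr N) +
       ennreal (C1 powr q * t powr (2*q+N)) * ennreal ((N + \<delta>) * V * t powr (-\<delta>) / \<delta>)"
      using nn_integral_norm_powr_outside[where 'a="real^'n", of t \<delta>] t d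
      by (intro add_mono mult_left_mono) (auto simp: emeasure_ball V_def N_def powr_realpow)
    also have "\<dots> = ennreal (C1 powr q * t powr (2*q) * (V * (2*t) powr N) + C1 powr q * t powr (2*q+N) * ((N + \<delta>) * V * t powr (-\<delta>) / \<delta>))"
      using V N2 d by (simp flip: ennreal_mult ennreal_plus)
    also have "\<dots> \<le> ennreal (C * t powr (2*q+N) * l)"
    proof (rule ennreal_leI)
      have "C1 powr q * t powr (2*q) * (V * (2*t) powr N) + C1 powr q * t powr (2*q+N) * ((N + \<delta>) * V * t powr (-\<delta>) / \<delta>)
         = C1 powr q * V * t powr (2*q+N) * (2 powr N + (N+\<delta>) * exp 1 * l)"
        unfolding td using t by (simp add: powr_mult powr_add \<delta>_def algebra_simps)
      also have "\<dots> \<le> C1 powr q * V * t powr (2*q+N) * (2 powr N * l + (N+1) * exp 1 * l)"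
        using l d N2 V by (intro mult_left_mono add_mono mult_right_mono) auto
      also have "\<dots> = C * t powr (2*q+N) * l" by (simp add: C_def algebra_simps)
      finally show "C1 powr q * t powr (2*q) * (V * (2*t) powr N) + C1 powr q * t powr (2*q+N) * ((N + \<delta>) * V * t powr (-\<delta>) / \<delta>)
         \<le> C * t powr (2*q+N) * l" .
    qed
    finally have "(\<integral>\<^sup>+z. ennreal (b z powr q) \<partial>lborel) \<le> ennreal (C * t powr (2*q+N) * ln (1/t))"
      by (simp add: l_def)
    then show "\<exists>b. b \<in> borel_measurable borel \<and> (\<forall>z. 0 \<le> b z) \<and> 
      (\<forall>z. bessel_ball_pot x t z \<le> ennreal (b z)) \<and>
      (\<integral>\<^sup>+z. ennreal (b z powr q) \<partial>lborel) \<le> ennreal (C * t powr (2*q+N) * ln (1/t))"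
      using meas nonneg bound by blast
  qed
qed

text \<open>The part of the integral over \<open>1 \<le> d \<le> 2\<close> is already bounded below.
  The bound serves to show that balls have finite capacity.\<close>

lemma bessel_G2_lower:
  obtains c where "c > 0" "\<And>w::real^'n::finite. norm w \<le> R \<Longrightarrow> ennreal c \<le> bessel_G2 w"
proof
  let ?c = "1 / (4 * pi) * exp (- pi * R\<^sup>2) * exp (- 2 / (4 * pi)) * 2 powr (- real CARD('n) / 2)"
  show "?c > 0" by simp
  fix w :: "real^'n" assume w: "norm w \<le> R"
  have "ennreal ?c = (\<integral>\<^sup>+d. ennreal ?c * indicator {1..2::real} d \<partial>lborel)"
    by (subst nn_integral_cmult_indicator) auto
  also have "\<dots> \<le> bessel_G2 w"
    unfolding bessel_G2_def
  proof (rule nn_integral_mono)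
    fix d :: real
    have "?c \<le> 1 / (4 * pi) * exp (- pi * (norm w)\<^sup>2 / d) * exp (- d / (4 * pi)) * d powr (- real CARD('n) / 2)"
      if "1 \<le> d" "d \<le> 2"
    proof -
      have "(norm w)\<^sup>2 / d \<le> (norm w)\<^sup>2" using that by (simp add: field_simps mult_le_cancel_right1)
      also have "\<dots> \<le> R\<^sup>2" using w by (simp add: power_mono)
      finally have "pi * ((norm w)\<^sup>2 / d) \<le> pi * R\<^sup>2" by (rule mult_left_mono) simp
      then have "- pi * R\<^sup>2 \<le> - pi * (norm w)\<^sup>2 / d" by simp
      then show ?thesis using that
        by (intro mult_mono powr_mono2') (auto simp: field_simps)
    qed
    then show "ennreal ?c * indicator {1..2::real} d \<le> indicator {0<..} d * ennreal (1 / (4 * pi) * exp (- pi * (norm w)\<^sup>2 / d) * exp (- d / (4 * pi)) * d powr (- real CARD('n) / 2))"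
      by (auto split: split_indicator intro!: ennreal_leI)
  qed
  finally show "ennreal ?c \<le> bessel_G2 w" .
qed

section \<open>Monotonicity of the capacity and its finiteness on balls\<close>

lemma bessel_cap2_mono: "E \<subseteq> E' \<Longrightarrow> bessel_cap2 p E \<le> bessel_cap2 p E'"
  unfolding bessel_cap2_def by (rule INF_superset_mono) auto

text \<open>Finiteness matters because \<open>enn2real\<close> in the Wiener integral sends \<open>\<infinity>\<close> to \<open>0\<close>.\<close>

lemma bessel_cap2_ball_finite:
  fixes x :: "real^'n::finite"
  assumes t: "t > 0"
  shows "bessel_cap2 p (ball x t) < \<infinity>"
proof -
  obtain c where c: "c > 0" "\<And>w::real^'n. norm w \<le> 2*t \<Longrightarrow> ennreal c \<le> bessel_G2 w"
    using bessel_G2_lower[where R="2*t" and 'n='n] by blast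
  define v where "v = unit_ball_vol (real CARD('n)) * t ^ CARD('n)"
  have v: "v > 0" using t by (simp add: v_def)
  have em: "emeasure lborel (ball x t) = ennreal v" using t by (simp add: v_def emeasure_ball)
  \<comment> \<open>A multiple of the indicator of the ball is admissible: distances within the ball
    are at most \<open>2 * t\<close>, so its potential there is at least
    \<open>c * K * v = 1\<close>.\<close>
  define K where "K = 1 / (c * v)"
  have K: "K > 0" using c v by (simp add: K_def)
  define f where "f y = K * indicator (ball x t) y" for y
  have "bessel_cap2 p (ball x t) \<le> (\<integral>\<^sup>+ y. ennreal (f y powr p) \<partial>lebesgue)"
    unfolding bessel_cap2_def
  proof (rule INF_lower, safe)
    show "f \<in> borel_measurable lebesgue" unfolding f_def
      by (intro measurable_completion borel_measurable_times borel_measurable_const borel_measurable_indicator) auto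
    show "0 \<le> f y" for y using K by (simp add: f_def)
    fix y assume y: "y \<in> ball x t"
    have "ennreal 1 = ennreal (c * K) * ennreal v"
      using c v K by (subst ennreal_mult[symmetric]) (auto simp: K_def)
    also have "\<dots> = (\<integral>\<^sup>+ z. ennreal (c * K) * indicator (ball x t) z \<partial>lborel)"
      by (subst nn_integral_cmult_indicator) (auto simp: em)
    also have "\<dots> \<le> (\<integral>\<^sup>+ z. bessel_G2 (y - z) * ennreal (f z) \<partial>lborel)"
    proof (rule nn_integral_mono)
      fix z
      show "ennreal (c * K) * indicator (ball x t) z \<le> bessel_G2 (y - z) * ennreal (f z)"
      proof (cases "z \<in> ball x t")
        case True
        then have "norm (y - z) \<le> 2 * t" using y norm_triangle_ineq[of "y - x" "x - z"]
          by (auto simp: dist_norm norm_minus_commute)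
        then have "ennreal c * ennreal K \<le> bessel_G2 (y - z) * ennreal K"
          by (intro mult_right_mono c) auto
        then show ?thesis using True c K by (simp add: f_def ennreal_mult)
      qed simp
    qed
    finally show "1 \<le> bessel_pot2 f y" by (simp add: bessel_pot2_def nn_integral_completion)
  qed
  also have "\<dots> \<le> (\<integral>\<^sup>+ y. ennreal (K powr p) * indicator (ball x t) y \<partial>lborel)"
    unfolding nn_integral_completion f_def
    by (intro nn_integral_mono) (auto split: split_indicator)
  also have "\<dots> = ennreal (K powr p * v)"
    using v by (subst nn_integral_cmult_indicator) (auto simp: em ennreal_mult)
  also have "\<dots> < \<infinity>" by simp
  finally show ?thesis .
qed

section \<open>Thin sets and Lebesgue density\<close>

text \<open>The exponent of the logarithm is sharp enough for the critical case \<open>2 * p = N\<close>: the Wiener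
  integrand is then bounded below by a multiple of \<open>1 / (t * ln (1/t))\<close>, which is not integrable at \<open>0\<close>.
  The proof tests the potential against the indicator of the set where it is at least \<open>1\<close>.\<close>

lemma bessel_cap2_lower:
  fixes q :: real
  defines "N \<equiv> real CARD('n::finite)" and "p \<equiv> q / (q-1)"
  assumes N2: "N > 2" and q: "q \<ge> N / (N-2)" and k: "\<kappa> > 0"
  obtains C t0 where "C > 0" "0 < t0" "t0 < 1" 
    "\<And>(x::real^'n) t E. 0 < t \<Longrightarrow> t < t0 \<Longrightarrow>
       (\<forall>A\<in>sets borel. E \<inter> ball x t \<subseteq> A \<longrightarrow> ennreal (\<kappa> * t powr N) \<le> emeasure lborel A) \<Longrightarrow>
       ennreal (C * t powr (N - 2*p) * ln (1/t) powr (-(p-1))) \<le> bessel_cap2 p (E \<inter> ball x t)"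
proof -
  have q1: "q > 1"
  proof -
    have "N/(N-2) > 1" using N2 by simp
    with q show ?thesis by linarith
  qed
  have p1: "p > 1" using q1 by (simp add: p_def field_simps)
  have "p - 1 = q / (q-1) - (q-1) / (q-1)" using q1 by (simp add: p_def)
  also have "\<dots> = 1 / (q-1)" unfolding diff_divide_distrib[symmetric] by simp
  finally have "p - 1 = 1 / (q-1)" .
  moreover have "p / q = 1 / (q-1)" "1/p + 1/q = 1"
    using q1 by (simp_all add: p_def flip: add_divide_distrib)
  ultimately have pq: "1/p + 1/q = 1" "p / q = p - 1" by simp_all
  obtain B t0 where B: "B > 0" "0 < t0" "t0 < 1"
    "\<And>(x::real^'n) t. 0 < t \<Longrightarrow> t < t0 \<Longrightarrow> \<exists>b. b \<in> borel_measurable borel \<and> (\<forall>z. 0 \<le> b z) \<and> 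
      (\<forall>z. bessel_ball_pot x t z \<le> ennreal (b z)) \<and>
      (\<integral>\<^sup>+z. ennreal (b z powr q) \<partial>lborel) \<le> ennreal (B * t powr (2*q+N) * ln (1/t))"
    by (rule bessel_pot_ball_bound[where 'n='n, of q, folded N_def, OF N2 q]) (rule that; assumption)
  \<comment> \<open>With \<open>s powr q = K * t powr (2*q) * l\<close> below, the second term of
    Young's inequality is exactly half of \<open>\<kappa> * t powr N\<close> and can be
    subtracted.\<close>
  define K where "K = 2 * B / (q * \<kappa>)"
  have K: "K > 0" using B k q1 by (simp add: K_def)
  define C where "C = p * \<kappa> / 2 * K powr (-(p-1))"
  show ?thesis
  proof
    show "C > 0" using p1 k K by (simp add: C_def)
    show "0 < t0" "t0 < 1" by fact+
    fix x :: "real^'n" and t E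
    assume t: "0 < t" "t < t0" and E: "\<forall>A\<in>sets borel. E \<inter> ball x t \<subseteq> A \<longrightarrow> ennreal (\<kappa> * t powr N) \<le> emeasure lborel A"
    define l where "l = ln (1/t)"
    have l: "l > 0" using t B by (simp add: l_def)
    obtain b where b[measurable]: "b \<in> borel_measurable borel" and b0: "\<And>z. 0 \<le> b z"
      and bG: "\<And>z. bessel_ball_pot x t z \<le> ennreal (b z)"
      and bi: "(\<integral>\<^sup>+z. ennreal (b z powr q) \<partial>lborel) \<le> ennreal (B * t powr (2*q+N) * l)"
      using B(4)[OF t, of x] unfolding l_def by blast
    define s where "s = (K * t powr (2*q) * l) powr (1/q)"
    have s: "s > 0" using K t l by (simp add: s_def)
    have sq: "s powr q = K * t powr (2*q) * l" using K t l q1 by (simp add: s_def powr_powr)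
    have sp: "s powr p = K powr (p-1) * t powr (2*p) * l powr (p-1)"
    proof -
      have "s powr p = (K * t powr (2*q) * l) powr (p-1)"
        using pq by (simp add: s_def powr_powr)
      also have "\<dots> = K powr (p-1) * t powr (2*q*(p-1)) * l powr (p-1)"
        using K l by (simp add: powr_mult powr_powr)
      also have "2*q*(p-1) = 2*p" using pq q1 by (simp add: field_simps)
      finally show ?thesis .
    qed
    show "ennreal (C * t powr (N - 2*p) * ln (1/t) powr (-(p-1))) \<le> bessel_cap2 p (E \<inter> ball x t)"
      unfolding bessel_cap2_def
    proof (rule INF_greatest, safe)
      fix f :: "real^'n \<Rightarrow> real"
      assume fm: "f \<in> borel_measurable lebesgue" and f0: "\<forall>x. 0 \<le> f x" and f1: "\<forall>y\<in>E \<inter> ball x t. 1 \<le> bessel_pot2 f y"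
      obtain g where g[measurable]: "g \<in> borel_measurable lborel" and fg: "AE y in lborel. f y = g y"
        using completion_ex_borel_measurable_real[OF fm] by blast
      \<comment> \<open>\<open>E\<close> need not be measurable. The Borel set where the potential
        reaches 1 covers its part in the ball, so the assumed lower bound applies to it.\<close>
      define A where "A = {y \<in> ball x t. 1 \<le> (\<integral>\<^sup>+z. bessel_G2 (y - z) * ennreal (g z) \<partial>lborel)}"
      have pot: "bessel_pot2 f y = (\<integral>\<^sup>+z. bessel_G2 (y - z) * ennreal (g z) \<partial>lborel)" for y
        unfolding bessel_pot2_def nn_integral_completion
        by (intro nn_integral_cong_AE) (use fg in eventually_elim, simp)
      have Am[measurable]: "A \<in> sets borel" unfolding A_def by measurable
      have [measurable]: "Measurable.pred (borel \<Otimes>\<^sub>M borel) (\<lambda>w::(real^'n) \<times> (real^'n). fst w \<in> ball x t)"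
        unfolding mem_ball by measurable
      have "ennreal (\<kappa> * t powr N) \<le> emeasure lborel A"
        using f1 pot by (intro E[rule_format]) (auto simp: A_def)
      also have "\<dots> = (\<integral>\<^sup>+y. indicator A y \<partial>lborel)" by simp
      also have "\<dots> \<le> (\<integral>\<^sup>+y. (\<integral>\<^sup>+z. bessel_G2 (y - z) * ennreal (g z) * indicator (ball x t) y \<partial>lborel) \<partial>lborel)"
        by (intro nn_integral_mono) (auto simp: A_def split: split_indicator)
      also have "\<dots> = (\<integral>\<^sup>+z. (\<integral>\<^sup>+y. bessel_G2 (y - z) * ennreal (g z) * indicator (ball x t) y \<partial>lborel) \<partial>lborel)"
        by (rule lborel_pair.Fubini'[symmetric]) measurable
      \<comment> \<open>Duality: testing the potential of \<open>f\<close> on the ball amounts to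
        testing \<open>f\<close> against the potential of the ball.\<close>
      also have "\<dots> = (\<integral>\<^sup>+z. ennreal (g z) * bessel_ball_pot x t z \<partial>lborel)"
      proof (rule nn_integral_cong)
        fix z :: "real^'n"
        have "(\<lambda>y. bessel_G2 (y - z) * indicator (ball x t) y) \<in> borel_measurable lborel"
          by (intro borel_measurable_times_ennreal borel_measurable_indicator) auto
        then show "(\<integral>\<^sup>+y. bessel_G2 (y - z) * ennreal (g z) * indicator (ball x t) y \<partial>lborel)
            = ennreal (g z) * bessel_ball_pot x t z"
          by (subst nn_integral_cmult[symmetric]) (auto simp: ac_simps)
      qed
      also have "\<dots> \<le> (\<integral>\<^sup>+z. ennreal (g z) * ennreal (b z) \<partial>lborel)"
        by (intro nn_integral_mono mult_left_mono bG) auto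
      also have "\<dots> \<le> (\<integral>\<^sup>+z. ennreal (s powr p / p) * ennreal (g z powr p) + ennreal (1 / (q * s powr q)) * ennreal (b z powr q) \<partial>lborel)"
      proof (rule nn_integral_mono_AE, use fg in eventually_elim)
        fix z assume "f z = g z"
        then have gz: "g z \<ge> 0" using f0 by metis
        have "g z * b z = (s * g z) * (b z / s)" using s by simp
        also have "\<dots> \<le> (s * g z) powr p / p + (b z / s) powr q / q"
          using p1 q1 pq gz b0 s by (intro Youngs_inequality) auto
        also have "\<dots> = s powr p / p * (g z powr p) + 1 / (q * s powr q) * (b z powr q)"
          using s gz b0 by (simp add: powr_mult powr_divide)
        finally show "ennreal (g z) * ennreal (b z) \<le> ennreal (s powr p / p) * ennreal (g z powr p) + ennreal (1 / (q * s powr q)) * ennreal (b z powr q)"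
          using gz b0 p1 q1 by (simp flip: ennreal_mult ennreal_plus add: ennreal_leI)
      qed
      also have "\<dots> = ennreal (s powr p / p) * (\<integral>\<^sup>+z. ennreal (g z powr p) \<partial>lborel) +
          ennreal (1 / (q * s powr q)) * (\<integral>\<^sup>+z. ennreal (b z powr q) \<partial>lborel)"
        by (subst nn_integral_add) (auto simp: nn_integral_cmult)
      also have "\<dots> \<le> ennreal (s powr p / p) * (\<integral>\<^sup>+z. ennreal (g z powr p) \<partial>lborel) +
          ennreal (1 / (q * s powr q)) * ennreal (B * t powr (2*q+N) * l)"
        by (intro add_left_mono mult_left_mono bi) auto
      also have "ennreal (1 / (q * s powr q)) * ennreal (B * t powr (2*q+N) * l) = ennreal (\<kappa> * t powr N / 2)"
        using B t l k q1 by (simp add: sq K_def powr_add flip: ennreal_mult)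
      finally have main: "ennreal (\<kappa> * t powr N) \<le> ennreal (s powr p / p) * (\<integral>\<^sup>+z. ennreal (g z powr p) \<partial>lborel) + ennreal (\<kappa> * t powr N / 2)" .
      have "(\<integral>\<^sup>+ y. ennreal (f y powr p) \<partial>lebesgue) = (\<integral>\<^sup>+z. ennreal (g z powr p) \<partial>lborel)"
        unfolding nn_integral_completion by (intro nn_integral_cong_AE) (use fg in eventually_elim, simp)
      moreover have "ennreal (C * t powr (N - 2*p) * l powr (-(p-1))) \<le> (\<integral>\<^sup>+z. ennreal (g z powr p) \<partial>lborel)"
      proof (cases "(\<integral>\<^sup>+z. ennreal (g z powr p) \<partial>lborel)")
        case (real r)
        have "\<kappa> * t powr N \<le> s powr p / p * r + \<kappa> * t powr N / 2"
          using main real k p1 by (simp flip: ennreal_mult ennreal_plus)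
        then have "p * \<kappa> / 2 * t powr N \<le> s powr p * r" using p1 by (simp add: field_simps)
        then have "p * \<kappa> / 2 * t powr N * s powr (-p) \<le> r" using s by (simp add: powr_minus field_simps)
        moreover have "s powr (-p) = K powr (-(p-1)) * t powr (-2*p) * l powr (-(p-1))"
          unfolding powr_minus[of s] sp by (simp add: powr_minus[symmetric])
        ultimately have "C * t powr (N - 2*p) * l powr (-(p-1)) \<le> r"
          by (simp add: C_def ac_simps powr_add[symmetric] diff_conv_add_uminus del: minus_diff_eq add_uminus_conv_diff)
        then show ?thesis using real by (simp add: ennreal_leI)
      qed simp
      ultimately show "ennreal (C * t powr (N - 2*p) * ln (1/t) powr (-(p-1))) \<le> (\<integral>\<^sup>+ y. ennreal (f y powr p) \<partial>lebesgue)"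
        by (simp add: l_def)
    qed
  qed
qed

text \<open>The antiderivative \<open>- c * ln (- ln t)\<close> is unbounded below at 0.\<close>

lemma nn_integral_inverse_log:
  fixes t0 c :: real
  assumes t0: "0 < t0" "t0 < 1" and c: "c > 0"
  shows "(\<integral>\<^sup>+t. ennreal (c / (t * ln (1/t))) * indicator {0<..<t0} t \<partial>lborel) = \<infinity>"
proof -
  define a where "a = t0 / 2"
  have a: "0 < a" "a < t0" "a < 1" using t0 by (auto simp: a_def)
  define F where "F t = - c * ln (- ln t)" for t :: real
  have ge: "ennreal (F a - F s) \<le> (\<integral>\<^sup>+t. ennreal (c / (t * ln (1/t))) * indicator {0<..<t0} t \<partial>lborel)"
    if "0 < s" "s < a" for s
  proof -
    have "ennreal (F a - F s) = (\<integral>\<^sup>+t. ennreal (c / (t * ln (1/t))) * indicator {s..a} t \<partial>lborel)"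
    proof (rule nn_integral_FTC_Icc[symmetric])
      fix t assume t: "t \<in> {s..a}"
      then have t': "0 < t" "t < 1" using that a by auto
      then have "ln t < 0" by simp
      then show "(F has_real_derivative c / (t * ln (1 / t))) (at t)" 
        unfolding F_def using t'
        by (auto intro!: derivative_eq_intros simp: ln_div field_simps)
      show "0 \<le> c / (t * ln (1 / t))"
        using t' c by (intro divide_nonneg_nonneg mult_nonneg_nonneg ln_ge_zero) auto
    qed (use that in auto)
    also have "\<dots> \<le> (\<integral>\<^sup>+t. ennreal (c / (t * ln (1/t))) * indicator {0<..<t0} t \<partial>lborel)"
      using that a by (intro nn_integral_mono mult_left_mono) (auto split: split_indicator)
    finally show ?thesis .
  qed
  have lim: "filterlim (\<lambda>s. F a - F s) at_top (at_right 0)"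
    unfolding F_def using c by real_asymp
  show ?thesis
  proof (rule ccontr)
    assume "(\<integral>\<^sup>+t. ennreal (c / (t * ln (1/t))) * indicator {0<..<t0} t \<partial>lborel) \<noteq> \<infinity>"
    then obtain r where r: "r \<ge> 0" "(\<integral>\<^sup>+t. ennreal (c / (t * ln (1/t))) * indicator {0<..<t0} t \<partial>lborel) = ennreal r"
      by (cases "(\<integral>\<^sup>+t. ennreal (c / (t * ln (1/t))) * indicator {0<..<t0} t \<partial>lborel)") auto
    have "eventually (\<lambda>s. F a - F s > r) (at_right 0)"
      using lim by (simp add: filterlim_at_top_dense)
    moreover have "eventually (\<lambda>s. 0 < s \<and> s < a) (at_right 0)"
      using a by (auto simp: eventually_at_right_field)
    ultimately have "eventually (\<lambda>s. False) (at_right (0::real))"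
    proof eventually_elim
      case (elim s)
      have "ennreal (F a - F s) \<le> ennreal r" using ge[of s] elim r by auto
      then show False using elim r by simp
    qed
    then show False by simp
  qed
qed

text \<open>Otherwise \<open>bessel_cap2_lower\<close> applies at every small radius; after taking
  the power \<open>1 / (p-1)\<close> the Wiener integrand is at least
  \<open>c / (t * ln (1/t))\<close>, whose integral diverges. The cover \<open>U\<close> stands for
  outer measure, and the form of the conclusion is that of
  \<open>negligible_eq_zero_density_alt\<close>.\<close>

lemma thin2_imp_small_density:
  fixes q :: real and E :: "(real^'n::finite) set"
  assumes N2: "real CARD('n) > 2" and q: "q \<ge> real CARD('n) / (real CARD('n)-2)"
    and thin: "thin2 (q / (q-1)) E x" and r: "r > 0" and e: "e > 0"
  shows "\<exists>d U. 0 < d \<and> d \<le> r \<and> E \<inter> ball x d \<subseteq> U \<and> U \<in> lmeasurable \<and> measure lebesgue U < e * measure lebesgue (ball x d)"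
proof (rule ccontr)
  assume neg: "\<not> ?thesis"
  define N where "N = real CARD('n)"
  define p where "p = q / (q-1)"
  have q1: "q > 1"
  proof -
    have "real CARD('n) / (real CARD('n)-2) > 1" using N2 by simp
    with q show ?thesis by linarith
  qed
  have p1: "p > 1" using q1 by (simp add: p_def field_simps)
  define V where "V = unit_ball_vol N"
  have V: "V > 0" by (simp add: V_def N_def)
  have big: "ennreal (e * V * d powr N) \<le> emeasure lborel A"
    if "0 < d" "d \<le> r" "A \<in> sets borel" "E \<inter> ball x d \<subseteq> A" for d A
  proof (cases "emeasure lborel A = \<infinity>")
    case False
    then have "A \<in> lmeasurable" using that by (intro fmeasurableI) (auto simp: less_top)
    then have "measure lebesgue A \<ge> e * measure lebesgue (ball x d)"
      using neg that by (meson not_le)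
    moreover have "measure lebesgue (ball x d) = V * d powr N"
      using that content_ball[of d x] by (simp add: V_def N_def powr_realpow)
    moreover have "emeasure lborel A = ennreal (measure lebesgue A)"
      using False that by (simp add: emeasure_eq_ennreal_measure)
    ultimately show ?thesis by (simp add: ennreal_leI mult.assoc)
  qed simp
  obtain C t1 where C: "C > 0" "0 < t1" "t1 < 1" 
    "\<And>(x::real^'n) t E. 0 < t \<Longrightarrow> t < t1 \<Longrightarrow>
       (\<forall>A\<in>sets borel. E \<inter> ball x t \<subseteq> A \<longrightarrow> ennreal (e * V * t powr N) \<le> emeasure lborel A) \<Longrightarrow>
       ennreal (C * t powr (N - 2*p) * ln (1/t) powr (-(p-1))) \<le> bessel_cap2 p (E \<inter> ball x t)"
    by (rule bessel_cap2_lower[where 'n='n, of q "e * V", folded N_def p_def, OF N2[folded N_def] q[folded N_def] mult_pos_pos[OF e V]])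
       (rule that; assumption)
  define t0 where "t0 = min t1 r"
  have t0: "0 < t0" "t0 < 1" using C r by (auto simp: t0_def)
  define c where "c = C powr (1/(p-1))"
  have c: "c > 0" using C by (simp add: c_def)
  have "\<infinity> = (\<integral>\<^sup>+t. ennreal (c / (t * ln (1/t))) * indicator {0<..<t0} t \<partial>lborel)"
    using nn_integral_inverse_log[OF t0 c] by simp
  also have "\<dots> \<le> wiener2 p E x"
    unfolding wiener2_def
  proof (rule nn_integral_mono)
    fix t :: real
    show "ennreal (c / (t * ln (1/t))) * indicator {0<..<t0} t \<le> indicator {0<..<1} t *
      ennreal ((enn2real (bessel_cap2 p (E \<inter> ball x t)) / t powr (real CARD('n) - 2 * p)) powr (1 / (p - 1)) / t)"
    proof (cases "0 < t \<and> t < t0")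
      case True
      then have t: "0 < t" "t < t1" "t \<le> r" "t < 1" using t0 by (auto simp: t0_def)
      define l where "l = ln (1/t)"
      have l: "l > 0" using t by (simp add: l_def)
      have "ennreal (C * t powr (N - 2*p) * l powr (-(p-1))) \<le> bessel_cap2 p (E \<inter> ball x t)"
        unfolding l_def using t big by (intro C(4)) auto
      moreover have "bessel_cap2 p (E \<inter> ball x t) < \<infinity>"
        using bessel_cap2_mono[of "E \<inter> ball x t" "ball x t" p] bessel_cap2_ball_finite[OF t(1), of p x] by auto
      ultimately have "C * t powr (N - 2*p) * l powr (-(p-1)) \<le> enn2real (bessel_cap2 p (E \<inter> ball x t))"
        by (cases "bessel_cap2 p (E \<inter> ball x t)") auto
      then have "C * l powr (-(p-1)) \<le> enn2real (bessel_cap2 p (E \<inter> ball x t)) / t powr (N - 2*p)"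
        using t by (simp add: field_simps)
      then have "(C * l powr (-(p-1))) powr (1/(p-1)) \<le> (enn2real (bessel_cap2 p (E \<inter> ball x t)) / t powr (N - 2*p)) powr (1/(p-1))"
        using C p1 by (intro powr_mono2) auto
      moreover have "(C * l powr (-(p-1))) powr (1/(p-1)) = c / l"
      proof -
        have "-(p-1) * (1/(p-1)) = -1" using p1 by (simp add: divide_simps)
        then have "(l powr (-(p-1))) powr (1/(p-1)) = 1 / l"
          unfolding powr_powr using l by (simp add: powr_minus_divide)
        then show ?thesis using C by (simp add: powr_mult c_def)
      qed
      ultimately have "c / l / t \<le> (enn2real (bessel_cap2 p (E \<inter> ball x t)) / t powr (N - 2*p)) powr (1/(p-1)) / t"
        using t by (intro divide_right_mono) auto
      then show ?thesis using True t by (simp add: l_def N_def ennreal_leI mult.commute)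
    qed auto
  qed
  finally show False using thin by (simp add: thin2_def p_def)
qed

section \<open>Measurability of finely closed sets and vanishing off the fine support\<close>

lemma measure_Un_negligible:
  assumes "U \<in> lmeasurable" "negligible W"
  shows "U \<union> W \<in> lmeasurable" "measure lebesgue (U \<union> W) = measure lebesgue U"
  using assms by (simp_all add: negligible_iff_null_sets measure_Un_null_set fmeasurableD
      fmeasurable.Un fmeasurableI_null_sets)

text \<open>\<open>F\<close> is compared with a measurable hull \<open>H\<close> and shown to differ
  from it by a null set. Boundedness keeps the measure of \<open>H\<close> finite, so that measures
  can be subtracted.\<close>

lemma finely_closed_imp_lebesgue_measurable:
  fixes q :: real and F :: "(real^'n::finite) set"
  assumes N2: "real CARD('n) > 2" and q: "q \<ge> real CARD('n) / (real CARD('n)-2)"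
    and F: "finely_closed (q / (q-1)) F" and bdd: "F \<subseteq> ball a R"
  shows "F \<in> sets lebesgue"
proof -
  obtain H0 where H0: "H0 \<in> sets lebesgue" "F \<subseteq> H0" "outer_measure_of lebesgue F = emeasure lebesgue H0"
    using outer_measure_of_attain[of F lebesgue] by auto
  define H where "H = H0 \<inter> ball a R"
  have H: "H \<in> sets lebesgue" "F \<subseteq> H" using H0 bdd by (auto simp: H_def)
  have min: "emeasure lebesgue H \<le> emeasure lebesgue A" if "A \<in> sets lebesgue" "F \<subseteq> A" for A
  proof -
    have "emeasure lebesgue H \<le> emeasure lebesgue H0" using H0 by (intro emeasure_mono) (auto simp: H_def)
    also have "\<dots> \<le> emeasure lebesgue A" using that H0(3) outer_measure_of_mono[of F A lebesgue] by simp
    finally show ?thesis .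
  qed
  have Hl: "H \<in> lmeasurable"
    using H(1) unfolding H_def by (intro bounded_set_imp_lmeasurable) auto
  \<comment> \<open>\<open>F\<close> is thin at every point of \<open>H - F\<close>, and by minimality of \<open>H\<close> small density of \<open>F\<close> is small density of \<open>H\<close>.\<close>
  have "negligible (H - F)"
    unfolding negligible_eq_zero_density_alt
  proof (intro ballI allI impI)
    fix x and e :: real assume x: "x \<in> H - F" and e: "e > 0"
    have "thin2 (q / (q-1)) F x"
      using F x by (auto simp: finely_closed_def finely_open_def)
    from thin2_imp_small_density[OF N2 q this e e]
    obtain d U where dU: "0 < d" "d \<le> e" "F \<inter> ball x d \<subseteq> U" "U \<in> lmeasurable" "measure lebesgue U < e * measure lebesgue (ball x d)"
      by blast
    \<comment> \<open>\<open>H - W\<close> is still a measurable superset of \<open>F\<close>, so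
      minimality of \<open>H\<close> makes \<open>W\<close> null.\<close>
    define W where "W = H \<inter> ball x d - U"
    have W: "W \<in> lmeasurable" unfolding W_def
      using Hl dU by (intro fmeasurable_Diff fmeasurable_Int_fmeasurable) (auto simp: fmeasurableD)
    have "emeasure lebesgue H \<le> emeasure lebesgue (H - W)"
      using H W dU by (intro min) (auto simp: W_def)
    then have "measure lebesgue H \<le> measure lebesgue (H - W)"
      using Hl W by (simp add: emeasure_eq_measure2 fmeasurable.Diff)
    moreover have "measure lebesgue (H - W) = measure lebesgue H - measure lebesgue W"
      using Hl W by (intro measurable_measure_Diff) (auto simp: W_def)
    ultimately have "measure lebesgue W = 0" using measure_nonneg[of lebesgue W] by linarith
    then have "negligible W" using W by (simp add: negligible_iff_measure0)
    then have "U \<union> W \<in> lmeasurable" "measure lebesgue (U \<union> W) = measure lebesgue U"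
      using measure_Un_negligible[OF dU(4)] by auto
    moreover have "(H - F) \<inter> ball x d \<subseteq> U \<union> W" by (auto simp: W_def)
    ultimately show "\<exists>d U. 0 < d \<and> d \<le> e \<and> (H - F) \<inter> ball x d \<subseteq> U \<and> U \<in> lmeasurable \<and> measure lebesgue U < e * measure lebesgue (ball x d)"
      using dU by (intro exI[of _ d] exI[of _ "U \<union> W"] conjI) (assumption | simp)+
  qed
  then have "H - F \<in> sets lebesgue" by (simp add: negligible_imp_sets)
  then have "H - (H - F) \<in> sets lebesgue" using H by auto
  moreover have "H - (H - F) = F" using H by auto
  ultimately show ?thesis by simp
qed

text \<open>For each bad point a single finely closed set \<open>E\<close> missing it suffices:
  \<open>E\<close> is thin there, and outside \<open>E\<close> the bad set is null. So the bad set
  has small density at each of its own points, and no null sets need to be united over all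
  \<open>E\<close>.\<close>

lemma AE_eq_0_off_fine_supp:
  fixes q :: real and h :: "real^'n::finite \<Rightarrow> real"
  assumes N2: "real CARD('n) > 2" and q: "q \<ge> real CARD('n) / (real CARD('n)-2)"
  shows "AE x in lebesgue. x \<notin> fine_supp (q / (q-1)) h \<longrightarrow> h x = 0"
proof -
  define P where "P = {x. x \<notin> fine_supp (q / (q-1)) h \<and> h x \<noteq> 0}"
  have "negligible P"
    unfolding negligible_eq_zero_density_alt
  proof (intro ballI allI impI)
    fix x and e :: real assume x: "x \<in> P" and e: "e > 0"
    then obtain E where E: "finely_closed (q / (q-1)) E" "AE x in lebesgue. x \<notin> E \<longrightarrow> h x = 0" "x \<notin> E"
      by (auto simp: P_def fine_supp_def)
    have "thin2 (q / (q-1)) E x"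
      using E by (auto simp: finely_closed_def finely_open_def)
    from thin2_imp_small_density[OF N2 q this e e]
    obtain d U where dU: "0 < d" "d \<le> e" "E \<inter> ball x d \<subseteq> U" "U \<in> lmeasurable" "measure lebesgue U < e * measure lebesgue (ball x d)"
      by blast
    obtain W0 where "W0 \<in> null_sets lebesgue" "{x. \<not> (x \<notin> E \<longrightarrow> h x = 0)} \<subseteq> W0"
      using E(2) by (auto simp: eventually_ae_filter)
    then have neg: "negligible {x. \<not> (x \<notin> E \<longrightarrow> h x = 0)}"
      using negligible_subset negligible_iff_null_sets by blast
    let ?W = "{x. \<not> (x \<notin> E \<longrightarrow> h x = 0)}"
    have "U \<union> ?W \<in> lmeasurable" "measure lebesgue (U \<union> ?W) = measure lebesgue U"
      using measure_Un_negligible[OF dU(4) neg] by auto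
    moreover have "P \<inter> ball x d \<subseteq> U \<union> ?W" using dU(3) by (auto simp: P_def)
    ultimately show "\<exists>d U. 0 < d \<and> d \<le> e \<and> P \<inter> ball x d \<subseteq> U \<and> U \<in> lmeasurable \<and> measure lebesgue U < e * measure lebesgue (ball x d)"
      using dU by (intro exI[of _ d] exI[of _ "U \<union> ?W"] conjI) (assumption | simp)+
  qed
  then have "AE x in lebesgue. x \<notin> P"
    by (simp add: negligible_iff_null_sets AE_not_in)
  then show ?thesis by eventually_elim (auto simp: P_def)
qed

section \<open>Smooth bumps\<close>

definition smooth_real :: "(real \<Rightarrow> real) \<Rightarrow> bool" where
  "smooth_real f \<longleftrightarrow> (\<forall>n x. (deriv ^^ n) f differentiable at x)"

text \<open>A coinduction principle: a class closed under differentiation contains all iterated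
  derivatives of its members.\<close>

lemma smooth_realI:
  assumes S: "\<And>f. f \<in> S \<Longrightarrow> \<exists>f'\<in>S. \<forall>x. (f has_real_derivative f' x) (at x)" and f: "f \<in> S"
  shows "smooth_real f"
proof -
  have der: "deriv g \<in> S" "g differentiable at x" if "g \<in> S" for g and x :: real
  proof -
    from S[OF that] obtain g' where g': "g' \<in> S" "\<forall>x. (g has_real_derivative g' x) (at x)" by blast
    then have "deriv g = g'" by (intro ext DERIV_imp_deriv) auto
    then show "deriv g \<in> S" using g' by simp
    show "g differentiable at x" using g' real_differentiable_def by blast
  qed
  have "(deriv ^^ n) f \<in> S" for n by (induction n) (auto simp: f der)
  then show ?thesis using der by (auto simp: smooth_real_def)
qed

lemma smooth_real_deriv: "smooth_real f \<Longrightarrow> smooth_real (deriv f)"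
  unfolding smooth_real_def by (metis comp_apply funpow_Suc_right)

lemma smooth_real_DERIV: "smooth_real f \<Longrightarrow> (f has_real_derivative deriv f x) (at x)"
  unfolding smooth_real_def by (metis DERIV_deriv_iff_real_differentiable funpow_0)

lemma smooth_real_continuous: "smooth_real f \<Longrightarrow> continuous_on A f"
  by (meson DERIV_isCont continuous_at_imp_continuous_on smooth_real_DERIV)

lemma tendsto_power_poly_exp: "((\<lambda>y::real. y ^ n * poly p y * exp (-y)) \<longlongrightarrow> 0) at_top"
proof (induction p arbitrary: n)
  case 0
  then show ?case by simp
next
  case (pCons a p)
  have "((\<lambda>y::real. a * (y ^ n / exp y) + y ^ Suc n * poly p y * exp (-y)) \<longlongrightarrow> a * 0 + 0) at_top"
    by (intro tendsto_add tendsto_mult tendsto_const tendsto_power_div_exp_0 pCons.IH)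
  then show ?case by (simp add: exp_minus field_simps)
qed

definition flat :: "real poly \<Rightarrow> real \<Rightarrow> real" where
  "flat p x = (if x > 0 then poly p (1/x) * exp (-1/x) else 0)"

text \<open>For \<open>x > 0\<close> differentiation produces the factor \<open>1/x\<^sup>2\<close>,
  which is the polynomial \<open>[:0,0,1:]\<close> at \<open>1/x\<close>. At 0 the right difference
  quotients vanish in the limit by \<open>tendsto_power_poly_exp\<close>.\<close>

lemma flat_DERIV: "(flat p has_real_derivative flat ([:0,0,1:] * (p - pderiv p)) x) (at x)"
proof -
  consider "x > 0" | "x < 0" | "x = 0" by linarith
  then show ?thesis
  proof cases
    case 1
    have "((\<lambda>x. poly p (1/x) * exp (-1/x)) has_real_derivative flat ([:0,0,1:] * (p - pderiv p)) x) (at x)"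
      using 1 by (auto intro!: derivative_eq_intros DERIV_chain'[of "\<lambda>x. 1/x" _ x _ "poly p"] poly_DERIV
          simp: flat_def field_simps power2_eq_square)
    then show ?thesis
      by (rule has_field_derivative_transform_within_open[where S="{0<..}"]) (use 1 in \<open>auto simp: flat_def\<close>)
  next
    case 2
    have "((\<lambda>x. 0) has_real_derivative flat ([:0,0,1:] * (p - pderiv p)) x) (at x)"
      using 2 by (simp add: flat_def)
    then show ?thesis
      by (rule has_field_derivative_transform_within_open[where S="{..<0}"]) (use 2 in \<open>auto simp: flat_def\<close>)
  next
    case 3
    have "((\<lambda>h. (flat p h - flat p 0) / h) \<longlongrightarrow> 0) (at 0)"
      unfolding filterlim_at_split
    proof
      have "((\<lambda>h. (flat p h - flat p 0) / h) \<longlongrightarrow> 0) (at_left 0) \<longleftrightarrow> ((\<lambda>h::real. 0::real) \<longlongrightarrow> 0) (at_left 0)"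
        by (intro filterlim_cong refl eventually_mono[OF eventually_at_left_real[of "-1" 0]]) (auto simp: flat_def)
      then show "((\<lambda>h. (flat p h - flat p 0) / h) \<longlongrightarrow> 0) (at_left 0)" by simp
      have "((\<lambda>h. (inverse h) ^ 1 * poly p (inverse h) * exp (- inverse h)) \<longlongrightarrow> 0) (at_right (0::real))"
        by (rule filterlim_compose[OF tendsto_power_poly_exp filterlim_inverse_at_top_right])
      moreover have "((\<lambda>h. (flat p h - flat p 0) / h) \<longlongrightarrow> 0) (at_right 0) \<longleftrightarrow> ((\<lambda>h. (inverse h) ^ 1 * poly p (inverse h) * exp (- inverse h)) \<longlongrightarrow> 0) (at_right (0::real))"
        by (intro filterlim_cong refl eventually_mono[OF eventually_at_right_less[of 0]]) (auto simp: flat_def divide_inverse)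
      ultimately show "((\<lambda>h. (flat p h - flat p 0) / h) \<longlongrightarrow> 0) (at_right 0)" by simp
    qed
    then show ?thesis using 3 by (simp add: DERIV_def flat_def)
  qed
qed

text \<open>Large \<open>k\<close> drives the profile to the indicator of the open interval, see
  \<open>bump_tendsto\<close>; the mollifiers use \<open>k = 1\<close>.\<close>

definition bump :: "real \<Rightarrow> real \<Rightarrow> real \<Rightarrow> real \<Rightarrow> real" where
  "bump k a b x = flat 1 (k * (x - a)) * flat 1 (k * (b - x))"

text \<open>A family containing the bumps and closed under differentiation, as \<open>smooth_realI\<close> asks for.\<close>

inductive_set bump_space :: "real \<Rightarrow> real \<Rightarrow> real \<Rightarrow> (real \<Rightarrow> real) set" for k a b where
  base: "(\<lambda>x. c * flat p (k * (x - a)) * flat r (k * (b - x))) \<in> bump_space k a b"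
| add: "f \<in> bump_space k a b \<Longrightarrow> g \<in> bump_space k a b \<Longrightarrow> (\<lambda>x. f x + g x) \<in> bump_space k a b"

lemma smooth_bump: "smooth_real (bump k a b)"
proof (rule smooth_realI[where S="bump_space k a b"])
  show "bump k a b \<in> bump_space k a b"
    unfolding bump_def using bump_space.base[of 1 1 k a 1 b] by simp
  fix f assume "f \<in> bump_space k a b"
  then show "\<exists>f'\<in>bump_space k a b. \<forall>x. (f has_real_derivative f' x) (at x)"
  proof induction
    case (base c p r)
    let ?D = "\<lambda>p::real poly. [:0,0,1:] * (p - pderiv p)"
    let ?f' = "\<lambda>x. (c * k) * flat (?D p) (k * (x - a)) * flat r (k * (b - x)) + (- c * k) * flat p (k * (x - a)) * flat (?D r) (k * (b - x))"
    have "((\<lambda>x. c * flat p (k * (x - a)) * flat r (k * (b - x))) has_real_derivative ?f' x) (at x)" for x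
    proof -
      have 1: "((\<lambda>x. flat p (k * (x - a))) has_real_derivative flat (?D p) (k * (x - a)) * k) (at x)"
        by (rule DERIV_chain'[OF _ flat_DERIV]) (auto intro!: derivative_eq_intros)
      have 2: "((\<lambda>x. flat r (k * (b - x))) has_real_derivative flat (?D r) (k * (b - x)) * (-k)) (at x)"
        by (rule DERIV_chain'[OF _ flat_DERIV]) (auto intro!: derivative_eq_intros)
      show ?thesis
        by (rule DERIV_cong, rule DERIV_mult[OF DERIV_cmult[OF 1] 2]) (simp add: algebra_simps)
    qed
    moreover have "?f' \<in> bump_space k a b" by (intro bump_space.intros)
    ultimately show ?case by (intro bexI[of _ ?f'] allI)
  next
    case (add f g)
    then show ?case by (auto intro!: bexI[OF _ bump_space.add] DERIV_add)
  qed
qed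

lemma bump_range: "0 \<le> bump k a b x" "bump k a b x \<le> 1"
  unfolding bump_def flat_def by (auto intro!: mult_le_one)

lemma bump_eq_0_iff: "k > 0 \<Longrightarrow> bump k a b x = 0 \<longleftrightarrow> x \<le> a \<or> b \<le> x"
  by (auto simp: bump_def flat_def zero_less_mult_iff)

lemma bump_tendsto: "(\<lambda>n. bump (real (Suc n)) a b x) \<longlonglongrightarrow> indicator {a<..<b} x"
proof (cases "a < x \<and> x < b")
  case True
  have "(\<lambda>n. exp (-1 / (real (Suc n) * (x - a))) * exp (-1 / (real (Suc n) * (b - x)))) \<longlonglongrightarrow> exp (-(0 / (x - a))) * exp (-(0 / (b - x)))"
  proof (intro tendsto_mult tendsto_exp)
    have "(\<lambda>n. -((1 / real (Suc n)) / c)) \<longlonglongrightarrow> -(0 / c)" for c :: real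
    proof (cases "c = 0")
      case False
      then show ?thesis unfolding divide_inverse[of 1] mult_1
        by (intro tendsto_minus tendsto_divide LIMSEQ_inverse_real_of_nat tendsto_const)
    qed simp
    then show "(\<lambda>n. -1 / (real (Suc n) * (x - a))) \<longlonglongrightarrow> -(0 / (x - a))" "(\<lambda>n. -1 / (real (Suc n) * (b - x))) \<longlonglongrightarrow> -(0 / (b - x))"
      by simp_all
  qed
  then show ?thesis using True by (simp add: bump_def flat_def zero_less_mult_iff)
next
  case False
  then have "bump (real (Suc n)) a b x = 0" for n by (subst bump_eq_0_iff) auto
  then show ?thesis using False by simp
qed

section \<open>Tensor products of smooth functions of one variable\<close>

definition prod_fun :: "real \<Rightarrow> ('n::finite \<Rightarrow> real \<Rightarrow> real) \<Rightarrow> real^'n \<Rightarrow> real" where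
  "prod_fun c B x = c * (\<Prod>j\<in>UNIV. B j (x $ j))"

text \<open>A partial derivative replaces one factor and stays in the class, so smoothness in
  several variables reduces to that of the factors.\<close>

lemma prod_fun_DERIV:
  fixes B :: "'n::finite \<Rightarrow> real \<Rightarrow> real"
  assumes "\<And>j. smooth_real (B j)"
  shows "((\<lambda>t. prod_fun c B (x + t *\<^sub>R axis i 1)) has_real_derivative prod_fun c (B(i := deriv (B i))) x) (at 0)"
proof -
  have split: "prod_fun c B (x + t *\<^sub>R axis i 1) = c * (B i (x $ i + t) * (\<Prod>j\<in>UNIV - {i}. B j (x $ j)))" for B and t
  proof -
    have "prod_fun c B (x + t *\<^sub>R axis i 1) = c * (B i ((x + t *\<^sub>R axis i 1) $ i) * (\<Prod>j\<in>UNIV - {i}. B j ((x + t *\<^sub>R axis i 1) $ j)))"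
      unfolding prod_fun_def by (subst prod.remove[of UNIV i]) auto
    also have "(\<Prod>j\<in>UNIV - {i}. B j ((x + t *\<^sub>R axis i 1) $ j)) = (\<Prod>j\<in>UNIV - {i}. B j (x $ j))"
      by (intro prod.cong) (auto simp: axis_def)
    finally show ?thesis by simp
  qed
  have "((\<lambda>t. B i (x $ i + t)) has_real_derivative deriv (B i) (x $ i + 0)) (at 0)"
    using smooth_real_DERIV[OF assms] by (simp add: DERIV_shift add.commute DERIV_at_within_shift flip: DERIV_shift)
  then have "((\<lambda>t. c * (B i (x $ i + t) * (\<Prod>j\<in>UNIV - {i}. B j (x $ j)))) has_real_derivative c * (deriv (B i) (x $ i + 0) * (\<Prod>j\<in>UNIV - {i}. B j (x $ j)))) (at 0)"
    by (intro DERIV_cmult DERIV_cmult_right)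
  moreover have "c * (deriv (B i) (x $ i + 0) * (\<Prod>j\<in>UNIV - {i}. B j (x $ j))) = prod_fun c (B(i := deriv (B i))) x"
    using split[of "B(i := deriv (B i))" 0] by simp
  ultimately show ?thesis unfolding split by simp
qed

lemma smooth_prod_fun:
  fixes B :: "'n::finite \<Rightarrow> real \<Rightarrow> real"
  assumes "\<And>j. smooth_real (B j)"
  shows "smooth_fun (prod_fun c B)"
proof -
  have iter: "\<exists>B'. (\<forall>j. smooth_real (B' j)) \<and> iter_pd is (prod_fun c B) = prod_fun c B'" for "is"
  proof (induction "is")
    case Nil
    then show ?case using assms by auto
  next
    case (Cons i js)
    then obtain B' where B': "\<And>j. smooth_real (B' j)" "iter_pd js (prod_fun c B) = prod_fun c B'" by blast
    have "iter_pd (i # js) (prod_fun c B) = prod_fun c (B'(i := deriv (B' i)))"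
      by (auto simp: B'(2) pd_def intro!: ext DERIV_imp_deriv prod_fun_DERIV B'(1))
    moreover have "\<forall>j. smooth_real ((B'(i := deriv (B' i))) j)"
      using B'(1) smooth_real_deriv by auto
    ultimately show ?case by blast
  qed
  show ?thesis
    unfolding smooth_fun_def
  proof (intro allI conjI)
    fix "is" :: "'n list"
    obtain B' where B': "\<And>j. smooth_real (B' j)" "iter_pd is (prod_fun c B) = prod_fun c B'" using iter by blast
    show "continuous_on UNIV (iter_pd is (prod_fun c B))"
      unfolding B'(2) prod_fun_def
      by (intro continuous_intros continuous_on_compose2[OF smooth_real_continuous[OF B'(1), of UNIV]]) auto
    show "(\<lambda>t. iter_pd is (prod_fun c B) (x + t *\<^sub>R axis i 1)) differentiable (at 0)" for i x
      unfolding B'(2) using prod_fun_DERIV[of B', OF B'(1)] real_differentiable_def by blast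
  qed
qed

definition box_bump :: "real \<Rightarrow> real \<Rightarrow> real^'n::finite \<Rightarrow> real^'n \<Rightarrow> real^'n \<Rightarrow> real" where
  "box_bump c k a b = prod_fun c (\<lambda>j. bump k (a $ j) (b $ j))"

lemma box_bump_nonzero_iff:
  "c \<noteq> 0 \<Longrightarrow> k > 0 \<Longrightarrow> box_bump c k a b x \<noteq> 0 \<longleftrightarrow> x \<in> box a b"
  by (auto simp: box_bump_def prod_fun_def bump_eq_0_iff mem_box_cart not_le)

lemma box_bump_range: "c \<ge> 0 \<Longrightarrow> 0 \<le> box_bump c k a b x" "c \<ge> 0 \<Longrightarrow> box_bump c k a b x \<le> c"
  by (auto simp: box_bump_def prod_fun_def bump_range prod_nonneg intro!: mult_left_le prod_le_1)

lemma box_bump_support: "closure {x. box_bump c k a b x \<noteq> 0} \<subseteq> cbox a b" if "k > 0"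
proof (rule closure_minimal)
  show "{x. box_bump c k a b x \<noteq> 0} \<subseteq> cbox a b"
  proof (cases "c = 0")
    case True
    then show ?thesis by (simp add: box_bump_def prod_fun_def)
  qed (use that box_subset_cbox in \<open>auto simp: box_bump_nonzero_iff\<close>)
qed (rule closed_cbox)

lemma test_fun_box_bump: "k > 0 \<Longrightarrow> test_fun (box_bump c k a b)"
  unfolding test_fun_def
proof
  show "smooth_fun (box_bump c k a b)"
    unfolding box_bump_def by (intro smooth_prod_fun smooth_bump)
  assume "k > 0"
  then show "compact (closure {x. box_bump c k a b x \<noteq> 0})"
    using box_bump_support[of k c a b] by (meson bounded_cbox bounded_subset closed_closure compact_eq_bounded_closed)
qed

lemma box_bump_tendsto: "(\<lambda>n. box_bump 1 (real (Suc n)) a b x) \<longlonglongrightarrow> indicator (box a b) x"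
proof -
  have "(\<lambda>n. 1 * (\<Prod>j\<in>UNIV. bump (real (Suc n)) (a $ j) (b $ j) (x $ j))) \<longlonglongrightarrow> 1 * (\<Prod>j\<in>UNIV. indicator {a $ j<..<b $ j} (x $ j))"
    by (intro tendsto_mult tendsto_const tendsto_prod bump_tendsto)
  moreover have "1 * (\<Prod>j\<in>UNIV. indicator {a $ j<..<b $ j} (x $ j)) = (indicator (box a b) x :: real)"
    by (auto simp: indicator_def mem_box_cart prod.neutral)
  ultimately show ?thesis by (simp add: box_bump_def prod_fun_def)
qed

section \<open>Directional derivatives and convolution\<close>

text \<open>The derivative is demanded at parameter 0 only. As the base point is arbitrary,
  \<open>has_dd_at\<close> recovers it along the whole line.\<close>

definition has_dd :: "'a::real_normed_vector \<Rightarrow> ('a \<Rightarrow> real) \<Rightarrow> ('a \<Rightarrow> real) \<Rightarrow> bool" where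
  "has_dd v f f' \<longleftrightarrow> (\<forall>x. ((\<lambda>t. f (x + t *\<^sub>R v)) has_real_derivative f' x) (at 0))"

lemma has_dd_at:
  assumes "has_dd v f f'"
  shows "((\<lambda>t. f (x + t *\<^sub>R v)) has_real_derivative f' (x + s *\<^sub>R v)) (at s)"
proof -
  have "((\<lambda>t. f ((x + s *\<^sub>R v) + t *\<^sub>R v)) has_real_derivative f' (x + s *\<^sub>R v)) (at 0)"
    using assms by (simp add: has_dd_def)
  then have "((\<lambda>t. f (x + (t + s) *\<^sub>R v)) has_real_derivative f' (x + s *\<^sub>R v)) (at 0)"
    by (simp add: scaleR_add_left ac_simps)
  then show ?thesis using DERIV_shift[of "\<lambda>t. f (x + t *\<^sub>R v)" _ 0 s] by simp
qed

lemma has_dd_mult: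
  assumes "has_dd v f f'" "has_dd v g g'"
  shows "has_dd v (\<lambda>x. f x * g x) (\<lambda>x. f' x * g x + f x * g' x)"
  unfolding has_dd_def
proof
  fix x
  show "((\<lambda>t. f (x + t *\<^sub>R v) * g (x + t *\<^sub>R v)) has_real_derivative f' x * g x + f x * g' x) (at 0)"
    by (rule DERIV_cong, rule DERIV_mult) (use assms in \<open>auto simp: has_dd_def\<close>)
qed

lemma has_dd_diff:
  "has_dd v f f' \<Longrightarrow> has_dd v g g' \<Longrightarrow> has_dd v (\<lambda>x. f x - g x) (\<lambda>x. f' x - g' x)"
  by (auto simp: has_dd_def intro!: DERIV_diff)

lemma has_dd_compose:
  assumes f: "has_dd v f f'" and F: "\<And>s. (F has_real_derivative F' s) (at s)"
  shows "has_dd v (\<lambda>x. F (f x)) (\<lambda>x. F' (f x) * f' x)"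
  unfolding has_dd_def
proof
  fix x
  show "((\<lambda>t. F (f (x + t *\<^sub>R v))) has_real_derivative F' (f x) * f' x) (at 0)"
    using DERIV_chain'[of "\<lambda>t. f (x + t *\<^sub>R v)" "f' x" 0 UNIV F "F' (f x)"] f F
    by (simp add: has_dd_def mult.commute)
qed

lemma has_dd_bound:
  assumes f: "has_dd v f f'" and M: "\<And>x. \<bar>f' x\<bar> \<le> M"
  shows "\<bar>f (x + t *\<^sub>R v) - f x\<bar> \<le> M * \<bar>t\<bar>"
proof -
  have "norm ((\<lambda>t. f (x + t *\<^sub>R v)) t - (\<lambda>t. f (x + t *\<^sub>R v)) 0) \<le> M * norm (t - 0)"
    by (rule field_differentiable_bound[where S=UNIV and f'="\<lambda>s. f' (x + s *\<^sub>R v)"]) (use has_dd_at[OF f] M in auto)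
  then show ?thesis by simp
qed

lemma has_dd_quotient_tendsto:
  assumes f: "has_dd v f f'" and X: "X \<longlonglongrightarrow> 0" "\<And>n. X n \<noteq> 0"
  shows "(\<lambda>n. (f (x + X n *\<^sub>R v) - f x) / X n) \<longlonglongrightarrow> f' x"
proof -
  have "((\<lambda>t. (f (x + t *\<^sub>R v) - f x) / t) \<longlongrightarrow> f' x) (at 0)"
    using f by (simp add: has_dd_def DERIV_def)
  then have "((\<lambda>t. (f (x + t *\<^sub>R v) - f x) / t) \<circ> X) \<longlonglongrightarrow> f' x"
    unfolding tendsto_at_iff_sequentially using X by auto
  then show ?thesis by (simp add: comp_def)
qed

text \<open>A class without any smoothness that makes all integrals finite and is stable under sums,
  products and continuous functions fixing 0. Derivatives are tracked separately by
  \<open>has_dd\<close>.\<close>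

definition tame :: "('a::euclidean_space \<Rightarrow> real) \<Rightarrow> bool" where
  "tame f \<longleftrightarrow> f \<in> borel_measurable borel \<and> (\<exists>M. \<forall>x. \<bar>f x\<bar> \<le> M) \<and> (\<exists>R. \<forall>x. norm x > R \<longrightarrow> f x = 0)"

lemma tame_measurable: "tame f \<Longrightarrow> f \<in> borel_measurable borel"
  by (simp add: tame_def)

lemma tame_bound:
  assumes "tame f"
  obtains M where "M > 0" "\<And>x. \<bar>f x\<bar> \<le> M"
proof -
  obtain M where M: "\<And>x. \<bar>f x\<bar> \<le> M" using assms by (auto simp: tame_def)
  show ?thesis by (rule that[of "max M 1"]) (auto simp: max_def intro: order_trans[OF M])
qed

lemma tame_support:
  assumes "tame f"
  obtains R where "R > 0" "\<And>x. norm x > R \<Longrightarrow> f x = 0"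
proof -
  obtain R where R: "\<And>x. norm x > R \<Longrightarrow> f x = 0" using assms by (auto simp: tame_def)
  show ?thesis by (rule that[of "max R 1"]) (auto intro: R)
qed

lemma tame_integrable:
  assumes "tame f"
  shows "integrable lborel f"
proof -
  obtain M where M: "\<And>x. \<bar>f x\<bar> \<le> M" using tame_bound[OF assms] by blast
  obtain R where R: "\<And>x. norm x > R \<Longrightarrow> f x = 0" using tame_support[OF assms] by blast
  have "integrable lborel (\<lambda>x::'a. M * indicator (cball 0 R) x)"
    by (intro integrable_mult_right integrable_real_indicator) (auto simp: emeasure_bounded_finite[unfolded infinity_ennreal_def])
  then show ?thesis
  proof (rule Bochner_Integration.integrable_bound)
    show "f \<in> borel_measurable lborel" using tame_measurable[OF assms] by simp
    show "AE x in lborel. norm (f x) \<le> norm (M * indicator (cball 0 R) x)"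
      using M R by (intro AE_I2) (auto simp: indicator_def not_le intro: order_trans[OF M] abs_ge_self)
  qed
qed

lemma tame_mult:
  assumes "tame f" "g \<in> borel_measurable borel" "\<And>x. \<bar>g x\<bar> \<le> M"
  shows "tame (\<lambda>x. f x * g x)"
proof -
  obtain M' where M': "\<And>x. \<bar>f x\<bar> \<le> M'" using tame_bound[OF assms(1)] by blast
  have "\<bar>f x * g x\<bar> \<le> M' * M" for x
    unfolding abs_mult using M' assms(3) by (intro mult_mono) (auto intro: order_trans[OF abs_ge_zero])
  then show ?thesis using assms(1,2) unfolding tame_def by (fastforce intro: borel_measurable_times)
qed

lemma tame_mult_tame:
  assumes "tame f" "tame g"
  shows "tame (\<lambda>x. f x * g x)"
proof -
  obtain M where "\<And>x. \<bar>g x\<bar> \<le> M" using tame_bound[OF assms(2)] by blast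
  then show ?thesis using tame_mult[OF assms(1) tame_measurable[OF assms(2)]] by blast
qed

lemma tame_add:
  assumes "tame f" "tame g"
  shows "tame (\<lambda>x. f x + g x)"
proof -
  obtain M where M: "\<And>x. \<bar>f x\<bar> \<le> M" using tame_bound[OF assms(1)] by blast
  obtain R where R: "\<And>x. norm x > R \<Longrightarrow> f x = 0" using tame_support[OF assms(1)] by blast
  obtain M' where M': "\<And>x. \<bar>g x\<bar> \<le> M'" using tame_bound[OF assms(2)] by blast
  obtain R' where R': "\<And>x. norm x > R' \<Longrightarrow> g x = 0" using tame_support[OF assms(2)] by blast
  have "\<bar>f x + g x\<bar> \<le> M + M'" for x using M[of x] M'[of x] by linarith
  moreover have "norm x > max R R' \<Longrightarrow> f x + g x = 0" for x using R R' by simp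
  moreover have "(\<lambda>x. f x + g x) \<in> borel_measurable borel"
    using assms by (intro borel_measurable_add tame_measurable)
  ultimately show ?thesis unfolding tame_def by blast
qed

lemma tame_compose:
  assumes "tame f" "continuous_on UNIV F" "F 0 = 0"
  shows "tame (\<lambda>x. F (f x))"
proof -
  obtain M where M: "\<And>x. \<bar>f x\<bar> \<le> M" using tame_bound[OF assms(1)] by blast
  have "compact (F ` {-M..M})"
    using assms(2) by (intro compact_continuous_image) (auto intro: continuous_on_subset)
  then obtain B where "\<And>y. y \<in> F ` {-M..M} \<Longrightarrow> norm y \<le> B"
    by (meson compact_imp_bounded bounded_iff)
  then have "\<bar>F (f x)\<bar> \<le> B" for x using M[of x] by (auto simp: abs_le_iff)
  moreover have "(\<lambda>x. F (f x)) \<in> borel_measurable borel"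
    using measurable_compose[OF tame_measurable[OF assms(1)]] borel_measurable_continuous_onI[OF assms(2)] by blast
  ultimately show ?thesis using assms(1,3) unfolding tame_def by metis
qed

lemma tame_uminus: "tame f \<Longrightarrow> tame (\<lambda>x. - f x)"
  by (rule tame_compose[where F=uminus]) (auto intro: continuous_intros)

lemma tame_diff: "tame f \<Longrightarrow> tame g \<Longrightarrow> tame (\<lambda>x. f x - g x)"
  using tame_add[OF _ tame_uminus] by fastforce

section \<open>Translation and reflection of Lebesgue integrals\<close>

lemma integral_lborel_shift:
  fixes f :: "'a::euclidean_space \<Rightarrow> real"
  assumes "f \<in> borel_measurable borel"
  shows "(\<integral>x. f (c + x) \<partial>lborel) = (\<integral>x. f x \<partial>lborel)"
  using assms by (subst (2) lborel_distr_plus[symmetric, of c], subst integral_distr) auto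

lemma integrable_lborel_shift:
  fixes f :: "'a::euclidean_space \<Rightarrow> real"
  assumes "integrable lborel f"
  shows "integrable lborel (\<lambda>x. f (c + x))"
proof -
  have "integrable (distr lborel borel ((+) c)) f" using assms by (simp add: lborel_distr_plus)
  then show ?thesis by (subst (asm) integrable_distr_eq) (use borel_measurable_integrable[OF assms] in auto)
qed

lemma lborel_distr_reflect: "distr lborel borel (\<lambda>x. c - x) = (lborel :: 'a::euclidean_space measure)"
  using lborel_affine[of "-1" c] by (simp add: density_1)

lemma nn_integral_lborel_reflect:
  fixes f :: "'a::euclidean_space \<Rightarrow> ennreal"
  assumes "f \<in> borel_measurable borel"
  shows "(\<integral>\<^sup>+x. f (c - x) \<partial>lborel) = (\<integral>\<^sup>+x. f x \<partial>lborel)"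
  using assms by (subst (2) lborel_distr_reflect[symmetric, of c], subst nn_integral_distr) auto

lemma integral_lborel_reflect:
  fixes f :: "'a::euclidean_space \<Rightarrow> real"
  assumes "f \<in> borel_measurable borel"
  shows "(\<integral>x. f (c - x) \<partial>lborel) = (\<integral>x. f x \<partial>lborel)"
  using assms by (subst (2) lborel_distr_reflect[symmetric, of c], subst integral_distr) auto

text \<open>By translation invariance every difference quotient has integral 0, and dominated
  convergence passes to the derivative. Applied to products this is integration by parts in an
  arbitrary direction.\<close>

lemma integral_dd_eq_0:
  fixes w :: "'a::euclidean_space \<Rightarrow> real"
  assumes w: "tame w" and w': "tame w'" and dd: "has_dd v w w'"
  shows "(\<integral>x. w' x \<partial>lborel) = 0"
proof -
  obtain M where M: "M > 0" "\<And>x. \<bar>w' x\<bar> \<le> M" using tame_bound[OF w'] by blast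
  obtain R where R: "R > 0" "\<And>x. norm x > R \<Longrightarrow> w x = 0" using tame_support[OF w] by blast
  note [measurable] = tame_measurable[OF w] tame_measurable[OF w']
  define X where "X n = inverse (real (Suc n))" for n
  have X: "X \<longlonglongrightarrow> 0" "\<And>n. X n \<noteq> 0" unfolding X_def using LIMSEQ_inverse_real_of_nat by auto
  have X1: "\<bar>X n\<bar> \<le> 1" for n by (simp add: X_def inverse_le_1_iff)
  let ?s = "\<lambda>n x. (w (x + X n *\<^sub>R v) - w x) / X n"
  have int0: "(\<integral>x. ?s n x \<partial>lborel) = 0" for n
  proof -
    have "integrable lborel (\<lambda>x. w (X n *\<^sub>R v + x))"
      by (rule integrable_lborel_shift[OF tame_integrable[OF w]])
    moreover have "(\<integral>x. w (X n *\<^sub>R v + x) \<partial>lborel) = (\<integral>x. w x \<partial>lborel)"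
      by (rule integral_lborel_shift) simp
    ultimately show ?thesis using tame_integrable[OF w] by (simp add: add.commute)
  qed
  have "(\<lambda>n. \<integral>x. ?s n x \<partial>lborel) \<longlonglongrightarrow> (\<integral>x. w' x \<partial>lborel)"
  \<comment> \<open>Shifts have length at most \<open>norm v\<close>, so all quotients vanish
    outside this ball; inside it they are bounded by the bound on the derivative.\<close>
  proof (rule integral_dominated_convergence[where w="\<lambda>x. M * indicator (cball 0 (R + norm v)) x"])
    show "integrable lborel (\<lambda>x. M * indicat_real (cball 0 (R + norm v)) x)"
      by (intro integrable_mult_right integrable_real_indicator) (auto simp: emeasure_bounded_finite[unfolded infinity_ennreal_def])
    show "AE x in lborel. (\<lambda>n. ?s n x) \<longlonglongrightarrow> w' x"
      using has_dd_quotient_tendsto[OF dd X] by simp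
    show "AE x in lborel. norm (?s n x) \<le> M * indicator (cball 0 (R + norm v)) x" for n
    proof (intro AE_I2)
      fix x
      show "norm (?s n x) \<le> M * indicator (cball 0 (R + norm v)) x"
      proof (cases "norm x \<le> R + norm v")
        case True
        have "\<bar>w (x + X n *\<^sub>R v) - w x\<bar> \<le> M * \<bar>X n\<bar>" by (rule has_dd_bound[OF dd M(2)])
        then show ?thesis using True X(2)[of n] by (simp add: field_simps)
      next
        case False
        have "norm (X n *\<^sub>R v) \<le> norm v" using X1[of n] by (simp add: mult_left_le_one_le)
        then have "norm (x + X n *\<^sub>R v) > R" "norm x > R"
          using False norm_triangle_ineq4[of "x + X n *\<^sub>R v" "X n *\<^sub>R v"] norm_ge_zero[of v] by (auto simp del: norm_ge_zero)
        then show ?thesis using R M by simp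
      qed
    qed
  qed measurable
  then have "(\<lambda>n. 0) \<longlonglongrightarrow> (\<integral>x. w' x \<partial>lborel)" by (simp only: int0)
  then show ?thesis using LIMSEQ_unique tendsto_const by blast
qed

section \<open>Convolution and its derivatives\<close>

definition conv :: "('a::euclidean_space \<Rightarrow> real) \<Rightarrow> ('a \<Rightarrow> real) \<Rightarrow> 'a \<Rightarrow> real" where
  "conv f \<eta> y = (\<integral>x. f x * \<eta> (y - x) \<partial>lborel)"

lemma conv_integrable:
  assumes f: "integrable lborel f" and \<eta>: "tame \<eta>"
  shows "integrable lborel (\<lambda>x. f x * \<eta> (y - x))"
proof -
  obtain M where M: "M > 0" "\<And>x. \<bar>\<eta> x\<bar> \<le> M" using tame_bound[OF \<eta>] by blast
  note [measurable] = tame_measurable[OF \<eta>] borel_measurable_integrable[OF f]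
  have "integrable lborel (\<lambda>x. f x * M)" using f by simp
  then show ?thesis
    by (rule Bochner_Integration.integrable_bound) (use M in \<open>auto simp: abs_mult mult_left_mono\<close>)
qed

lemma conv_measurable:
  assumes f: "integrable lborel f" and \<eta>: "tame \<eta>"
  shows "conv f \<eta> \<in> borel_measurable borel"
proof -
  note [measurable] = tame_measurable[OF \<eta>] borel_measurable_integrable[OF f]
  show ?thesis unfolding conv_def by measurable
qed

text \<open>The derivative falls on the kernel. Its difference quotients are bounded by the supremum
  of \<open>\<eta>'\<close>, so a multiple of \<open>\<bar>f x\<bar>\<close> dominates.\<close>

lemma conv_has_dd:
  assumes f: "integrable lborel f" and \<eta>: "tame \<eta>" and \<eta>': "tame \<eta>'" and dd: "has_dd v \<eta> \<eta>'"
  shows "has_dd v (conv f \<eta>) (conv f \<eta>')"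
  unfolding has_dd_def DERIV_def
proof
  fix y
  obtain M where M: "M > 0" "\<And>x. \<bar>\<eta>' x\<bar> \<le> M" using tame_bound[OF \<eta>'] by blast
  note [measurable] = tame_measurable[OF \<eta>] tame_measurable[OF \<eta>'] borel_measurable_integrable[OF f]
  show "((\<lambda>t. (conv f \<eta> (y + (0 + t) *\<^sub>R v) - conv f \<eta> (y + 0 *\<^sub>R v)) / t) \<longlongrightarrow> conv f \<eta>' y) (at 0)"
    unfolding tendsto_at_iff_sequentially
  proof (intro allI impI)
    fix X :: "nat \<Rightarrow> real" assume "\<forall>i. X i \<in> UNIV - {0}" and X0: "X \<longlonglongrightarrow> 0"
    then have Xn: "X n \<noteq> 0" for n by auto
    let ?s = "\<lambda>n x. f x * ((\<eta> ((y - x) + X n *\<^sub>R v) - \<eta> (y - x)) / X n)"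
    have eq: "(conv f \<eta> (y + X n *\<^sub>R v) - conv f \<eta> y) / X n = (\<integral>x. ?s n x \<partial>lborel)" for n
    proof -
      have "(\<integral>x. ?s n x \<partial>lborel) = (\<integral>x. (f x * \<eta> ((y + X n *\<^sub>R v) - x) - f x * \<eta> (y - x)) / X n \<partial>lborel)"
        by (intro Bochner_Integration.integral_cong) (auto simp: algebra_simps diff_divide_distrib)
      also have "\<dots> = (conv f \<eta> (y + X n *\<^sub>R v) - conv f \<eta> y) / X n"
        using conv_integrable[OF f \<eta>] by (simp add: conv_def)
      finally show ?thesis ..
    qed
    have "(\<lambda>n. \<integral>x. ?s n x \<partial>lborel) \<longlonglongrightarrow> (\<integral>x. f x * \<eta>' (y - x) \<partial>lborel)"
    proof (rule integral_dominated_convergence[where w="\<lambda>x. \<bar>f x\<bar> * M"])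
      show "integrable lborel (\<lambda>x. \<bar>f x\<bar> * M)" using f by simp
      show "AE x in lborel. (\<lambda>n. ?s n x) \<longlonglongrightarrow> f x * \<eta>' (y - x)"
        by (intro AE_I2 tendsto_mult tendsto_const has_dd_quotient_tendsto[OF dd X0 Xn])
      show "AE x in lborel. norm (?s n x) \<le> \<bar>f x\<bar> * M" for n
      proof (intro AE_I2)
        fix x
        have "\<bar>\<eta> ((y - x) + X n *\<^sub>R v) - \<eta> (y - x)\<bar> \<le> M * \<bar>X n\<bar>" by (rule has_dd_bound[OF dd M(2)])
        then have "\<bar>(\<eta> ((y - x) + X n *\<^sub>R v) - \<eta> (y - x)) / X n\<bar> \<le> M" using Xn[of n] by (simp add: field_simps)
        then show "norm (?s n x) \<le> \<bar>f x\<bar> * M" unfolding real_norm_def abs_mult by (intro mult_left_mono) auto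
      qed
    qed measurable
    then show "((\<lambda>t. (conv f \<eta> (y + (0 + t) *\<^sub>R v) - conv f \<eta> (y + 0 *\<^sub>R v)) / t) \<circ> X) \<longlonglongrightarrow> conv f \<eta>' y"
      unfolding eq[symmetric] by (simp add: comp_def) (simp add: conv_def)
  qed
qed

lemma conv_tame:
  assumes f: "integrable lborel f" and supp: "\<And>x. norm x > R \<Longrightarrow> f x = 0" and \<eta>: "tame \<eta>"
  shows "tame (conv f \<eta>)"
proof -
  obtain M where M: "M > 0" "\<And>x. \<bar>\<eta> x\<bar> \<le> M" using tame_bound[OF \<eta>] by blast
  obtain R' where R': "R' > 0" "\<And>x. norm x > R' \<Longrightarrow> \<eta> x = 0" using tame_support[OF \<eta>] by blast
  have "\<bar>conv f \<eta> y\<bar> \<le> (\<integral>x. \<bar>f x\<bar> * M \<partial>lborel)" for y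
  proof -
    have "\<bar>conv f \<eta> y\<bar> \<le> (\<integral>x. \<bar>f x * \<eta> (y - x)\<bar> \<partial>lborel)" unfolding conv_def by (rule integral_abs_bound)
    also have "\<dots> \<le> (\<integral>x. \<bar>f x\<bar> * M \<partial>lborel)"
      using f conv_integrable[OF f \<eta>] M by (intro integral_mono integrable_abs) (auto simp: abs_mult mult_left_mono)
    finally show ?thesis .
  qed
  moreover have "conv f \<eta> y = 0" if "norm y > R + R'" for y
  proof -
    have "f x * \<eta> (y - x) = 0" for x
    proof (cases "norm x > R")
      case False
      then have "norm (y - x) > R'" using that norm_triangle_ineq[of "y - x" x] by simp
      then show ?thesis using R' by simp
    qed (use supp in simp)
    then show ?thesis unfolding conv_def by (simp only: Bochner_Integration.integral_zero)
  qed
  ultimately show ?thesis using conv_measurable[OF f \<eta>] unfolding tame_def by blast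
qed

section \<open>Test functions and their partial derivatives\<close>

lemma test_fun_has_dd: "test_fun \<psi> \<Longrightarrow> has_dd (axis i 1) \<psi> (pd i \<psi>)"
proof -
  assume "test_fun \<psi>"
  then have "smooth_fun \<psi>" by (simp add: test_fun_def)
  then have "(\<lambda>t. iter_pd [] \<psi> (x + t *\<^sub>R axis i 1)) differentiable (at 0)" for x
    unfolding smooth_fun_def by blast
  then show ?thesis unfolding has_dd_def pd_def by (simp add: DERIV_deriv_iff_real_differentiable)
qed

lemma iter_pd_append: "iter_pd (js @ ks) f = iter_pd js (iter_pd ks f)"
  by (induction js) auto

lemma pd_eq_0_off_support:
  fixes \<psi> :: "real^'n::finite \<Rightarrow> real"
  assumes x: "x \<notin> closure {x. \<psi> x \<noteq> 0}"
  shows "pd i \<psi> x = 0"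
proof -
  have "open (- closure {x. \<psi> x \<noteq> 0})" by auto
  then obtain e where e: "e > 0" "ball x e \<subseteq> - closure {x. \<psi> x \<noteq> 0}"
    using x by (meson ComplI openE)
  have z: "\<psi> y = 0" if "y \<in> ball x e" for y
    using e(2) that closure_subset[of "{x. \<psi> x \<noteq> 0}"] by auto
  have "((\<lambda>t. \<psi> (x + t *\<^sub>R axis i 1)) has_real_derivative 0) (at 0)"
  proof (rule has_field_derivative_transform_within_open[where S="ball 0 e" and f="\<lambda>_. 0"])
    show "0 = \<psi> (x + t *\<^sub>R axis i 1)" if "t \<in> ball 0 e" for t
      using that z[of "x + t *\<^sub>R axis i 1"] by (simp add: dist_norm)
  qed (use e in auto)
  then show ?thesis unfolding pd_def by (rule DERIV_imp_deriv)
qed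

lemma test_fun_pd:
  assumes "test_fun \<psi>"
  shows "test_fun (pd i \<psi>)"
proof -
  have sm: "smooth_fun \<psi>" and c: "compact (closure {x. \<psi> x \<noteq> 0})" using assms by (auto simp: test_fun_def)
  have "smooth_fun (pd i \<psi>)"
    using sm unfolding smooth_fun_def by (metis iter_pd.simps iter_pd_append)
  moreover have "closure {x. pd i \<psi> x \<noteq> 0} \<subseteq> closure {x. \<psi> x \<noteq> 0}"
    using pd_eq_0_off_support by (intro closure_minimal) auto
  then have "compact (closure {x. pd i \<psi> x \<noteq> 0})"
    using c by (meson bounded_subset closed_closure compact_eq_bounded_closed)
  ultimately show ?thesis by (simp add: test_fun_def)
qed

lemma test_fun_continuous: "test_fun \<psi> \<Longrightarrow> continuous_on UNIV \<psi>"
  unfolding test_fun_def smooth_fun_def by (metis iter_pd.simps(1))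

lemma test_fun_tame:
  assumes "test_fun \<psi>"
  shows "tame \<psi>"
proof -
  let ?K = "closure {x. \<psi> x \<noteq> 0}"
  have K: "compact ?K" using assms by (simp add: test_fun_def)
  have z: "\<psi> x = 0" if "x \<notin> ?K" for x using that closure_subset[of "{x. \<psi> x \<noteq> 0}"] by auto
  have cont: "continuous_on UNIV \<psi>" by (rule test_fun_continuous[OF assms])
  then have "bounded (\<psi> ` ?K)"
    by (intro compact_imp_bounded compact_continuous_image K continuous_on_subset[OF cont]) auto
  then obtain M where "\<And>x. x \<in> ?K \<Longrightarrow> \<bar>\<psi> x\<bar> \<le> M" by (auto simp: bounded_iff)
  then have "\<bar>\<psi> x\<bar> \<le> max M 0" for x using z[of x] by (cases "x \<in> ?K") (auto simp: le_max_iff_disj)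
  moreover obtain R where "\<And>x. x \<in> ?K \<Longrightarrow> norm x \<le> R"
    using compact_imp_bounded[OF K] unfolding bounded_iff by blast
  then have "\<forall>x. norm x > R \<longrightarrow> \<psi> x = 0" using z by (meson not_le)
  ultimately show ?thesis using borel_measurable_continuous_onI[OF cont] unfolding tame_def by blast
qed

section \<open>Vanishing in the sense of distributions, continuity of translations\<close>

text \<open>Open boxes generate the Borel sets and are closed under intersection. Exhausting the
  space by boxes gives total integral 0, which handles complements in Dynkin's argument. The sets
  where \<open>f\<close> is positive and where it is negative then finish the proof.\<close>

lemma AE_eq_0_if_box_integrals_0:
  fixes f :: "'a::euclidean_space \<Rightarrow> real"
  assumes f: "integrable lborel f" and box: "\<And>a b. (\<integral>x. f x * indicator (box a b) x \<partial>lborel) = 0"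
  shows "AE x in lborel. f x = 0"
proof -
  have [measurable]: "f \<in> borel_measurable borel" using f by simp
  have ib: "integrable lborel (\<lambda>x. f x * indicator A x)" if "A \<in> sets borel" for A
    using integrable_mult_indicator[OF _ f, of A] that by (simp add: mult.commute)
  have tot: "(\<integral>x. f x \<partial>lborel) = 0"
  proof -
    have "(\<lambda>n. \<integral>x. f x * indicator (box (- (real n *\<^sub>R One)) (real n *\<^sub>R One)) x \<partial>lborel) \<longlonglongrightarrow> (\<integral>x. f x \<partial>lborel)"
    proof (rule integral_dominated_convergence[where w="\<lambda>x. \<bar>f x\<bar>"])
      show "AE x in lborel. (\<lambda>n. f x * indicator (box (- (real n *\<^sub>R One)) (real n *\<^sub>R One)) x) \<longlonglongrightarrow> f x"
      proof (intro AE_I2 tendsto_eventually)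
        fix x :: 'a
        obtain n0 :: nat where n0: "norm x < real n0" using reals_Archimedean2 by blast
        show "\<forall>\<^sub>F n in sequentially. f x * indicator (box (- (real n *\<^sub>R One)) (real n *\<^sub>R One)) x = f x"
        proof (rule eventually_mono[OF eventually_ge_at_top[of n0]])
          fix n assume "n0 \<le> n"
          have "x \<in> box (- (real n *\<^sub>R One)) (real n *\<^sub>R One)"
            unfolding mem_box
          proof (intro ballI)
            fix i :: 'a assume i: "i \<in> Basis"
            have "\<bar>x \<bullet> i\<bar> < real n" using Basis_le_norm[OF i, of x] n0 \<open>n0 \<le> n\<close> by simp
            then show "- (real n *\<^sub>R One) \<bullet> i < x \<bullet> i \<and> x \<bullet> i < real n *\<^sub>R One \<bullet> i"
              using i by (auto simp: abs_less_iff)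
          qed
          then show "f x * indicator (box (- (real n *\<^sub>R One)) (real n *\<^sub>R One)) x = f x" by simp
        qed
      qed
    qed (use f in \<open>auto split: split_indicator\<close>)
    then show ?thesis unfolding box using LIMSEQ_unique tendsto_const by blast
  qed
  have sets0: "(\<integral>x. f x * indicator A x \<partial>lborel) = 0" if "A \<in> sets borel" for A
  proof -
    let ?G = "range (\<lambda>(a, b). box a b :: 'a set)"
    have "sigma_sets UNIV ?G = sets borel" by (simp add: borel_eq_box)
    with that have A: "A \<in> sigma_sets UNIV ?G" by simp
    have "Int_stable ?G" "?G \<subseteq> Pow UNIV" by (auto simp: Int_stable_def box_Int_box)
    then show ?thesis using A
    proof (induction A rule: sigma_sets_induct_disjoint)
      case (basic A)
      then show ?case using box by auto
    next
      case empty
      then show ?case by simp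
    next
      case (compl A)
      then have A: "A \<in> sets borel" by (simp add: borel_eq_box)
      have "(\<integral>x. f x * indicator (UNIV - A) x \<partial>lborel) = (\<integral>x. f x - f x * indicator A x \<partial>lborel)"
        by (intro Bochner_Integration.integral_cong) (auto split: split_indicator)
      also have "\<dots> = 0" using f ib[OF A] tot compl by simp
      finally show ?case .
    next
      case (union A)
      then have A: "A i \<in> sets borel" for i by (auto simp: borel_eq_box)
      have "(\<lambda>n. \<integral>x. f x * (\<Sum>i<n. indicator (A i) x) \<partial>lborel) \<longlonglongrightarrow> (\<integral>x. f x * indicator (\<Union>i. A i) x \<partial>lborel)"
      proof (rule integral_dominated_convergence[where w="\<lambda>x. \<bar>f x\<bar>"])
        have s: "(\<Sum>i<n. indicator (A i) x) = (indicator (\<Union>i<n. A i) x :: real)" for n x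
          using union(1) by (subst indicator_UN_disjoint) (auto simp: disjoint_family_on_def)
        show "AE x in lborel. (\<lambda>n. f x * (\<Sum>i<n. indicator (A i) x)) \<longlonglongrightarrow> f x * indicator (\<Union>i. A i) x"
          unfolding s by (intro AE_I2 tendsto_mult tendsto_const LIMSEQ_indicator_UN)
        show "AE x in lborel. norm (f x * (\<Sum>i<n. indicator (A i) x)) \<le> \<bar>f x\<bar>" for n
          unfolding s by (intro AE_I2) (auto split: split_indicator)
      qed (use f A in \<open>auto intro!: borel_measurable_times borel_measurable_sum\<close>)
      moreover have "(\<integral>x. f x * (\<Sum>i<n. indicator (A i) x) \<partial>lborel) = 0" for n
        unfolding sum_distrib_left using ib[OF A] union(3) by (subst Bochner_Integration.integral_sum) auto
      ultimately have "(\<lambda>n. 0) \<longlonglongrightarrow> (\<integral>x. f x * indicator (\<Union>i. A i) x \<partial>lborel)" by simp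
      then show ?case using LIMSEQ_unique tendsto_const by blast
    qed
  qed
  have "AE x in lborel. f x * indicator {x. f x > 0} x = 0"
    by (subst integral_nonneg_eq_0_iff_AE[symmetric]) (auto intro!: ib sets0 split: split_indicator)
  moreover have "AE x in lborel. - (f x * indicator {x. f x < 0} x) = 0"
    by (subst integral_nonneg_eq_0_iff_AE[symmetric]) (auto intro!: ib sets0 split: split_indicator)
  ultimately show ?thesis
    by eventually_elim (auto simp: indicator_def split: if_splits)
qed

lemma loc_integrable_test_fun:
  assumes "loc_integrable f" "test_fun \<psi>"
  shows "integrable lebesgue (\<lambda>x. f x * \<psi> x)"
proof -
  let ?K = "closure {x. \<psi> x \<noteq> 0}"
  obtain M where M: "M > 0" "\<And>x. \<bar>\<psi> x\<bar> \<le> M" using tame_bound[OF test_fun_tame[OF assms(2)]] by blast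
  have "compact ?K" using assms(2) by (simp add: test_fun_def)
  then have i: "integrable lebesgue (\<lambda>x. indicator ?K x * f x)"
    using assms(1) by (auto simp: loc_integrable_def set_integrable_def)
  have m: "\<psi> \<in> borel_measurable lebesgue"
    using tame_measurable[OF test_fun_tame[OF assms(2)]] by (intro measurable_completion) simp
  have "integrable lebesgue (\<lambda>x. (indicator ?K x * f x) * \<psi> x)"
  proof (rule Bochner_Integration.integrable_bound)
    show "integrable lebesgue (\<lambda>x. (indicator ?K x * f x) * M)" using i by simp
    show "(\<lambda>x. (indicator ?K x * f x) * \<psi> x) \<in> borel_measurable lebesgue"
      by (intro borel_measurable_times[OF borel_measurable_integrable[OF i] m])
    show "AE x in lebesgue. norm ((indicator ?K x * f x) * \<psi> x) \<le> norm ((indicator ?K x * f x) * M)"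
      unfolding real_norm_def abs_mult[of _ "\<psi> _"] abs_mult[of _ M] using M
      by (intro AE_I2 mult_left_mono) auto
  qed
  moreover have "(indicator ?K x * f x) * \<psi> x = f x * \<psi> x" for x
    using closure_subset[of "{x. \<psi> x \<noteq> 0}"] by (auto simp: indicator_def)
  ultimately show ?thesis by simp
qed

text \<open>The fundamental lemma of the calculus of variations. Within a closed box contained in
  \<open>U\<close>, indicators of open boxes are bounded limits of bumps supported in that closed
  box, and countably many closed boxes exhaust \<open>U\<close>.\<close>

lemma AE_eq_0_on_open:
  fixes f :: "real^'n::finite \<Rightarrow> real"
  assumes f: "loc_integrable f" and U: "open U"
    and test: "\<And>\<psi>. test_fun \<psi> \<Longrightarrow> closure {x. \<psi> x \<noteq> 0} \<subseteq> U \<Longrightarrow> (\<integral>x. f x * \<psi> x \<partial>lebesgue) = 0"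
  shows "AE x in lebesgue. x \<in> U \<longrightarrow> f x = 0"
proof -
  have one: "AE x in lebesgue. x \<in> cbox c d \<longrightarrow> f x = 0" if cd: "cbox c d \<subseteq> U" for c d
  proof -
    define f1 where "f1 x = indicator (box c d) x * f x" for x
    have "set_integrable lebesgue (cbox c d) f" using f by (simp add: loc_integrable_def)
    then have "set_integrable lebesgue (box c d) f"
      by (rule set_integrable_subset) (auto simp: box_subset_cbox)
    then have f1: "integrable lebesgue f1" by (simp add: set_integrable_def f1_def[abs_def])
    \<comment> \<open>The box criterion concerns Borel measure, whereas \<open>f\<close> is only
      measurable for the completion.\<close>
    obtain g where g: "g \<in> borel_measurable lborel" "AE x in lborel. f1 x = g x"
      using completion_ex_borel_measurable_real[OF borel_measurable_integrable[OF f1]] by blast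
    have ae: "AE x in lebesgue. f1 x = g x" using g(2) by (rule AE_completion)
    have gm: "g \<in> borel_measurable lebesgue" using g(1) by (rule measurable_completion)
    have gi: "integrable lborel g"
      using integrable_cong_AE[OF borel_measurable_integrable[OF f1] gm ae] f1 g(1) integrable_completion by blast
    have "(\<integral>x. g x * indicator (box a b) x \<partial>lborel) = 0" for a b
    proof -
      obtain a' b' where ab: "box a b \<inter> box c d = box a' b'"
        by (simp add: box_Int_box)
      have im: "indicator (box a b) \<in> borel_measurable lebesgue" for a b :: "real^'n"
        by (intro borel_measurable_indicator) (auto intro: borel_open)
      have "(\<integral>x. g x * indicator (box a b) x \<partial>lborel) = (\<integral>x. g x * indicator (box a b) x \<partial>lebesgue)"
        using g(1) by (intro integral_completion[symmetric]) (auto intro!: borel_measurable_times)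
      also have "\<dots> = (\<integral>x. f1 x * indicator (box a b) x \<partial>lebesgue)"
        by (intro integral_cong_AE borel_measurable_times gm borel_measurable_integrable[OF f1] im)
          (use ae in eventually_elim, simp)
      also have "\<dots> = (\<integral>x. f1 x * indicator (box a' b') x \<partial>lebesgue)"
        using ab by (intro Bochner_Integration.integral_cong) (auto simp: f1_def indicator_def)
      also have "\<dots> = 0"
      proof (rule LIMSEQ_unique)
        show "(\<lambda>n. \<integral>x. f1 x * box_bump 1 (real (Suc n)) a' b' x \<partial>lebesgue) \<longlonglongrightarrow> (\<integral>x. f1 x * indicator (box a' b') x \<partial>lebesgue)"
        proof (rule integral_dominated_convergence[where w="\<lambda>x. \<bar>f1 x\<bar>"])
          show "(\<lambda>x. f1 x * indicator (box a' b') x) \<in> borel_measurable lebesgue"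
            by (intro borel_measurable_times borel_measurable_integrable[OF f1] im)
          show "(\<lambda>x. f1 x * box_bump 1 (real (Suc n)) a' b' x) \<in> borel_measurable lebesgue" for n
            using tame_measurable[OF test_fun_tame[OF test_fun_box_bump[of "real (Suc n)" 1 a' b']]]
            by (intro borel_measurable_times borel_measurable_integrable[OF f1] measurable_completion) simp
          show "AE x in lebesgue. (\<lambda>n. f1 x * box_bump 1 (real (Suc n)) a' b' x) \<longlonglongrightarrow> f1 x * indicator (box a' b') x"
            by (intro AE_I2 tendsto_mult tendsto_const box_bump_tendsto)
          show "AE x in lebesgue. norm (f1 x * box_bump 1 (real (Suc n)) a' b' x) \<le> \<bar>f1 x\<bar>" for n
            using box_bump_range[of 1 "real (Suc n)" a' b'] by (intro AE_I2) (auto simp: abs_mult mult_left_le)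
        qed (use f1 in simp)
        have "(\<integral>x. f1 x * box_bump 1 (real (Suc n)) a' b' x \<partial>lebesgue) = 0" for n
        proof -
          have nz: "{x. box_bump 1 (real (Suc n)) a' b' x \<noteq> 0} = box a b \<inter> box c d"
            unfolding ab using box_bump_nonzero_iff[of 1 "real (Suc n)" a' b'] by auto
          have "closure {x. box_bump 1 (real (Suc n)) a' b' x \<noteq> 0} \<subseteq> cbox c d"
            unfolding nz by (intro closure_minimal) (auto intro: subsetD[OF box_subset_cbox])
          then have "(\<integral>x. f x * box_bump 1 (real (Suc n)) a' b' x \<partial>lebesgue) = 0"
            using cd by (intro test test_fun_box_bump) auto
          moreover have "f1 x * box_bump 1 (real (Suc n)) a' b' x = f x * box_bump 1 (real (Suc n)) a' b' x" for x
            using nz by (auto simp: f1_def indicator_def)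
          ultimately show ?thesis by (simp only:)
        qed
        then show "(\<lambda>n. \<integral>x. f1 x * box_bump 1 (real (Suc n)) a' b' x \<partial>lebesgue) \<longlonglongrightarrow> 0" by simp
      qed
      finally show ?thesis .
    qed
    then have "AE x in lborel. g x = 0" by (rule AE_eq_0_if_box_integrals_0[OF gi])
    then have "AE x in lebesgue. g x = 0" by (rule AE_completion)
    \<comment> \<open>\<open>f1\<close> sees only the open box; the faces form a null set.\<close>
    moreover have "AE x in lebesgue. x \<notin> cbox c d - box c d"
      using negligible_frontier_interval[of c d] unfolding negligible_iff_null_sets by (rule AE_not_in)
    ultimately show ?thesis using ae
      by eventually_elim (auto simp: f1_def indicator_def)
  qed
  obtain D where D: "countable D" "D \<subseteq> Pow U" "\<And>X. X \<in> D \<Longrightarrow> \<exists>a b. X = cbox a b" "\<Union>D = U"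
    using open_countable_Union_open_cbox[OF U] by blast
  have "AE x in lebesgue. \<forall>X\<in>D. x \<in> X \<longrightarrow> f x = 0"
    using D(1)
  proof (rule AE_ball_countable[THEN iffD2])
    show "\<forall>X\<in>D. AE x in lebesgue. x \<in> X \<longrightarrow> f x = 0"
    proof
      fix X assume X: "X \<in> D"
      then obtain a b where "X = cbox a b" using D(3) by blast
      then show "AE x in lebesgue. x \<in> X \<longrightarrow> f x = 0" using one[of a b] X D(2) by auto
    qed
  qed
  then show ?thesis by eventually_elim (use D(4) in blast)
qed

section \<open>Continuity of translations in the mean\<close>

definition L1_shift_continuous :: "('a::euclidean_space \<Rightarrow> real) \<Rightarrow> bool" where
  "L1_shift_continuous f \<longleftrightarrow> (\<forall>e>0. \<exists>d>0. \<forall>z. norm z < d \<longrightarrow> (\<integral>x. \<bar>f (z + x) - f x\<bar> \<partial>lborel) < e)"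

lemma L1_shift_continuous_approx:
  assumes f: "integrable lborel f"
    and ap: "\<And>e. e > 0 \<Longrightarrow> \<exists>g. integrable lborel g \<and> L1_shift_continuous g \<and> (\<integral>x. \<bar>f x - g x\<bar> \<partial>lborel) < e"
  shows "L1_shift_continuous f"
  unfolding L1_shift_continuous_def
proof (intro allI impI)
  fix e :: real assume e: "e > 0"
  obtain g where g: "integrable lborel g" "L1_shift_continuous g" "(\<integral>x. \<bar>f x - g x\<bar> \<partial>lborel) < e / 3"
    using ap[of "e/3"] e by auto
  obtain d where d: "d > 0" "\<And>z. norm z < d \<Longrightarrow> (\<integral>x. \<bar>g (z + x) - g x\<bar> \<partial>lborel) < e / 3"
    using g(2) e unfolding L1_shift_continuous_def by (metis zero_less_divide_iff zero_less_numeral)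
  show "\<exists>d>0. \<forall>z. norm z < d \<longrightarrow> (\<integral>x. \<bar>f (z + x) - f x\<bar> \<partial>lborel) < e"
  proof (intro exI conjI allI impI)
    fix z :: 'a assume z: "norm z < d"
    note fz = integrable_lborel_shift[OF f, of z] and gz = integrable_lborel_shift[OF g(1), of z]
    have "(\<integral>x. \<bar>f (z + x) - g (z + x)\<bar> \<partial>lborel) = (\<integral>x. \<bar>f x - g x\<bar> \<partial>lborel)"
      by (rule integral_lborel_shift[of "\<lambda>x. \<bar>f x - g x\<bar>"])
         (use borel_measurable_integrable[OF f] borel_measurable_integrable[OF g(1)] in auto)
    then have 1: "(\<integral>x. \<bar>f (z + x) - g (z + x)\<bar> \<partial>lborel) < e / 3" using g(3) by simp
    have "(\<integral>x. \<bar>f (z + x) - f x\<bar> \<partial>lborel)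
      \<le> (\<integral>x. \<bar>f (z + x) - g (z + x)\<bar> + \<bar>g (z + x) - g x\<bar> + \<bar>f x - g x\<bar> \<partial>lborel)"
      using f g fz gz by (intro integral_mono integrable_abs Bochner_Integration.integrable_diff Bochner_Integration.integrable_add) auto
    also have "\<dots> = (\<integral>x. \<bar>f (z + x) - g (z + x)\<bar> \<partial>lborel) + (\<integral>x. \<bar>g (z + x) - g x\<bar> \<partial>lborel) + (\<integral>x. \<bar>f x - g x\<bar> \<partial>lborel)"
      using f g fz gz by simp
    also have "\<dots> < e" using 1 g(3) d(2)[OF z] by linarith
    finally show "(\<integral>x. \<bar>f (z + x) - f x\<bar> \<partial>lborel) < e" .
  qed (rule d(1))
qed

text \<open>Since a shift preserves measure, gain and loss are equal and the distance is twice the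
  loss. The loss tends to 0 pointwise because \<open>U\<close> is open.\<close>

lemma L1_shift_continuous_open:
  fixes U :: "'a::euclidean_space set"
  assumes U: "open U" and fin: "emeasure lborel U < \<infinity>"
  shows "L1_shift_continuous (indicator U)"
proof -
  have i: "integrable lborel (indicat_real U)"
    using U fin by (intro integrable_real_indicator) auto
  note iz = integrable_lborel_shift[OF i]
  have "((\<lambda>z. \<integral>x. \<bar>indicat_real U (z + x) - indicator U x\<bar> \<partial>lborel) \<longlongrightarrow> 0) (at 0)"
    unfolding tendsto_at_iff_sequentially
  proof (intro allI impI)
    fix X :: "nat \<Rightarrow> 'a" assume X: "X \<longlonglongrightarrow> 0"
    let ?m = "\<lambda>n x. max 0 (indicat_real U x - indicator U (X n + x))"
    have mi: "integrable lborel (?m n)" for n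
      using i iz by (intro integrable_max) auto
    have "(\<lambda>n. \<integral>x. ?m n x \<partial>lborel) \<longlonglongrightarrow> (\<integral>x. 0 \<partial>(lborel::'a measure))"
    proof (rule integral_dominated_convergence[where w="indicator U"])
      show "?m n \<in> borel_measurable lborel" for n using mi by (rule borel_measurable_integrable)
      show "AE x in lborel. (\<lambda>n. ?m n x) \<longlonglongrightarrow> 0"
      proof (intro AE_I2 tendsto_eventually)
        fix x
        show "\<forall>\<^sub>F n in sequentially. ?m n x = 0"
        proof (cases "x \<in> U")
          case True
          have "(\<lambda>n. X n + x) \<longlonglongrightarrow> 0 + x" by (intro tendsto_add X tendsto_const)
          then have "\<forall>\<^sub>F n in sequentially. X n + x \<in> U" using True U by (intro topological_tendstoD) auto
          then show ?thesis by eventually_elim simp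
        qed simp
      qed
      show "AE x in lborel. norm (?m n x) \<le> indicator U x" for n
        by (intro AE_I2) (auto split: split_indicator)
    qed (use i in auto)
    moreover have "(\<integral>x. \<bar>indicat_real U (X n + x) - indicator U x\<bar> \<partial>lborel) = 2 * (\<integral>x. ?m n x \<partial>lborel)" for n
    proof -
      have "(\<integral>x. indicat_real U (X n + x) \<partial>lborel) = (\<integral>x. indicator U x \<partial>lborel)"
        using borel_measurable_integrable[OF i] by (intro integral_lborel_shift) auto
      then have "(\<integral>x. 2 * ?m n x + (indicat_real U (X n + x) - indicator U x) \<partial>lborel) = 2 * (\<integral>x. ?m n x \<partial>lborel)"
        using i iz mi by simp
      moreover have "\<bar>indicat_real U (X n + x) - indicator U x\<bar> = 2 * ?m n x + (indicat_real U (X n + x) - indicator U x)" for x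
        by (auto split: split_indicator)
      ultimately show ?thesis by simp
    qed
    ultimately show "((\<lambda>z. \<integral>x. \<bar>indicat_real U (z + x) - indicator U x\<bar> \<partial>lborel) \<circ> X) \<longlonglongrightarrow> 0"
      using tendsto_mult_right_zero[of "\<lambda>n. \<integral>x. ?m n x \<partial>lborel" sequentially 2] by (simp add: comp_def)
  qed
  then show ?thesis
    unfolding L1_shift_continuous_def
  proof (intro allI impI)
    fix e :: real assume e: "e > 0"
    assume "((\<lambda>z. \<integral>x. \<bar>indicat_real U (z + x) - indicator U x\<bar> \<partial>lborel) \<longlongrightarrow> 0) (at 0)"
    then obtain d where d: "d > 0" "\<And>z. z \<noteq> 0 \<Longrightarrow> norm z < d \<Longrightarrow> norm (\<integral>x. \<bar>indicat_real U (z + x) - indicator U x\<bar> \<partial>lborel) < e"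
      using e unfolding LIM_eq by (auto simp del: norm_eq_zero)
    have "(\<integral>x. \<bar>indicat_real U (z + x) - indicator U x\<bar> \<partial>lborel) < e" if "norm z < d" for z
      using d(2)[of z] that e by (cases "z = 0") auto
    then show "\<exists>d>0. \<forall>z. norm z < d \<longrightarrow> (\<integral>x. \<bar>indicat_real U (z + x) - indicator U x\<bar> \<partial>lborel) < e"
      using d(1) by blast
  qed
qed

text \<open>Outer regularity of Lebesgue measure reduces indicators to those of open sets; sums and
  dominated limits follow by approximation in the mean.\<close>

lemma L1_shift_continuous_integrable:
  fixes f :: "'a::euclidean_space \<Rightarrow> real"
  assumes "integrable lborel f"
  shows "L1_shift_continuous f"
  using assms
proof (induction rule: integrable_induct)
  case (base A c)
  have iA: "integrable lborel (\<lambda>x. indicat_real A x *\<^sub>R c)" using base by auto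
  show ?case
  proof (rule L1_shift_continuous_approx[OF iA])
    fix e :: real assume e: "e > 0"
    have "A \<in> sets lebesgue" using base by (simp add: sets_completionI_sets)
    \<comment> \<open>Adding 1 covers \<open>c = 0\<close> and makes the product with
      \<open>\<bar>c\<bar>\<close> strictly smaller than \<open>e\<close>.\<close>
    moreover have ep: "e / (\<bar>c\<bar> + 1) > 0" using e by simp
    ultimately obtain U where U: "open U" "A \<subseteq> U" "U - A \<in> lmeasurable" "emeasure lebesgue (U - A) < ennreal (e / (\<bar>c\<bar> + 1))"
      using sets_lebesgue_outer_open by blast
    have Ub: "U \<in> sets borel" "U - A \<in> sets borel" using U base by auto
    have em: "emeasure lborel (U - A) < ennreal (e / (\<bar>c\<bar> + 1))" using U(4) Ub by simp
    have "emeasure lborel U \<le> emeasure lborel A + emeasure lborel (U - A)"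
      using U base emeasure_subadditive[of A lborel "U - A"] by (simp add: Un_absorb1 Ub)
    also have "\<dots> < \<infinity>" using base em by (auto simp: less_top[symmetric])
    finally have fU: "emeasure lborel U < \<infinity>" .
    have iU: "integrable lborel (\<lambda>x. indicat_real U x * c)" using Ub fU by auto
    have "L1_shift_continuous (\<lambda>x. indicat_real U x * c)"
      unfolding L1_shift_continuous_def
    proof (intro allI impI)
      fix r :: real assume r: "r > 0"
      obtain d where d: "d > 0" "\<And>z. norm z < d \<Longrightarrow> (\<integral>x. \<bar>indicat_real U (z + x) - indicator U x\<bar> \<partial>lborel) < r / (\<bar>c\<bar> + 1)"
      proof -
        have "r / (\<bar>c\<bar> + 1) > 0" using r by simp
        then show ?thesis using L1_shift_continuous_open[OF U(1) fU] that unfolding L1_shift_continuous_def by blast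
      qed
      show "\<exists>d>0. \<forall>z. norm z < d \<longrightarrow> (\<integral>x. \<bar>indicat_real U (z + x) * c - indicat_real U x * c\<bar> \<partial>lborel) < r"
      proof (intro exI conjI allI impI)
        fix z :: 'a assume "norm z < d"
        have "(\<integral>x. \<bar>indicat_real U (z + x) * c - indicat_real U x * c\<bar> \<partial>lborel) = (\<integral>x. \<bar>indicat_real U (z + x) - indicator U x\<bar> \<partial>lborel) * \<bar>c\<bar>"
          by (simp flip: left_diff_distrib add: abs_mult)
        also have "\<dots> \<le> (r / (\<bar>c\<bar> + 1)) * \<bar>c\<bar>" using d(2)[OF \<open>norm z < d\<close>] by (intro mult_right_mono) auto
        also have "\<dots> < r" using r by (simp add: field_simps)
        finally show "(\<integral>x. \<bar>indicat_real U (z + x) * c - indicat_real U x * c\<bar> \<partial>lborel) < r" .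
      qed (rule d(1))
    qed
    moreover have "(\<integral>x. \<bar>indicat_real A x *\<^sub>R c - indicat_real U x * c\<bar> \<partial>lborel) < e"
    proof -
      have "(\<integral>x. \<bar>indicat_real A x *\<^sub>R c - indicat_real U x * c\<bar> \<partial>lborel) = (\<integral>x. indicat_real (U - A) x * \<bar>c\<bar> \<partial>lborel)"
        using U(2) by (intro Bochner_Integration.integral_cong) (auto split: split_indicator)
      also have "\<dots> = measure lborel (U - A) * \<bar>c\<bar>" by simp
      also have "\<dots> \<le> (e / (\<bar>c\<bar> + 1)) * \<bar>c\<bar>"
        using em ep by (intro mult_right_mono) (auto simp: measure_def enn2real_leI less_imp_le)
      also have "\<dots> < e" using e by (simp add: field_simps)
      finally show ?thesis .
    qed
    ultimately show "\<exists>g. integrable lborel g \<and> L1_shift_continuous g \<and> (\<integral>x. \<bar>indicat_real A x *\<^sub>R c - g x\<bar> \<partial>lborel) < e"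
      using iU by blast
  qed
next
  case (add f g)
  show ?case
    unfolding L1_shift_continuous_def
  proof (intro allI impI)
    fix e :: real assume e: "e > 0"
    then have "e / 2 > 0" by simp
    then obtain d1 d2 where d: "d1 > 0" "\<And>z. norm z < d1 \<Longrightarrow> (\<integral>x. \<bar>f (z + x) - f x\<bar> \<partial>lborel) < e / 2"
       "d2 > 0" "\<And>z. norm z < d2 \<Longrightarrow> (\<integral>x. \<bar>g (z + x) - g x\<bar> \<partial>lborel) < e / 2"
      using add(3,4) unfolding L1_shift_continuous_def by (elim allE[of _ "e/2"]) auto
    show "\<exists>d>0. \<forall>z. norm z < d \<longrightarrow> (\<integral>x. \<bar>f (z + x) + g (z + x) - (f x + g x)\<bar> \<partial>lborel) < e"
    proof (intro exI[of _ "min d1 d2"] conjI allI impI)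
      fix z :: 'a assume z: "norm z < min d1 d2"
      note fz = integrable_lborel_shift[OF add(1), of z] and gz = integrable_lborel_shift[OF add(2), of z]
      have "(\<integral>x. \<bar>f (z + x) + g (z + x) - (f x + g x)\<bar> \<partial>lborel) \<le> (\<integral>x. \<bar>f (z + x) - f x\<bar> + \<bar>g (z + x) - g x\<bar> \<partial>lborel)"
        using add(1,2) fz gz by (intro integral_mono integrable_abs Bochner_Integration.integrable_diff Bochner_Integration.integrable_add) auto
      also have "\<dots> = (\<integral>x. \<bar>f (z + x) - f x\<bar> \<partial>lborel) + (\<integral>x. \<bar>g (z + x) - g x\<bar> \<partial>lborel)"
        using add(1,2) fz gz by simp
      also have "\<dots> < e" using d(2,4)[of z] z by simp
      finally show "(\<integral>x. \<bar>f (z + x) + g (z + x) - (f x + g x)\<bar> \<partial>lborel) < e" .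
    qed (use d in auto)
  qed
next
  case (lim f s)
  show ?case
  proof (rule L1_shift_continuous_approx[OF lim(4)])
    fix e :: real assume e: "e > 0"
    have "(\<lambda>i. \<integral>x. \<bar>f x - s i x\<bar> \<partial>lborel) \<longlonglongrightarrow> (\<integral>x. 0 \<partial>(lborel::'a measure))"
    proof (rule integral_dominated_convergence[where w="\<lambda>x. 3 * \<bar>f x\<bar>"])
      show "AE x in lborel. (\<lambda>i. \<bar>f x - s i x\<bar>) \<longlonglongrightarrow> 0"
      proof (intro AE_I2)
        fix x
        have "(\<lambda>i. \<bar>f x - s i x\<bar>) \<longlonglongrightarrow> \<bar>f x - f x\<bar>"
          using lim(2)[of x] by (intro tendsto_intros) auto
        then show "(\<lambda>i. \<bar>f x - s i x\<bar>) \<longlonglongrightarrow> 0" by simp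
      qed
      show "AE x in lborel. norm \<bar>f x - s i x\<bar> \<le> 3 * \<bar>f x\<bar>" for i
      proof (intro AE_I2)
        fix x :: 'a
        show "norm \<bar>f x - s i x\<bar> \<le> 3 * \<bar>f x\<bar>" using lim(3)[of x i] by simp
      qed
    qed (use lim(1,4) in auto)
    then have "\<forall>\<^sub>F i in sequentially. (\<integral>x. \<bar>f x - s i x\<bar> \<partial>lborel) < e"
      using e by (intro order_tendstoD) auto
    then obtain i where "(\<integral>x. \<bar>f x - s i x\<bar> \<partial>lborel) < e" by (auto simp: eventually_sequentially)
    then show "\<exists>g. integrable lborel g \<and> L1_shift_continuous g \<and> (\<integral>x. \<bar>f x - g x\<bar> \<partial>lborel) < e"
      using lim(1,5) by blast
  qed
qed

section \<open>Mollifiers\<close>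

text \<open>The reflected translates are required to be test functions because
  \<open>conv_weak_pd\<close> inserts them into the definition of a weak derivative.\<close>

definition mollifier :: "real \<Rightarrow> (real^'n::finite \<Rightarrow> real) \<Rightarrow> bool" where
  "mollifier d \<eta> \<longleftrightarrow> test_fun \<eta> \<and> (\<forall>y. test_fun (\<lambda>x. \<eta> (y - x))) \<and> (\<forall>x. 0 \<le> \<eta> x) \<and>
     (\<integral>x. \<eta> x \<partial>lborel) = 1 \<and> (\<forall>x. \<eta> x \<noteq> 0 \<longrightarrow> norm x < d)"

lemma mollifier_exists:
  assumes d: "d > 0"
  shows "\<exists>\<eta> :: real^'n::finite \<Rightarrow> real. mollifier d \<eta>"
proof -
  \<comment> \<open>The norm is at most the sum of the moduli of the coordinates, so a cube with
    this half side lies in the ball of radius \<open>d\<close>.\<close>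
  define r where "r = d / real CARD('n)"
  have r: "r > 0" using d by (simp add: r_def)
  define a :: "real^'n" where "a = (\<chi> j. r)"
  define \<phi> :: "real^'n \<Rightarrow> real" where "\<phi> = box_bump 1 1 (- a) a"
  define I where "I = (\<integral>x. \<phi> x \<partial>lborel)"
  have tp: "test_fun \<phi>" unfolding \<phi>_def by (intro test_fun_box_bump) simp
  have nz: "\<phi> x \<noteq> 0 \<longleftrightarrow> x \<in> box (- a) a" for x unfolding \<phi>_def by (intro box_bump_nonzero_iff) auto
  have p0: "0 \<le> \<phi> x" for x unfolding \<phi>_def by (intro box_bump_range) auto
  have "I \<noteq> 0"
  proof
    assume "I = 0"
    then have "AE x in lborel. \<phi> x = 0"
      unfolding I_def using tame_integrable[OF test_fun_tame[OF tp]] p0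
      by (subst (asm) integral_nonneg_eq_0_iff_AE) auto
    then have "AE x in lborel. x \<notin> box (- a) a" by eventually_elim (use nz in auto)
    then have "emeasure lborel (box (- a) a) = 0"
      by (subst (asm) AE_iff_measurable[where N="box (-a) a"]) auto
    moreover have "emeasure lborel (box (- a) a) = ennreal (\<Prod>b\<in>Basis. (a - (- a)) \<bullet> b)"
      using r by (subst emeasure_lborel_box) (auto simp: Basis_vec_def a_def inner_axis)
    ultimately have "(\<Prod>b\<in>Basis. (a - (- a)) \<bullet> b) \<le> 0" by (simp only: ennreal_eq_0_iff)
    moreover have "(\<Prod>b\<in>Basis. (a - (- a)) \<bullet> b) > 0"
      using r by (intro prod_pos) (auto simp: Basis_vec_def a_def inner_axis)
    ultimately show False by linarith
  qed
  moreover have "I \<ge> 0" unfolding I_def by (intro integral_nonneg_AE) (simp add: p0)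
  ultimately have I: "I > 0" by simp
  define \<eta> where "\<eta> = box_bump (1 / I) 1 (- a) a"
  have eq: "\<eta> x = \<phi> x / I" for x by (simp add: \<eta>_def \<phi>_def box_bump_def prod_fun_def)
  have refl: "(\<lambda>x. \<eta> (y - x)) = box_bump (1 / I) 1 (y - a) (y + a)" for y
  proof
    fix x
    have "bump 1 (- r) r (y $ j - x $ j) = bump 1 (y $ j - r) (y $ j + r) (x $ j)" for j
      unfolding bump_def by (simp add: algebra_simps)
    then show "\<eta> (y - x) = box_bump (1 / I) 1 (y - a) (y + a) x"
      by (simp add: \<eta>_def box_bump_def prod_fun_def a_def)
  qed
  have "norm x < d" if "\<eta> x \<noteq> 0" for x
  proof -
    have "x \<in> box (- a) a" using that nz eq by auto
    then have "\<bar>x $ j\<bar> < r" for j by (auto simp: mem_box_cart a_def abs_less_iff minus_less_iff)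
    then have "(\<Sum>j\<in>UNIV. \<bar>x $ j\<bar>) < (\<Sum>j\<in>(UNIV::'n set). r)" by (intro sum_strict_mono) auto
    also have "\<dots> = d" by (simp add: r_def)
    finally show ?thesis using norm_le_l1_cart[of x] by simp
  qed
  moreover have "test_fun \<eta>" unfolding \<eta>_def by (intro test_fun_box_bump) simp
  moreover have "test_fun (\<lambda>x. \<eta> (y - x))" for y unfolding refl by (intro test_fun_box_bump) simp
  moreover have "(\<integral>x. \<eta> x \<partial>lborel) = 1" using I by (simp add: eq flip: I_def)
  moreover have "0 \<le> \<eta> x" for x using I p0 by (simp add: eq)
  ultimately show ?thesis unfolding mollifier_def by blast
qed

lemma mollifier_tame: "mollifier d \<eta> \<Longrightarrow> tame \<eta>"
  by (simp add: mollifier_def test_fun_tame)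

lemma mollifier_integral_reflect:
  assumes "mollifier d \<eta>"
  shows "(\<integral>x. \<eta> (y - x) \<partial>lborel) = 1" "integrable lborel (\<lambda>x. \<eta> (y - x))"
proof -
  show "(\<integral>x. \<eta> (y - x) \<partial>lborel) = 1"
    using integral_lborel_reflect[OF tame_measurable[OF mollifier_tame[OF assms]], of y] assms
    by (simp add: mollifier_def)
  show "integrable lborel (\<lambda>x. \<eta> (y - x))"
    using assms by (intro tame_integrable test_fun_tame) (simp add: mollifier_def)
qed

lemma conv_mollifier_bound:
  assumes f: "integrable lborel f" and L: "AE x in lborel. \<bar>f x\<bar> \<le> L" and m: "mollifier d \<eta>"
  shows "\<bar>conv f \<eta> y\<bar> \<le> L"
proof -
  have "\<bar>conv f \<eta> y\<bar> \<le> (\<integral>x. \<bar>f x * \<eta> (y - x)\<bar> \<partial>lborel)" unfolding conv_def by (rule integral_abs_bound)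
  also have "\<dots> \<le> (\<integral>x. L * \<eta> (y - x) \<partial>lborel)"
  proof (rule integral_mono_AE)
    show "AE x in lborel. \<bar>f x * \<eta> (y - x)\<bar> \<le> L * \<eta> (y - x)"
      using L by eventually_elim (use m in \<open>auto simp: mollifier_def abs_mult intro!: mult_right_mono\<close>)
  qed (use mollifier_integral_reflect[OF m, of y] conv_integrable[OF f mollifier_tame[OF m]] in \<open>auto intro: integrable_abs\<close>)
  also have "\<dots> = L" using mollifier_integral_reflect[OF m] by simp
  finally show ?thesis .
qed

text \<open>The error is an average of differences of \<open>f\<close> and its translates by vectors
  shorter than \<open>d\<close>; exchanging the integrals reduces it to continuity of
  translations.\<close>

lemma conv_L1_approx:
  fixes f :: "real^'n::finite \<Rightarrow> real"
  assumes f: "integrable lborel f" and e: "e > 0"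
  obtains d where "d > 0" "\<And>\<eta>. mollifier d \<eta> \<Longrightarrow> (\<integral>\<^sup>+y. ennreal \<bar>conv f \<eta> y - f y\<bar> \<partial>lborel) \<le> ennreal e"
proof -
  obtain d where d: "d > 0" "\<And>z. norm z < d \<Longrightarrow> (\<integral>x. \<bar>f (z + x) - f x\<bar> \<partial>lborel) < e"
    using L1_shift_continuous_integrable[OF f] e unfolding L1_shift_continuous_def by blast
  show ?thesis
  proof (rule that[OF d(1)])
    fix \<eta> :: "real^'n \<Rightarrow> real" assume m: "mollifier d \<eta>"
    have \<eta>0: "0 \<le> \<eta> x" for x using m by (simp add: mollifier_def)
    note [measurable] = tame_measurable[OF mollifier_tame[OF m]] borel_measurable_integrable[OF f, unfolded measurable_lborel2]
    have "ennreal \<bar>conv f \<eta> y - f y\<bar> \<le> (\<integral>\<^sup>+z. ennreal \<bar>f (y - z) - f y\<bar> * ennreal (\<eta> z) \<partial>lborel)" for y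
    proof -
      have i1: "integrable lborel (\<lambda>x. (f x - f y) * \<eta> (y - x))"
        unfolding left_diff_distrib
        using conv_integrable[OF f mollifier_tame[OF m]] mollifier_integral_reflect(2)[OF m] by (intro Bochner_Integration.integrable_diff) auto
      have "conv f \<eta> y - f y = (\<integral>x. (f x - f y) * \<eta> (y - x) \<partial>lborel)"
        unfolding left_diff_distrib conv_def
        using conv_integrable[OF f mollifier_tame[OF m]] mollifier_integral_reflect[OF m] by simp
      then have "ennreal \<bar>conv f \<eta> y - f y\<bar> \<le> (\<integral>\<^sup>+x. ennreal \<bar>(f x - f y) * \<eta> (y - x)\<bar> \<partial>lborel)"
        using integral_norm_bound_ennreal[OF i1] by simp
      also have "\<dots> = (\<integral>\<^sup>+x. ennreal \<bar>(f (y - (y - x)) - f y) * \<eta> (y - x)\<bar> \<partial>lborel)" by simp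
      also have "\<dots> = (\<integral>\<^sup>+z. ennreal \<bar>(f (y - z) - f y) * \<eta> z\<bar> \<partial>lborel)"
        by (rule nn_integral_lborel_reflect[of "\<lambda>z. ennreal \<bar>(f (y - z) - f y) * \<eta> z\<bar>"]) measurable
      also have "\<dots> = (\<integral>\<^sup>+z. ennreal \<bar>f (y - z) - f y\<bar> * ennreal (\<eta> z) \<partial>lborel)"
        using \<eta>0 by (intro nn_integral_cong) (simp add: abs_mult ennreal_mult)
      finally show ?thesis .
    qed
    then have "(\<integral>\<^sup>+y. ennreal \<bar>conv f \<eta> y - f y\<bar> \<partial>lborel)
       \<le> (\<integral>\<^sup>+y. (\<integral>\<^sup>+z. ennreal \<bar>f (y - z) - f y\<bar> * ennreal (\<eta> z) \<partial>lborel) \<partial>lborel)"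
      by (intro nn_integral_mono)
    also have "\<dots> = (\<integral>\<^sup>+z. (\<integral>\<^sup>+y. ennreal \<bar>f (y - z) - f y\<bar> * ennreal (\<eta> z) \<partial>lborel) \<partial>lborel)"
      by (rule lborel_pair.Fubini') measurable
    also have "\<dots> = (\<integral>\<^sup>+z. (\<integral>\<^sup>+y. ennreal \<bar>f (y - z) - f y\<bar> \<partial>lborel) * ennreal (\<eta> z) \<partial>lborel)"
      by (intro nn_integral_cong nn_integral_multc) measurable
    also have "\<dots> \<le> (\<integral>\<^sup>+z. ennreal e * ennreal (\<eta> z) \<partial>lborel)"
    proof (rule nn_integral_mono)
      fix z
      show "(\<integral>\<^sup>+y. ennreal \<bar>f (y - z) - f y\<bar> \<partial>lborel) * ennreal (\<eta> z) \<le> ennreal e * ennreal (\<eta> z)"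
      proof (cases "\<eta> z = 0")
        case False
        then have z: "norm (- z) < d" using m by (simp add: mollifier_def)
        have "integrable lborel (\<lambda>y. \<bar>f (- z + y) - f y\<bar>)"
          using integrable_lborel_shift[OF f] f by (intro integrable_abs Bochner_Integration.integrable_diff)
        then have "(\<integral>\<^sup>+y. ennreal \<bar>f (- z + y) - f y\<bar> \<partial>lborel) = ennreal (\<integral>y. \<bar>f (- z + y) - f y\<bar> \<partial>lborel)"
          by (intro nn_integral_eq_integral) auto
        also have "\<dots> \<le> ennreal e" using d(2)[OF z] by (intro ennreal_leI) simp
        finally show ?thesis by (intro mult_right_mono) (simp_all add: add.commute)
      qed simp
    qed
    also have "\<dots> = ennreal e * (\<integral>\<^sup>+z. ennreal (\<eta> z) \<partial>lborel)"
      by (intro nn_integral_cmult) measurable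
    also have "(\<integral>\<^sup>+z. ennreal (\<eta> z) \<partial>lborel) = 1"
      using m tame_integrable[OF mollifier_tame[OF m]] \<eta>0 by (subst nn_integral_eq_integral) (auto simp: mollifier_def)
    finally show "(\<integral>\<^sup>+y. ennreal \<bar>conv f \<eta> y - f y\<bar> \<partial>lborel) \<le> ennreal e" by simp
  qed
qed

text \<open>The left side is the tangent line of \<open>s powr p\<close> at \<open>m\<close>, so
  this is convexity. It supplies Jensen's inequality in \<open>conv_Lp_bound\<close>.\<close>

lemma powr_tangent_le:
  fixes p s m :: real
  assumes "p > 1" "s \<ge> 0" "m \<ge> 0"
  shows "p * m powr (p - 1) * s - (p - 1) * m powr p \<le> s powr p"
proof -
  have "s * m powr (p - 1) \<le> s powr p / p + (m powr (p - 1)) powr (p / (p - 1)) / (p / (p - 1))"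
    using assms by (intro Youngs_inequality) (auto simp: field_simps)
  also have "(m powr (p - 1)) powr (p / (p - 1)) = m powr p"
    using assms by (simp add: powr_powr)
  finally have "p * (s * m powr (p - 1)) \<le> p * (s powr p / p + m powr p / (p / (p - 1)))"
    using assms by (intro mult_left_mono) auto
  also have "\<dots> = s powr p + (p - 1) * m powr p" using assms by (simp add: distrib_left mult.commute)
  finally show ?thesis by (simp add: ac_simps)
qed

lemma conv_Lp_bound:
  fixes f :: "real^'n::finite \<Rightarrow> real"
  assumes f: "integrable lborel f" and fp: "integrable lborel (\<lambda>x. \<bar>f x\<bar> powr p)" and p: "p > 1" and m: "mollifier d \<eta>"
  shows "(\<integral>\<^sup>+y. ennreal (\<bar>conv f \<eta> y\<bar> powr p) \<partial>lborel) \<le> (\<integral>\<^sup>+x. ennreal (\<bar>f x\<bar> powr p) \<partial>lborel)"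
proof -
  have \<eta>0: "0 \<le> \<eta> x" for x using m by (simp add: mollifier_def)
  note t = mollifier_tame[OF m]
  note [measurable] = tame_measurable[OF t] borel_measurable_integrable[OF f, unfolded measurable_lborel2]
  have "\<bar>conv f \<eta> y\<bar> powr p \<le> (\<integral>x. \<bar>f x\<bar> powr p * \<eta> (y - x) \<partial>lborel)" for y
  proof -
    define c where "c = \<bar>conv f \<eta> y\<bar>"
    have ia: "integrable lborel (\<lambda>x. \<bar>f x\<bar> * \<eta> (y - x))" using conv_integrable[OF integrable_abs[OF f] t] .
    have "c \<le> (\<integral>x. \<bar>f x * \<eta> (y - x)\<bar> \<partial>lborel)" unfolding conv_def c_def by (rule integral_abs_bound)
    then have c: "c \<le> (\<integral>x. \<bar>f x\<bar> * \<eta> (y - x) \<partial>lborel)" using \<eta>0 by (simp add: abs_mult)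
    \<comment> \<open>At \<open>c\<close> the tangent takes the value \<open>c powr p\<close>. Its
      average against the mollifier is at least that value and at most the average of
      \<open>\<bar>f x\<bar> powr p\<close>.\<close>
    have "c powr p = p * c powr (p - 1) * c - (p - 1) * c powr p"
    proof -
      have "c powr (p - 1) * c = c powr p" using powr_mult_base[of c "p - 1"] by (simp add: mult.commute c_def)
      then show ?thesis unfolding mult.assoc by (simp add: algebra_simps)
    qed
    also have "\<dots> \<le> p * c powr (p - 1) * (\<integral>x. \<bar>f x\<bar> * \<eta> (y - x) \<partial>lborel) - (p - 1) * c powr p"
      using p c by (intro diff_right_mono mult_left_mono) auto
    also have "\<dots> = (\<integral>x. (p * c powr (p - 1) * \<bar>f x\<bar> - (p - 1) * c powr p) * \<eta> (y - x) \<partial>lborel)"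
      unfolding left_diff_distrib mult.assoc using ia mollifier_integral_reflect[OF m, of y] by simp
    also have "\<dots> \<le> (\<integral>x. \<bar>f x\<bar> powr p * \<eta> (y - x) \<partial>lborel)"
    proof (rule integral_mono)
      show "integrable lborel (\<lambda>x. (p * c powr (p - 1) * \<bar>f x\<bar> - (p - 1) * c powr p) * \<eta> (y - x))"
        unfolding left_diff_distrib mult.assoc using ia mollifier_integral_reflect[OF m, of y] by simp
      show "integrable lborel (\<lambda>x. \<bar>f x\<bar> powr p * \<eta> (y - x))" by (rule conv_integrable[OF fp t])
      show "(p * c powr (p - 1) * \<bar>f x\<bar> - (p - 1) * c powr p) * \<eta> (y - x) \<le> \<bar>f x\<bar> powr p * \<eta> (y - x)" for x
        using p \<eta>0 by (intro mult_right_mono powr_tangent_le) (auto simp: c_def)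
    qed
    finally show ?thesis by (simp add: c_def)
  qed
  then have "(\<integral>\<^sup>+y. ennreal (\<bar>conv f \<eta> y\<bar> powr p) \<partial>lborel) \<le> (\<integral>\<^sup>+y. ennreal (\<integral>x. \<bar>f x\<bar> powr p * \<eta> (y - x) \<partial>lborel) \<partial>lborel)"
    by (intro nn_integral_mono ennreal_leI)
  also have "\<dots> = (\<integral>\<^sup>+y. (\<integral>\<^sup>+x. ennreal (\<bar>f x\<bar> powr p) * ennreal (\<eta> (y - x)) \<partial>lborel) \<partial>lborel)"
    using \<eta>0 conv_integrable[OF fp t] by (intro nn_integral_cong, subst nn_integral_eq_integral[symmetric]) (auto simp: ennreal_mult)
  also have "\<dots> = (\<integral>\<^sup>+x. (\<integral>\<^sup>+y. ennreal (\<bar>f x\<bar> powr p) * ennreal (\<eta> (y - x)) \<partial>lborel) \<partial>lborel)"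
    by (rule lborel_pair.Fubini') measurable
  also have "\<dots> = (\<integral>\<^sup>+x. ennreal (\<bar>f x\<bar> powr p) \<partial>lborel)"
  proof (rule nn_integral_cong)
    fix x
    have "(\<integral>\<^sup>+y. ennreal (\<eta> (y - x)) \<partial>lborel) = (\<integral>\<^sup>+y. ennreal (\<eta> y) \<partial>lborel)"
      using nn_integral_lborel_shift[of "\<lambda>y. ennreal (\<eta> y)" "- x"] by simp
    also have "\<dots> = 1"
      using m tame_integrable[OF t] \<eta>0 by (subst nn_integral_eq_integral) (auto simp: mollifier_def)
    finally show "(\<integral>\<^sup>+y. ennreal (\<bar>f x\<bar> powr p) * ennreal (\<eta> (y - x)) \<partial>lborel) = ennreal (\<bar>f x\<bar> powr p)"
      by (subst nn_integral_cmult) auto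
  qed
  finally show ?thesis .
qed

text \<open>The first-order case of \<open>weak_deriv\<close> for Borel functions over
  \<open>lborel\<close>; integrability is assumed separately where it is used.\<close>

definition weak_pd :: "'n \<Rightarrow> (real^'n::finite \<Rightarrow> real) \<Rightarrow> (real^'n \<Rightarrow> real) \<Rightarrow> bool" where
  "weak_pd i f g \<longleftrightarrow> (\<forall>\<psi>. test_fun \<psi> \<longrightarrow> (\<integral>x. f x * pd i \<psi> x \<partial>lborel) = - (\<integral>x. g x * \<psi> x \<partial>lborel))"

text \<open>The test function is \<open>\<lambda>x. \<eta> (y - x)\<close>. Its reflection and the
  integration by parts each contribute a sign, and the signs cancel.\<close>

lemma conv_weak_pd:
  assumes w: "weak_pd i f g" and m: "mollifier d \<eta>"
  shows "conv f (pd i \<eta>) = conv g \<eta>"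
proof
  fix y
  have dd: "has_dd (axis i 1) \<eta> (pd i \<eta>)" using m by (simp add: mollifier_def test_fun_has_dd)
  have t: "test_fun (\<lambda>x. \<eta> (y - x))" using m by (simp add: mollifier_def)
  have "pd i (\<lambda>x. \<eta> (y - x)) x = - pd i \<eta> (y - x)" for x
  proof -
    have "((\<lambda>t. \<eta> ((y - x) + t *\<^sub>R axis i 1)) has_real_derivative pd i \<eta> (y - x)) (at (- 0))"
      using dd by (simp add: has_dd_def)
    then have "((\<lambda>t. \<eta> ((y - x) + (- t) *\<^sub>R axis i 1)) has_real_derivative pd i \<eta> (y - x) * (-1)) (at 0)"
      by (intro DERIV_chain'[where f="\<lambda>t. - t" and g="\<lambda>t. \<eta> ((y - x) + t *\<^sub>R axis i 1)", THEN DERIV_cong])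
        (auto intro!: derivative_eq_intros)
    then have "((\<lambda>t. \<eta> (y - (x + t *\<^sub>R axis i 1))) has_real_derivative - pd i \<eta> (y - x)) (at 0)"
      by (simp add: algebra_simps)
    then show ?thesis unfolding pd_def[of i "\<lambda>x. \<eta> (y - x)"] by (rule DERIV_imp_deriv)
  qed
  then have "(\<integral>x. f x * (- pd i \<eta> (y - x)) \<partial>lborel) = - (\<integral>x. g x * \<eta> (y - x) \<partial>lborel)"
    using w t unfolding weak_pd_def by (metis (no_types, lifting) Bochner_Integration.integral_cong)
  then show "conv f (pd i \<eta>) y = conv g \<eta> y" by (simp add: conv_def)
qed

section \<open>Interpolation inequality and power rule\<close>

text \<open>The odd companion of \<open>\<bar>s\<bar> powr a\<close>. For \<open>a > 1\<close> each
  of the two differentiates, also at 0, into a multiple of the other with the exponent lowered by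
  one.\<close>

definition spow :: "real \<Rightarrow> real \<Rightarrow> real" where
  "spow a s = sgn s * \<bar>s\<bar> powr a"

lemma spow_DERIV:
  assumes a: "a > 1"
  shows "(spow a has_real_derivative a * \<bar>s\<bar> powr (a - 1)) (at s)"
    and "((\<lambda>s. \<bar>s\<bar> powr a) has_real_derivative a * spow (a - 1) s) (at s)"
proof -
  consider "s > 0" | "s < 0" | "s = 0" by linarith
  then have "(spow a has_real_derivative a * \<bar>s\<bar> powr (a - 1)) (at s) \<and>
     ((\<lambda>s. \<bar>s\<bar> powr a) has_real_derivative a * spow (a - 1) s) (at s)"
  proof cases
    case 1
    have "((\<lambda>s. s powr a) has_real_derivative a * s powr (a - 1)) (at s)"
      using 1 by (auto intro!: derivative_eq_intros)
    then show ?thesis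
      using has_field_derivative_transform_within_open[where S="{0<..}" and a=s and f="\<lambda>s. s powr a"] 1
      by (auto simp: spow_def)
  next
    case 2
    have "((\<lambda>s. (- s) powr a) has_real_derivative - (a * (- s) powr (a - 1))) (at s)"
      using 2 by (auto intro!: derivative_eq_intros)
    moreover have "((\<lambda>s. - ((- s) powr a)) has_real_derivative a * (- s) powr (a - 1)) (at s)"
      using 2 by (auto intro!: derivative_eq_intros)
    ultimately show ?thesis
      using has_field_derivative_transform_within_open[where S="{..<0}" and a=s and f="\<lambda>s. (- s) powr a" and g="\<lambda>s. \<bar>s\<bar> powr a"]
        has_field_derivative_transform_within_open[where S="{..<0}" and a=s and f="\<lambda>s. - ((- s) powr a)" and g="spow a"] 2
      by (auto simp: spow_def)
  next
    case 3
    \<comment> \<open>At 0 both difference quotients have modulus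
      \<open>\<bar>h\<bar> powr (a - 1)\<close>, which tends to 0.\<close>
    have "((\<lambda>h::real. \<bar>h\<bar> powr (a - 1)) \<longlongrightarrow> \<bar>0\<bar> powr (a - 1)) (at 0)"
      using a by (intro tendsto_powr' tendsto_intros) auto
    then have lim: "((\<lambda>h::real. \<bar>h\<bar> powr (a - 1)) \<longlongrightarrow> 0) (at 0)" by simp
    have eq: "\<bar>h\<bar> powr a = \<bar>h\<bar> * \<bar>h\<bar> powr (a - 1)" for h :: real using powr_mult_base[of "\<bar>h\<bar>" "a - 1"] by simp
    have "((\<lambda>h. \<bar>h\<bar> powr a / h) \<longlongrightarrow> 0) (at 0)" "((\<lambda>h. spow a h / h) \<longlongrightarrow> 0) (at 0)"
      by (rule Lim_null_comparison[OF _ lim], use eq in \<open>auto simp: abs_mult spow_def eventually_at_filter\<close>)+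
    then show ?thesis using 3 by (simp add: DERIV_def spow_def)
  qed
  then show "(spow a has_real_derivative a * \<bar>s\<bar> powr (a - 1)) (at s)"
    and "((\<lambda>s. \<bar>s\<bar> powr a) has_real_derivative a * spow (a - 1) s) (at s)" by auto
qed

lemma spow_continuous: "a > 1 \<Longrightarrow> continuous_on A (spow a)"
  using spow_DERIV(1) by (meson DERIV_isCont continuous_at_imp_continuous_on)

lemma abs_powr_continuous: "a > 0 \<Longrightarrow> continuous_on A (\<lambda>s::real. \<bar>s\<bar> powr a)"
  by (intro continuous_on_powr' continuous_intros) auto

lemma spow_0 [simp]: "spow a 0 = 0"
  by (simp add: spow_def)

lemma energy_identity:
  assumes t: "tame v" "tame v1" "tame v2" and d: "has_dd e v v1" "has_dd e v1 v2"
  shows "(\<integral>x. (v1 x)\<^sup>2 \<partial>lborel) = - (\<integral>x. v x * v2 x \<partial>lborel)"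
proof -
  have "(\<integral>x. v1 x * v1 x + v x * v2 x \<partial>lborel) = 0"
    using has_dd_mult[OF d] t by (intro integral_dd_eq_0[of "\<lambda>x. v x * v1 x"] tame_add tame_mult_tame)
  then show ?thesis using t by (simp add: tame_integrable tame_mult_tame power2_eq_square)
qed

text \<open>Integrating the derivative of \<open>v x * spow (2*p-1) (v1 x)\<close> expresses the
  left side through \<open>v\<close>, \<open>\<bar>v1 x\<bar> powr (2*p-2)\<close> and
  \<open>v2\<close>. Young's inequality with exponents \<open>p / (p-1)\<close> and \<open>p\<close>
  returns the left side with factor \<open>1 - 1/p\<close>; the part kept and the other term both
  carry \<open>1/p\<close>, which cancels and leaves the stated constant.\<close>

lemma gradient_interpolation:
  assumes t: "tame v" "tame v1" "tame v2" and d: "has_dd e v v1" "has_dd e v1 v2"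
    and L: "\<And>x. \<bar>v x\<bar> \<le> L" and p: "p > 1"
  shows "(\<integral>x. \<bar>v1 x\<bar> powr (2*p) \<partial>lborel) \<le> ((2*p-1)*L) powr p * (\<integral>x. \<bar>v2 x\<bar> powr p \<partial>lborel)"
proof -
  let ?G = "spow (2*p-1)" and ?G' = "\<lambda>s. (2*p-1) * \<bar>s\<bar> powr (2*p-2)"
  have L0: "L \<ge> 0" using L[of undefined] by linarith
  have dG: "(?G has_real_derivative ?G' s) (at s)" for s
    using spow_DERIV(1)[of "2*p-1" s] p by simp
  have tG: "tame (\<lambda>x. ?G (v1 x))" by (rule tame_compose[OF t(2) spow_continuous]) (use p in auto)
  have tG': "tame (\<lambda>x. ?G' (v1 x))" 
    by (rule tame_compose[OF t(2)]) (use p in \<open>auto intro!: continuous_on_mult_left abs_powr_continuous\<close>)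
  have dd: "has_dd e (\<lambda>x. v x * ?G (v1 x)) (\<lambda>x. v1 x * ?G (v1 x) + v x * (?G' (v1 x) * v2 x))"
    by (intro has_dd_mult d has_dd_compose dG)
  have t1: "tame (\<lambda>x. \<bar>v1 x\<bar> powr (2*p))" "tame (\<lambda>x. \<bar>v2 x\<bar> powr p)"
    by (rule tame_compose[OF t(2) abs_powr_continuous] tame_compose[OF t(3) abs_powr_continuous]; use p in simp)+
  have t2: "tame (\<lambda>x. v x * (?G' (v1 x) * v2 x))" by (intro tame_mult_tame t tG')
  have eq: "v1 x * ?G (v1 x) = \<bar>v1 x\<bar> powr (2*p)" for x
  proof -
    have "v1 x * ?G (v1 x) = (v1 x * sgn (v1 x)) * \<bar>v1 x\<bar> powr (2*p-1)" unfolding spow_def by (rule mult.assoc[symmetric])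
    also have "v1 x * sgn (v1 x) = \<bar>v1 x\<bar>" by (rule abs_sgn[symmetric])
    also have "\<bar>v1 x\<bar> * \<bar>v1 x\<bar> powr (2*p-1) = \<bar>v1 x\<bar> powr (2*p)" using powr_mult_base[of "\<bar>v1 x\<bar>" "2*p-1"] by simp
    finally show ?thesis .
  qed
  have "(\<integral>x. v1 x * ?G (v1 x) + v x * (?G' (v1 x) * v2 x) \<partial>lborel) = 0"
    using dd by (rule integral_dd_eq_0[rotated 2]) (intro tame_add tame_mult_tame t tG tG')+
  then have "(\<integral>x. \<bar>v1 x\<bar> powr (2*p) \<partial>lborel) = (\<integral>x. - (v x * (?G' (v1 x) * v2 x)) \<partial>lborel)"
    unfolding eq using tame_integrable[OF t1(1)] tame_integrable[OF t2] by simp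
  also have "\<dots> \<le> (\<integral>x. (1 - 1/p) * \<bar>v1 x\<bar> powr (2*p) + ((2*p-1)*L) powr p / p * \<bar>v2 x\<bar> powr p \<partial>lborel)"
  proof (rule integral_mono)
    show "integrable lborel (\<lambda>x. - (v x * (?G' (v1 x) * v2 x)))" using tame_integrable[OF t2] by simp
    show "integrable lborel (\<lambda>x. (1 - 1/p) * \<bar>v1 x\<bar> powr (2*p) + ((2*p-1)*L) powr p / p * \<bar>v2 x\<bar> powr p)"
      using tame_integrable[OF t1(1)] tame_integrable[OF t1(2)] by simp
    fix x
    define A where "A = \<bar>v1 x\<bar> powr (2*p-2)"
    define B where "B = (2*p-1) * L * \<bar>v2 x\<bar>"
    have "- (v x * (?G' (v1 x) * v2 x)) \<le> \<bar>v x\<bar> * ((2*p-1) * A * \<bar>v2 x\<bar>)"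
      using p abs_ge_minus_self[of "v x * (?G' (v1 x) * v2 x)"] by (simp add: abs_mult A_def)
    also have "\<dots> \<le> L * ((2*p-1) * A * \<bar>v2 x\<bar>)"
      using p L by (intro mult_right_mono) (auto simp: A_def)
    also have "\<dots> = A * B" by (simp add: B_def)
    also have "\<dots> \<le> A powr (p/(p-1)) / (p/(p-1)) + B powr p / p"
    proof (rule Youngs_inequality)
      show "p / (p-1) > 1" "1 / (p/(p-1)) + 1/p = 1" using p by (auto simp: field_simps)
      show "A \<ge> 0" "B \<ge> 0" using p L0 by (auto simp: A_def B_def)
    qed (rule p)
    also have "A powr (p/(p-1)) = \<bar>v1 x\<bar> powr (2*p)"
    proof -
      have "(2*p-2) * (p/(p-1)) = 2*p" using p by (simp add: divide_simps)
      then show ?thesis by (simp add: A_def powr_powr)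
    qed
    also have "B powr p = ((2*p-1)*L) powr p * \<bar>v2 x\<bar> powr p"
      using p L0 by (simp add: B_def powr_mult)
    also have "\<bar>v1 x\<bar> powr (2*p) / (p/(p-1)) = (1 - 1/p) * \<bar>v1 x\<bar> powr (2*p)"
      using p by (simp add: field_simps)
    finally show "- (v x * (?G' (v1 x) * v2 x)) \<le> (1 - 1/p) * \<bar>v1 x\<bar> powr (2*p) + ((2*p-1)*L) powr p / p * \<bar>v2 x\<bar> powr p"
      by simp
  qed
  also have "\<dots> = (1 - 1/p) * (\<integral>x. \<bar>v1 x\<bar> powr (2*p) \<partial>lborel) + ((2*p-1)*L) powr p / p * (\<integral>x. \<bar>v2 x\<bar> powr p \<partial>lborel)"
    using tame_integrable[OF t1(1)] tame_integrable[OF t1(2)] by simp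
  finally have "(\<integral>x. \<bar>v1 x\<bar> powr (2*p) \<partial>lborel) / p \<le> ((2*p-1)*L) powr p * (\<integral>x. \<bar>v2 x\<bar> powr p \<partial>lborel) / p"
    by (simp add: left_diff_distrib)
  then show ?thesis using p by (simp add: divide_le_cancel)
qed

text \<open>With \<open>F s = \<bar>s\<bar> powr a\<close>, one integrates the derivative of
  \<open>F (v x) * pd i \<psi> x - F' (v x) * v1 x * \<psi> x\<close>. The cross terms cancel, so
  both derivatives move at once. The condition \<open>a > 2\<close> makes \<open>F\<close> twice
  differentiable also at zeros of \<open>v\<close>.\<close>

lemma chain_rule_tame:
  assumes t: "tame v" "tame v1" "tame v2" and d: "has_dd (axis i 1) v v1" "has_dd (axis i 1) v1 v2"
    and a: "a > 2" and \<psi>: "test_fun \<psi>"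
  shows "(\<integral>x. \<bar>v x\<bar> powr a * pd i (pd i \<psi>) x \<partial>lborel) =
     (\<integral>x. (a * (a-1) * \<bar>v x\<bar> powr (a-2) * \<psi> x) * (v1 x)\<^sup>2 + (a * spow (a-1) (v x) * \<psi> x) * v2 x \<partial>lborel)"
proof -
  note tp = test_fun_tame[OF \<psi>] test_fun_tame[OF test_fun_pd[OF \<psi>, of i]] test_fun_tame[OF test_fun_pd[OF test_fun_pd[OF \<psi>, of i], of i]]
  note dp = test_fun_has_dd[OF \<psi>, of i] test_fun_has_dd[OF test_fun_pd[OF \<psi>, of i], of i]
  let ?F = "\<lambda>s. \<bar>s\<bar> powr a" and ?F' = "\<lambda>s. a * spow (a-1) s" and ?F'' = "\<lambda>s. a * ((a-1) * \<bar>s\<bar> powr (a-1-1))"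
  have dF: "(?F has_real_derivative ?F' s) (at s)" "(?F' has_real_derivative ?F'' s) (at s)" for s
    by (rule spow_DERIV(2), use a in simp) (rule DERIV_cmult, rule spow_DERIV(1), use a in simp)
  have tF: "tame (\<lambda>x. ?F (v x))" "tame (\<lambda>x. ?F' (v x))" "tame (\<lambda>x. ?F'' (v x))"
    by (rule tame_compose[OF t(1)]; use a in \<open>auto intro!: continuous_on_mult_left abs_powr_continuous spow_continuous\<close>)+
  have "has_dd (axis i 1) (\<lambda>x. ?F (v x) * pd i \<psi> x - (?F' (v x) * v1 x) * \<psi> x)
    (\<lambda>x. ((?F' (v x) * v1 x) * pd i \<psi> x + ?F (v x) * pd i (pd i \<psi>) x)
      - (((?F'' (v x) * v1 x) * v1 x + ?F' (v x) * v2 x) * \<psi> x + (?F' (v x) * v1 x) * pd i \<psi> x))"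
    by (intro has_dd_diff has_dd_mult has_dd_compose dF dp d)
  then have "(\<integral>x. ((?F' (v x) * v1 x) * pd i \<psi> x + ?F (v x) * pd i (pd i \<psi>) x)
      - (((?F'' (v x) * v1 x) * v1 x + ?F' (v x) * v2 x) * \<psi> x + (?F' (v x) * v1 x) * pd i \<psi> x) \<partial>lborel) = 0"
    by (rule integral_dd_eq_0[rotated 2]) (intro tame_add tame_diff tame_mult_tame t tF tp)+
  also have "(\<lambda>x. ((?F' (v x) * v1 x) * pd i \<psi> x + ?F (v x) * pd i (pd i \<psi>) x)
      - (((?F'' (v x) * v1 x) * v1 x + ?F' (v x) * v2 x) * \<psi> x + (?F' (v x) * v1 x) * pd i \<psi> x))
    = (\<lambda>x. ?F (v x) * pd i (pd i \<psi>) x - ((?F'' (v x) * \<psi> x) * (v1 x * v1 x) + (?F' (v x) * \<psi> x) * v2 x))"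
    by (auto simp: algebra_simps)
  finally have "(\<integral>x. ?F (v x) * pd i (pd i \<psi>) x \<partial>lborel) = (\<integral>x. (?F'' (v x) * \<psi> x) * (v1 x * v1 x) + (?F' (v x) * \<psi> x) * v2 x \<partial>lborel)"
  proof -
    have "tame (\<lambda>x. ?F (v x) * pd i (pd i \<psi>) x)" "tame (\<lambda>x. (?F'' (v x) * \<psi> x) * (v1 x * v1 x) + (?F' (v x) * \<psi> x) * v2 x)"
      by (intro tame_add tame_mult_tame t tF tp)+
    note i = this[THEN tame_integrable]
    assume "(\<integral>x. ?F (v x) * pd i (pd i \<psi>) x - ((?F'' (v x) * \<psi> x) * (v1 x * v1 x) + (?F' (v x) * \<psi> x) * v2 x) \<partial>lborel) = 0"
    then show ?thesis unfolding Bochner_Integration.integral_diff[OF i] by linarith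
  qed
  then show ?thesis by (simp add: power2_eq_square mult.assoc)
qed

section \<open>Passing to the limit in mollifications\<close>

lemma AE_tendsto_0_if_L1_rate:
  fixes u :: "nat \<Rightarrow> 'a \<Rightarrow> real"
  assumes m: "\<And>n. u n \<in> borel_measurable M" and b: "\<And>n. (\<integral>\<^sup>+x. ennreal \<bar>u n x\<bar> \<partial>M) \<le> ennreal ((1/4)^n)"
  shows "AE x in M. (\<lambda>n. u n x) \<longlonglongrightarrow> 0"
proof -
  have "(\<integral>\<^sup>+x. (\<Sum>n. ennreal \<bar>u n x\<bar>) \<partial>M) = (\<Sum>n. \<integral>\<^sup>+x. ennreal \<bar>u n x\<bar> \<partial>M)"
    using m by (intro nn_integral_suminf) simp
  also have "\<dots> \<le> (\<Sum>n. ennreal ((1/4)^n))" by (rule suminf_le[OF b summableI summableI])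
  also have "\<dots> = ennreal (\<Sum>n. (1/4)^n)" by (rule suminf_ennreal2) (auto intro: summable_geometric)
  also have "\<dots> < \<infinity>" by (simp only: ennreal_less_top infinity_ennreal_def)
  finally have "AE x in M. (\<Sum>n. ennreal \<bar>u n x\<bar>) \<noteq> \<infinity>"
    using m by (intro nn_integral_PInf_AE borel_measurable_suminf) (auto simp del: not_infinity_eq)
  then show ?thesis
  proof eventually_elim
    case (elim x)
    then have "summable (\<lambda>n. \<bar>u n x\<bar>)" by (intro summable_suminf_not_top) (simp_all only: abs_ge_zero infinity_ennreal_def simp_thms)
    then have "(\<lambda>n. \<bar>u n x\<bar>) \<longlonglongrightarrow> 0" by (rule summable_LIMSEQ_zero)
    then show ?case by (rule tendsto_rabs_zero_cancel)
  qed
qed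

text \<open>The product is split as \<open>\<phi> n x * w' x + \<phi> n x * (w n x - w' x)\<close>:
  dominated convergence handles the first part, the uniform bound and convergence in the mean the
  second.\<close>

lemma tendsto_integral_mult_L1:
  fixes \<phi> w :: "nat \<Rightarrow> 'a \<Rightarrow> real"
  assumes m: "\<And>n. \<phi> n \<in> borel_measurable M" "\<phi>' \<in> borel_measurable M"
    and c: "AE x in M. (\<lambda>n. \<phi> n x) \<longlonglongrightarrow> \<phi>' x" and C: "\<And>n x. \<bar>\<phi> n x\<bar> \<le> C"
    and w: "\<And>n. integrable M (w n)" "integrable M w'" and L1: "(\<lambda>n. \<integral>x. \<bar>w n x - w' x\<bar> \<partial>M) \<longlonglongrightarrow> 0"
  shows "integrable M (\<lambda>x. \<phi>' x * w' x)" and "(\<lambda>n. \<integral>x. \<phi> n x * w n x \<partial>M) \<longlonglongrightarrow> (\<integral>x. \<phi>' x * w' x \<partial>M)"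
proof -
  have mw: "w' \<in> borel_measurable M" using w(2) by (rule borel_measurable_integrable)
  have iC: "integrable M (\<lambda>x. C * \<bar>w' x\<bar>)" using w(2) by simp
  have ae: "AE x in M. (\<lambda>n. \<phi> n x * w' x) \<longlonglongrightarrow> \<phi>' x * w' x"
    using c by eventually_elim (intro tendsto_mult tendsto_const)
  have bd: "AE x in M. norm (\<phi> n x * w' x) \<le> C * \<bar>w' x\<bar>" for n
    using C by (intro AE_I2) (auto simp: abs_mult intro!: mult_right_mono)
  have mm: "(\<lambda>x. \<phi>' x * w' x) \<in> borel_measurable M" "\<And>n. (\<lambda>x. \<phi> n x * w' x) \<in> borel_measurable M"
    using m mw by auto
  show "integrable M (\<lambda>x. \<phi>' x * w' x)"
    by (rule integrable_dominated_convergence[OF mm iC ae bd])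
  have l1: "(\<lambda>n. \<integral>x. \<phi> n x * w' x \<partial>M) \<longlonglongrightarrow> (\<integral>x. \<phi>' x * w' x \<partial>M)"
    by (rule integral_dominated_convergence[OF mm iC ae bd])
  have ip: "integrable M (\<lambda>x. \<phi> n x * g x)" if g: "integrable M g" for n g
  proof (rule Bochner_Integration.integrable_bound)
    show "integrable M (\<lambda>x. C * \<bar>g x\<bar>)" using g by simp
    show "AE x in M. norm (\<phi> n x * g x) \<le> norm (C * \<bar>g x\<bar>)"
    proof (intro AE_I2)
      fix x
      have "\<bar>\<phi> n x\<bar> \<le> \<bar>C\<bar>" using C[of n x] by linarith
      then show "norm (\<phi> n x * g x) \<le> norm (C * \<bar>g x\<bar>)" by (auto simp: abs_mult intro!: mult_right_mono)
    qed
  qed (use m g in auto)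
  have "(\<lambda>n. \<integral>x. \<phi> n x * (w n x - w' x) \<partial>M) \<longlonglongrightarrow> 0"
  proof (rule Lim_null_comparison)
    show "(\<lambda>n. C * (\<integral>x. \<bar>w n x - w' x\<bar> \<partial>M)) \<longlonglongrightarrow> 0" using tendsto_mult_right_zero[OF L1] .
    show "\<forall>\<^sub>F n in sequentially. norm (\<integral>x. \<phi> n x * (w n x - w' x) \<partial>M) \<le> C * (\<integral>x. \<bar>w n x - w' x\<bar> \<partial>M)"
    proof (intro always_eventually allI)
      fix n
      have i: "integrable M (\<lambda>x. w n x - w' x)" using w by simp
      have "norm (\<integral>x. \<phi> n x * (w n x - w' x) \<partial>M) \<le> (\<integral>x. norm (\<phi> n x * (w n x - w' x)) \<partial>M)"
        by (rule integral_norm_bound)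
      also have "\<dots> \<le> (\<integral>x. C * \<bar>w n x - w' x\<bar> \<partial>M)"
        using ip[OF i] i C by (intro integral_mono integrable_norm) (auto simp: abs_mult intro!: mult_right_mono)
      finally show "norm (\<integral>x. \<phi> n x * (w n x - w' x) \<partial>M) \<le> C * (\<integral>x. \<bar>w n x - w' x\<bar> \<partial>M)" by simp
    qed
  qed
  from tendsto_add[OF l1 this]
  have "(\<lambda>n. (\<integral>x. \<phi> n x * w' x \<partial>M) + (\<integral>x. \<phi> n x * (w n x - w' x) \<partial>M)) \<longlonglongrightarrow> (\<integral>x. \<phi>' x * w' x \<partial>M)" by simp
  moreover have "(\<integral>x. \<phi> n x * w' x \<partial>M) + (\<integral>x. \<phi> n x * (w n x - w' x) \<partial>M) = (\<integral>x. \<phi> n x * w n x \<partial>M)" for n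
    using ip[OF w(1), of n] ip[OF w(2), of n] by (simp add: right_diff_distrib)
  ultimately show "(\<lambda>n. \<integral>x. \<phi> n x * w n x \<partial>M) \<longlonglongrightarrow> (\<integral>x. \<phi>' x * w' x \<partial>M)" by simp
qed

lemma nn_integral_le_if_AE_limit:
  fixes f :: "'a \<Rightarrow> real"
  assumes m: "\<And>n. u n \<in> borel_measurable M" and c: "AE x in M. (\<lambda>n. u n x) \<longlonglongrightarrow> f x"
    and b: "\<forall>\<^sub>F n in sequentially. (\<integral>\<^sup>+x. ennreal (u n x) \<partial>M) \<le> C"
  shows "(\<integral>\<^sup>+x. ennreal (f x) \<partial>M) \<le> C"
proof -
  have "(\<integral>\<^sup>+x. ennreal (f x) \<partial>M) = (\<integral>\<^sup>+x. liminf (\<lambda>n. ennreal (u n x)) \<partial>M)"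
  proof (intro nn_integral_cong_AE, use c in eventually_elim)
    fix x assume "(\<lambda>n. u n x) \<longlonglongrightarrow> f x"
    then have "(\<lambda>n. ennreal (u n x)) \<longlonglongrightarrow> ennreal (f x)" by (rule tendsto_ennrealI)
    then show "ennreal (f x) = liminf (\<lambda>n. ennreal (u n x))"
      by (intro lim_imp_Liminf[symmetric]) auto
  qed
  also have "\<dots> \<le> liminf (\<lambda>n. \<integral>\<^sup>+x. ennreal (u n x) \<partial>M)"
    using m by (intro nn_integral_liminf) auto
  also have "\<dots> \<le> limsup (\<lambda>n. \<integral>\<^sup>+x. ennreal (u n x) \<partial>M)"
    by (rule Liminf_le_Limsup) simp
  also have "\<dots> \<le> C" by (rule Limsup_bounded[OF b])
  finally show ?thesis .
qed

lemma integral_le_if_nn_integral_le: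
  assumes i: "integrable M f" and n: "(\<integral>\<^sup>+x. ennreal \<bar>f x\<bar> \<partial>M) \<le> ennreal c" and c: "c \<ge> 0"
  shows "(\<integral>x. \<bar>f x\<bar> \<partial>M) \<le> c"
proof -
  have "ennreal (\<integral>x. \<bar>f x\<bar> \<partial>M) = (\<integral>\<^sup>+x. ennreal \<bar>f x\<bar> \<partial>M)"
    using i by (intro nn_integral_eq_integral[symmetric]) auto
  then have "ennreal (\<integral>x. \<bar>f x\<bar> \<partial>M) \<le> ennreal c" using n by simp
  then show ?thesis unfolding ennreal_le_iff[OF c] .
qed

text \<open>The geometric rate gives convergence almost everywhere without passing to subsequences,
  and is fast enough for \<open>tendsto_square_L1\<close>.\<close>

lemma mollified_sequence:
  fixes h g1 g2 :: "real^'n::finite \<Rightarrow> real"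
  assumes i: "integrable lborel h" "integrable lborel g1" "integrable lborel g2"
    and s: "\<And>x. norm x > R \<Longrightarrow> h x = 0" "\<And>x. norm x > R \<Longrightarrow> g1 x = 0" "\<And>x. norm x > R \<Longrightarrow> g2 x = 0"
    and L: "AE x in lborel. \<bar>h x\<bar> \<le> L"
    and w: "weak_pd i h g1" "weak_pd i g1 g2"
    and p: "p > 1" and g2p: "integrable lborel (\<lambda>x. \<bar>g2 x\<bar> powr p)"
  obtains v v1 v2 :: "nat \<Rightarrow> real^'n \<Rightarrow> real" where
    "\<And>n. tame (v n)" "\<And>n. tame (v1 n)" "\<And>n. tame (v2 n)"
    "\<And>n. has_dd (axis i 1) (v n) (v1 n)" "\<And>n. has_dd (axis i 1) (v1 n) (v2 n)"
    "\<And>n x. \<bar>v n x\<bar> \<le> L"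
    "\<And>n. (\<integral>\<^sup>+y. ennreal \<bar>v n y - h y\<bar> \<partial>lborel) \<le> ennreal ((1/4)^n)"
    "\<And>n. (\<integral>\<^sup>+y. ennreal \<bar>v1 n y - g1 y\<bar> \<partial>lborel) \<le> ennreal ((1/4)^n)"
    "\<And>n. (\<integral>\<^sup>+y. ennreal \<bar>v2 n y - g2 y\<bar> \<partial>lborel) \<le> ennreal ((1/4)^n)"
    "\<And>n. (\<integral>\<^sup>+y. ennreal (\<bar>v2 n y\<bar> powr p) \<partial>lborel) \<le> (\<integral>\<^sup>+y. ennreal (\<bar>g2 y\<bar> powr p) \<partial>lborel)"
proof -
  \<comment> \<open>One mollifier has to serve all three functions, so that the convolutions are
    derivatives of each other. It is paired with its radius so that one choice selects both.\<close>
  define Q where "Q n e \<longleftrightarrow> mollifier (snd e) (fst e) \<and> (\<integral>\<^sup>+y. ennreal \<bar>conv h (fst e) y - h y\<bar> \<partial>lborel) \<le> ennreal ((1/4)^n)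
     \<and> (\<integral>\<^sup>+y. ennreal \<bar>conv g1 (fst e) y - g1 y\<bar> \<partial>lborel) \<le> ennreal ((1/4)^n)
     \<and> (\<integral>\<^sup>+y. ennreal \<bar>conv g2 (fst e) y - g2 y\<bar> \<partial>lborel) \<le> ennreal ((1/4)^n)"
    for n :: nat and e :: "(real^'n \<Rightarrow> real) \<times> real"
  have "\<exists>e. Q n e" for n
  proof -
    have e: "(1/4::real)^n > 0" by simp
    obtain d0 where d0: "d0 > 0" "\<And>\<eta>. mollifier d0 \<eta> \<Longrightarrow> (\<integral>\<^sup>+y. ennreal \<bar>conv h \<eta> y - h y\<bar> \<partial>lborel) \<le> ennreal ((1/4)^n)"
      using conv_L1_approx[OF i(1) e] by blast
    obtain d1 where d1: "d1 > 0" "\<And>\<eta>. mollifier d1 \<eta> \<Longrightarrow> (\<integral>\<^sup>+y. ennreal \<bar>conv g1 \<eta> y - g1 y\<bar> \<partial>lborel) \<le> ennreal ((1/4)^n)"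
      using conv_L1_approx[OF i(2) e] by blast
    obtain d2 where d2: "d2 > 0" "\<And>\<eta>. mollifier d2 \<eta> \<Longrightarrow> (\<integral>\<^sup>+y. ennreal \<bar>conv g2 \<eta> y - g2 y\<bar> \<partial>lborel) \<le> ennreal ((1/4)^n)"
      using conv_L1_approx[OF i(3) e] by blast
    define d where "d = min d0 (min d1 d2)"
    have "d > 0" using d0 d1 d2 by (simp add: d_def)
    then obtain \<eta> :: "real^'n \<Rightarrow> real" where m: "mollifier d \<eta>" using mollifier_exists by blast
    then have "mollifier d0 \<eta>" "mollifier d1 \<eta>" "mollifier d2 \<eta>" by (auto simp: mollifier_def d_def)
    then show ?thesis unfolding Q_def by (intro exI[of _ "(\<eta>, d)"]) (simp add: m d0(2) d1(2) d2(2))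
  qed
  then have "\<exists>e. \<forall>n. Q n (e n)" by (intro choice allI)
  then obtain e where e: "\<And>n. Q n (e n)" by blast
  define \<eta> where "\<eta> n = fst (e n)" for n
  have m: "\<And>n. mollifier (snd (e n)) (\<eta> n)"
     "\<And>n. (\<integral>\<^sup>+y. ennreal \<bar>conv h (\<eta> n) y - h y\<bar> \<partial>lborel) \<le> ennreal ((1/4)^n)"
     "\<And>n. (\<integral>\<^sup>+y. ennreal \<bar>conv g1 (\<eta> n) y - g1 y\<bar> \<partial>lborel) \<le> ennreal ((1/4)^n)"
     "\<And>n. (\<integral>\<^sup>+y. ennreal \<bar>conv g2 (\<eta> n) y - g2 y\<bar> \<partial>lborel) \<le> ennreal ((1/4)^n)"
    using e unfolding Q_def \<eta>_def by simp_all
  have t: "test_fun (\<eta> n)" for n using m(1)[of n] by (simp add: mollifier_def)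
  have tm: "tame (\<eta> n)" "tame (pd i (\<eta> n))" for n using t by (auto intro: test_fun_tame test_fun_pd)
  show ?thesis
  proof (rule that[of "\<lambda>n. conv h (\<eta> n)" "\<lambda>n. conv g1 (\<eta> n)" "\<lambda>n. conv g2 (\<eta> n)"])
    show "tame (conv h (\<eta> n))" "tame (conv g1 (\<eta> n))" "tame (conv g2 (\<eta> n))" for n
      by (rule conv_tame[OF i(1) s(1) tm(1)], assumption, rule conv_tame[OF i(2) s(2) tm(1)], assumption, rule conv_tame[OF i(3) s(3) tm(1)], assumption)
    show "has_dd (axis i 1) (conv h (\<eta> n)) (conv g1 (\<eta> n))" for n
      using conv_has_dd[OF i(1) tm test_fun_has_dd[OF t]] conv_weak_pd[OF w(1) m(1)] by simp
    show "has_dd (axis i 1) (conv g1 (\<eta> n)) (conv g2 (\<eta> n))" for n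
      using conv_has_dd[OF i(2) tm test_fun_has_dd[OF t]] conv_weak_pd[OF w(2) m(1)] by simp
    show "\<bar>conv h (\<eta> n) x\<bar> \<le> L" for n x by (rule conv_mollifier_bound[OF i(1) L m(1)])
    show "(\<integral>\<^sup>+y. ennreal (\<bar>conv g2 (\<eta> n) y\<bar> powr p) \<partial>lborel) \<le> (\<integral>\<^sup>+y. ennreal (\<bar>g2 y\<bar> powr p) \<partial>lborel)" for n
      by (rule conv_Lp_bound[OF i(3) g2p p m(1)])
  qed (rule m)+
qed

text \<open>With \<open>\<delta> = a n x - b x\<close>, the mixed term
  \<open>2 * \<bar>\<delta>\<bar> * \<bar>b x\<bar>\<close> is at most
  \<open>2^n * \<delta>\<^sup>2 + (1/2)^n * (b x)\<^sup>2\<close>, and the rate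
  \<open>(1/4)^n\<close> beats the weight \<open>2^n\<close>. This takes the place of the
  Cauchy-Schwarz inequality.\<close>

lemma tendsto_square_L1:
  fixes a :: "nat \<Rightarrow> 'a \<Rightarrow> real"
  assumes ma: "\<And>n. a n \<in> borel_measurable M" and mb: "b \<in> borel_measurable M"
    and ia: "\<And>n. integrable M (\<lambda>x. (a n x)\<^sup>2)" and K: "K \<ge> 0"
    and r: "\<And>n. (\<integral>\<^sup>+x. ennreal ((a n x - b x)\<^sup>2) \<partial>M) \<le> ennreal (K * (1/4)^n)"
  shows "integrable M (\<lambda>x. (b x)\<^sup>2)" and "(\<lambda>n. \<integral>x. \<bar>(a n x)\<^sup>2 - (b x)\<^sup>2\<bar> \<partial>M) \<longlonglongrightarrow> 0"
proof -
  have id: "integrable M (\<lambda>x. (a n x - b x)\<^sup>2)" for n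
  proof (rule integrableI_bounded)
    show "(\<lambda>x. (a n x - b x)\<^sup>2) \<in> borel_measurable M" using ma mb by auto
    show "(\<integral>\<^sup>+x. ennreal (norm ((a n x - b x)\<^sup>2)) \<partial>M) < \<infinity>"
      using le_less_trans[OF r[of n] ennreal_less_top] by simp
  qed
  have rr: "(\<integral>x. (a n x - b x)\<^sup>2 \<partial>M) \<le> K * (1/4)^n" for n
    using integral_le_if_nn_integral_le[OF id[of n], of "K * (1/4)^n"] r[of n] K by simp
  show ib: "integrable M (\<lambda>x. (b x)\<^sup>2)"
  proof (rule Bochner_Integration.integrable_bound)
    show "integrable M (\<lambda>x. 2 * (a 0 x)\<^sup>2 + 2 * (a 0 x - b x)\<^sup>2)" using ia id by simp
    show "AE x in M. norm ((b x)\<^sup>2) \<le> norm (2 * (a 0 x)\<^sup>2 + 2 * (a 0 x - b x)\<^sup>2)"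
    proof (intro AE_I2)
      fix x
      have "0 \<le> (2 * a 0 x - b x)\<^sup>2" by simp
      then have "(b x)\<^sup>2 \<le> 2 * (a 0 x)\<^sup>2 + 2 * (a 0 x - b x)\<^sup>2" by (simp add: power2_eq_square algebra_simps)
      then show "norm ((b x)\<^sup>2) \<le> norm (2 * (a 0 x)\<^sup>2 + 2 * (a 0 x - b x)\<^sup>2)" by simp
    qed
  qed (use mb in auto)
  show "(\<lambda>n. \<integral>x. \<bar>(a n x)\<^sup>2 - (b x)\<^sup>2\<bar> \<partial>M) \<longlonglongrightarrow> 0"
  proof (rule Lim_null_comparison)
    define B where "B = (\<integral>x. (b x)\<^sup>2 \<partial>M)"
    show "(\<lambda>n. 2 * K * (1/2)^n + (1/2)^n * B) \<longlonglongrightarrow> 0"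
      by (intro tendsto_add_zero tendsto_mult_right_zero tendsto_mult_left_zero LIMSEQ_power_zero) auto
    show "\<forall>\<^sub>F n in sequentially. norm (\<integral>x. \<bar>(a n x)\<^sup>2 - (b x)\<^sup>2\<bar> \<partial>M) \<le> 2 * K * (1/2)^n + (1/2)^n * B"
    proof (intro always_eventually allI)
      fix n
      have "(\<integral>x. \<bar>(a n x)\<^sup>2 - (b x)\<^sup>2\<bar> \<partial>M) \<le> (\<integral>x. (1 + 2^n) * (a n x - b x)\<^sup>2 + (1/2)^n * (b x)\<^sup>2 \<partial>M)"
      proof (rule integral_mono)
        show "integrable M (\<lambda>x. \<bar>(a n x)\<^sup>2 - (b x)\<^sup>2\<bar>)" using ia ib by auto
        show "integrable M (\<lambda>x. (1 + 2^n) * (a n x - b x)\<^sup>2 + (1/2)^n * (b x)\<^sup>2)" using id ib by simp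
        fix x
        define \<delta> where "\<delta> = a n x - b x"
        have "0 \<le> (2^n * \<bar>\<delta>\<bar> - \<bar>b x\<bar>)\<^sup>2" by simp
        then have "2 * 2^n * (\<bar>\<delta>\<bar> * \<bar>b x\<bar>) \<le> 2^n * 2^n * \<delta>\<^sup>2 + (b x)\<^sup>2"
          by (simp add: power2_eq_square algebra_simps)
        then have "2 * 2^n * (\<bar>\<delta>\<bar> * \<bar>b x\<bar>) * (1/2)^n \<le> (2^n * 2^n * \<delta>\<^sup>2 + (b x)\<^sup>2) * (1/2)^n"
          by (rule mult_right_mono) simp
        then have 1: "2 * (\<bar>\<delta>\<bar> * \<bar>b x\<bar>) \<le> 2^n * \<delta>\<^sup>2 + (1/2)^n * (b x)\<^sup>2"
          by (simp add: field_simps)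
        have "(a n x)\<^sup>2 - (b x)\<^sup>2 = \<delta>\<^sup>2 + 2 * (\<delta> * b x)" by (simp add: \<delta>_def power2_eq_square algebra_simps)
        then have "\<bar>(a n x)\<^sup>2 - (b x)\<^sup>2\<bar> \<le> \<delta>\<^sup>2 + 2 * (\<bar>\<delta>\<bar> * \<bar>b x\<bar>)"
          using abs_triangle_ineq[of "\<delta>\<^sup>2" "2 * (\<delta> * b x)"] by (simp add: abs_mult)
        then show "\<bar>(a n x)\<^sup>2 - (b x)\<^sup>2\<bar> \<le> (1 + 2^n) * (a n x - b x)\<^sup>2 + (1/2)^n * (b x)\<^sup>2"
          using 1 by (simp add: \<delta>_def algebra_simps)
      qed
      also have "\<dots> = (1 + 2^n) * (\<integral>x. (a n x - b x)\<^sup>2 \<partial>M) + (1/2)^n * B"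
        using id ib by (simp add: B_def)
      also have "\<dots> \<le> (2 * 2^n) * (K * (1/4)^n) + (1/2)^n * B"
        using rr K by (intro add_right_mono mult_mono) auto
      also have "(2 * 2^n) * (K * (1/4)^n) = 2 * K * (1/2)^n"
        by (simp add: power_divide field_simps flip: power_mult_distrib)
      finally show "norm (\<integral>x. \<bar>(a n x)\<^sup>2 - (b x)\<^sup>2\<bar> \<partial>M) \<le> 2 * K * (1/2)^n + (1/2)^n * B" by simp
    qed
  qed
qed

text \<open>Fatou's lemma carries the interpolation inequality to the limit. In the chain rule the
  delicate term is the one with \<open>(g1 x)\<^sup>2\<close>, for which the first derivatives have
  to converge in the square mean.\<close>

lemma weak_power_rule:
  fixes h g1 g2 :: "real^'n::finite \<Rightarrow> real"
  assumes i: "integrable lborel h" "integrable lborel g1" "integrable lborel g2"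
    and s: "\<And>x. norm x > R \<Longrightarrow> h x = 0" "\<And>x. norm x > R \<Longrightarrow> g1 x = 0" "\<And>x. norm x > R \<Longrightarrow> g2 x = 0"
    and L: "AE x in lborel. \<bar>h x\<bar> \<le> L"
    and w: "weak_pd i h g1" "weak_pd i g1 g2"
    and p: "p > 1" and g2p: "integrable lborel (\<lambda>x. \<bar>g2 x\<bar> powr p)"
  shows "(\<integral>\<^sup>+x. ennreal (\<bar>g1 x\<bar> powr (2*p)) \<partial>lborel) \<le> ennreal (((2*p-1)*L) powr p * (\<integral>x. \<bar>g2 x\<bar> powr p \<partial>lborel))"
    and "test_fun \<psi> \<Longrightarrow> (\<integral>x. \<bar>h x\<bar> powr (2*p) * pd i (pd i \<psi>) x \<partial>lborel) =
       (\<integral>x. (2*p * (2*p-1) * \<bar>h x\<bar> powr (2*p-2) * (g1 x)\<^sup>2 + 2*p * spow (2*p-1) (h x) * g2 x) * \<psi> x \<partial>lborel)"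
proof -
  obtain v v1 v2 :: "nat \<Rightarrow> real^'n \<Rightarrow> real" where t: "\<And>n. tame (v n)" "\<And>n. tame (v1 n)" "\<And>n. tame (v2 n)"
    and dd: "\<And>n. has_dd (axis i 1) (v n) (v1 n)" "\<And>n. has_dd (axis i 1) (v1 n) (v2 n)"
    and vL: "\<And>n x. \<bar>v n x\<bar> \<le> L"
    and r: "\<And>n. (\<integral>\<^sup>+y. ennreal \<bar>v n y - h y\<bar> \<partial>lborel) \<le> ennreal ((1/4)^n)"
    "\<And>n. (\<integral>\<^sup>+y. ennreal \<bar>v1 n y - g1 y\<bar> \<partial>lborel) \<le> ennreal ((1/4)^n)"
    "\<And>n. (\<integral>\<^sup>+y. ennreal \<bar>v2 n y - g2 y\<bar> \<partial>lborel) \<le> ennreal ((1/4)^n)"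
    and vp: "\<And>n. (\<integral>\<^sup>+y. ennreal (\<bar>v2 n y\<bar> powr p) \<partial>lborel) \<le> (\<integral>\<^sup>+y. ennreal (\<bar>g2 y\<bar> powr p) \<partial>lborel)"
    using mollified_sequence[OF i s L w p g2p] by blast
  have L0: "L \<ge> 0" using vL[of 0 0] by linarith
  note im = borel_measurable_integrable
  note ti = tame_integrable[OF t(1)] tame_integrable[OF t(2)] tame_integrable[OF t(3)]
  have AE_lim: "AE x in lborel. (\<lambda>n. v n x) \<longlonglongrightarrow> h x" "AE x in lborel. (\<lambda>n. v1 n x) \<longlonglongrightarrow> g1 x"
  proof -
    have "AE x in lborel. (\<lambda>n. v n x - h x) \<longlonglongrightarrow> 0"
      by (rule AE_tendsto_0_if_L1_rate[OF _ r(1)]) (intro borel_measurable_diff im ti i)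
    then show "AE x in lborel. (\<lambda>n. v n x) \<longlonglongrightarrow> h x" by eventually_elim (rule LIM_zero_cancel)
    have "AE x in lborel. (\<lambda>n. v1 n x - g1 x) \<longlonglongrightarrow> 0"
      by (rule AE_tendsto_0_if_L1_rate[OF _ r(2)]) (intro borel_measurable_diff im ti i)
    then show "AE x in lborel. (\<lambda>n. v1 n x) \<longlonglongrightarrow> g1 x" by eventually_elim (rule LIM_zero_cancel)
  qed
  show "(\<integral>\<^sup>+x. ennreal (\<bar>g1 x\<bar> powr (2*p)) \<partial>lborel) \<le> ennreal (((2*p-1)*L) powr p * (\<integral>x. \<bar>g2 x\<bar> powr p \<partial>lborel))"
  proof (rule nn_integral_le_if_AE_limit)
    show "(\<lambda>x. \<bar>v1 n x\<bar> powr (2*p)) \<in> borel_measurable lborel" for n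
      using im[OF ti(2)] by (intro powr_real_measurable borel_measurable_abs) auto
    show "AE x in lborel. (\<lambda>n. \<bar>v1 n x\<bar> powr (2*p)) \<longlonglongrightarrow> \<bar>g1 x\<bar> powr (2*p)"
      using AE_lim(2) by eventually_elim (use p in \<open>auto intro!: tendsto_powr' tendsto_intros\<close>)
    show "\<forall>\<^sub>F n in sequentially. (\<integral>\<^sup>+x. ennreal (\<bar>v1 n x\<bar> powr (2*p)) \<partial>lborel)
        \<le> ennreal (((2*p-1)*L) powr p * (\<integral>x. \<bar>g2 x\<bar> powr p \<partial>lborel))"
    proof (intro always_eventually allI)
      fix n
      have tp: "tame (\<lambda>x. \<bar>v1 n x\<bar> powr (2*p))" "tame (\<lambda>x. \<bar>v2 n x\<bar> powr p)"
        by (rule tame_compose[OF t(2) abs_powr_continuous] tame_compose[OF t(3) abs_powr_continuous]; use p in simp)+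
      have "ennreal (\<integral>x. \<bar>v2 n x\<bar> powr p \<partial>lborel) \<le> ennreal (\<integral>x. \<bar>g2 x\<bar> powr p \<partial>lborel)"
        using vp[of n] tame_integrable[OF tp(2)] g2p by (simp add: nn_integral_eq_integral)
      then have le: "(\<integral>x. \<bar>v2 n x\<bar> powr p \<partial>lborel) \<le> (\<integral>x. \<bar>g2 x\<bar> powr p \<partial>lborel)"
        by (simp add: ennreal_le_iff integral_nonneg_AE)
      have "(\<integral>\<^sup>+x. ennreal (\<bar>v1 n x\<bar> powr (2*p)) \<partial>lborel) = ennreal (\<integral>x. \<bar>v1 n x\<bar> powr (2*p) \<partial>lborel)"
        using tame_integrable[OF tp(1)] by (intro nn_integral_eq_integral) auto
      also have "\<dots> \<le> ennreal (((2*p-1)*L) powr p * (\<integral>x. \<bar>v2 n x\<bar> powr p \<partial>lborel))"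
        by (intro ennreal_leI gradient_interpolation[OF t dd vL p])
      also have "\<dots> \<le> ennreal (((2*p-1)*L) powr p * (\<integral>x. \<bar>g2 x\<bar> powr p \<partial>lborel))"
        by (intro ennreal_leI mult_left_mono le) simp
      finally show "(\<integral>\<^sup>+x. ennreal (\<bar>v1 n x\<bar> powr (2*p)) \<partial>lborel)
        \<le> ennreal (((2*p-1)*L) powr p * (\<integral>x. \<bar>g2 x\<bar> powr p \<partial>lborel))" .
    qed
  qed
  assume \<psi>: "test_fun \<psi>"
  have L1v2: "(\<integral>x. \<bar>v2 n x - g2 x\<bar> \<partial>lborel) \<le> (1/4)^n" for n
    by (rule integral_le_if_nn_integral_le[OF _ r(3)]) (use ti i in auto)
  \<comment> \<open>For \<open>m \<ge> n\<close> the energy identity bounds the square distance of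
    \<open>v1 n\<close> and \<open>v1 m\<close> by \<open>2 * L\<close> times the distance in the
    mean of the second derivatives, hence by \<open>2 * L * (2 * (1/4)^n)\<close>. Then
    \<open>m\<close> tends to infinity by Fatou's lemma.\<close>
  have L2v1: "(\<integral>\<^sup>+x. ennreal ((v1 n x - g1 x)\<^sup>2) \<partial>lborel) \<le> ennreal (4 * L * (1/4)^n)" for n
  proof (rule nn_integral_le_if_AE_limit)
    show "(\<lambda>x. (v1 n x - v1 m x)\<^sup>2) \<in> borel_measurable lborel" for m
      using im[OF ti(2)] by auto
    show "AE x in lborel. (\<lambda>m. (v1 n x - v1 m x)\<^sup>2) \<longlonglongrightarrow> (v1 n x - g1 x)\<^sup>2"
      using AE_lim(2) by eventually_elim (intro tendsto_intros)
    show "\<forall>\<^sub>F m in sequentially. (\<integral>\<^sup>+x. ennreal ((v1 n x - v1 m x)\<^sup>2) \<partial>lborel) \<le> ennreal (4 * L * (1/4)^n)"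
    proof (rule eventually_mono[OF eventually_ge_at_top[of n]])
      fix m assume nm: "n \<le> m"
      have td: "tame (\<lambda>x. v n x - v m x)" "tame (\<lambda>x. v1 n x - v1 m x)" "tame (\<lambda>x. v2 n x - v2 m x)"
        by (intro tame_diff t)+
      have tsq: "tame (\<lambda>x. (v1 n x - v1 m x)\<^sup>2)" unfolding power2_eq_square by (intro tame_mult_tame td)
      have "(\<integral>x. (v1 n x - v1 m x)\<^sup>2 \<partial>lborel) = - (\<integral>x. (v n x - v m x) * (v2 n x - v2 m x) \<partial>lborel)"
        by (rule energy_identity[OF td has_dd_diff[OF dd(1) dd(1)] has_dd_diff[OF dd(2) dd(2)]])
      also have "\<dots> \<le> (\<integral>x. \<bar>(v n x - v m x) * (v2 n x - v2 m x)\<bar> \<partial>lborel)"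
        using integral_abs_bound[of lborel "\<lambda>x. (v n x - v m x) * (v2 n x - v2 m x)"] by linarith
      also have "\<dots> \<le> (\<integral>x. 2 * L * (\<bar>v2 n x - g2 x\<bar> + \<bar>v2 m x - g2 x\<bar>) \<partial>lborel)"
      proof (rule integral_mono)
        show "integrable lborel (\<lambda>x. \<bar>(v n x - v m x) * (v2 n x - v2 m x)\<bar>)"
          by (intro integrable_abs tame_integrable tame_mult_tame td)
        show "integrable lborel (\<lambda>x. 2 * L * (\<bar>v2 n x - g2 x\<bar> + \<bar>v2 m x - g2 x\<bar>))" using ti i by auto
        fix x
        have "\<bar>v n x - v m x\<bar> \<le> 2 * L" using vL[of n x] vL[of m x] by linarith
        moreover have "\<bar>v2 n x - v2 m x\<bar> \<le> \<bar>v2 n x - g2 x\<bar> + \<bar>v2 m x - g2 x\<bar>" by linarith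
        ultimately show "\<bar>(v n x - v m x) * (v2 n x - v2 m x)\<bar> \<le> 2 * L * (\<bar>v2 n x - g2 x\<bar> + \<bar>v2 m x - g2 x\<bar>)"
          unfolding abs_mult using L0 by (intro mult_mono) auto
      qed
      also have "\<dots> = 2 * L * ((\<integral>x. \<bar>v2 n x - g2 x\<bar> \<partial>lborel) + (\<integral>x. \<bar>v2 m x - g2 x\<bar> \<partial>lborel))"
        using ti i by simp
      also have "\<dots> \<le> 2 * L * ((1/4)^n + (1/4)^n)"
      proof (intro mult_left_mono add_mono L1v2)
        have "(1/4::real)^m \<le> (1/4)^n" using nm by (intro power_decreasing) auto
        then show "(\<integral>x. \<bar>v2 m x - g2 x\<bar> \<partial>lborel) \<le> (1/4)^n" using L1v2[of m] by linarith
      qed (use L0 in auto)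
      finally have "(\<integral>x. (v1 n x - v1 m x)\<^sup>2 \<partial>lborel) \<le> 4 * L * (1/4)^n" by simp
      then show "(\<integral>\<^sup>+x. ennreal ((v1 n x - v1 m x)\<^sup>2) \<partial>lborel) \<le> ennreal (4 * L * (1/4)^n)"
        using tame_integrable[OF tsq] by (simp add: nn_integral_eq_integral ennreal_leI)
    qed
  qed
  have tsq: "tame (\<lambda>x. (v1 n x)\<^sup>2)" for n unfolding power2_eq_square by (intro tame_mult_tame t)
  have K: "4 * L \<ge> 0" using L0 by simp
  have isq: "integrable lborel (\<lambda>x. (g1 x)\<^sup>2)" and limsq: "(\<lambda>n. \<integral>x. \<bar>(v1 n x)\<^sup>2 - (g1 x)\<^sup>2\<bar> \<partial>lborel) \<longlonglongrightarrow> 0"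
    using tendsto_square_L1[OF im[OF ti(2)] im[OF i(2)] tame_integrable[OF tsq] K L2v1] by auto
  have limv2: "(\<lambda>n. \<integral>x. \<bar>v2 n x - g2 x\<bar> \<partial>lborel) \<longlonglongrightarrow> 0"
    by (rule Lim_null_comparison[OF _ LIMSEQ_power_zero[of "1/4::real"]]) (use L1v2 in auto)
  note tp = test_fun_tame[OF \<psi>] test_fun_tame[OF test_fun_pd[OF test_fun_pd[OF \<psi>, of i], of i]]
  obtain M where M: "M > 0" "\<And>x. \<bar>\<psi> x\<bar> \<le> M" using tame_bound[OF tp(1)] by blast
  let ?a = "2*p"
  let ?A = "\<lambda>s. ?a * (?a-1) * \<bar>s\<bar> powr (?a-2)" and ?B = "\<lambda>s. ?a * spow (?a-1) s"
  have cA: "continuous_on UNIV ?A" "continuous_on UNIV ?B"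
    using p by (auto intro!: continuous_on_mult_left abs_powr_continuous spow_continuous)
  have lim_cont: "AE x in lborel. (\<lambda>n. F (v n x)) \<longlonglongrightarrow> F (h x)" if "continuous_on UNIV F" for F :: "real \<Rightarrow> real"
    using AE_lim(1) by eventually_elim (use that in \<open>auto intro: isCont_tendsto_compose simp: continuous_on_eq_continuous_at\<close>)
  have m_cont: "(\<lambda>x. F (v n x)) \<in> borel_measurable lborel" "(\<lambda>x. F (h x)) \<in> borel_measurable lborel"
    if "continuous_on UNIV F" for F :: "real \<Rightarrow> real" and n
    using borel_measurable_continuous_onI[OF that] im[OF ti(1)] im[OF i(1)] by (auto intro: measurable_compose)
  have b0: "\<bar>\<bar>v n x\<bar> powr ?a\<bar> \<le> L powr ?a" for n x
    using p vL[of n x] by (simp add: powr_mono2)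
  have bA: "\<bar>?A (v n x) * \<psi> x\<bar> \<le> ?a * (?a-1) * L powr (?a-2) * M" for n x
    unfolding abs_mult using p vL[of n x] M L0 by (intro mult_mono) (auto simp: powr_mono2)
  have bB: "\<bar>?B (v n x) * \<psi> x\<bar> \<le> ?a * L powr (?a-1) * M" for n x
    unfolding abs_mult using p vL[of n x] M L0
    by (intro mult_mono) (auto simp: powr_mono2 spow_def abs_mult abs_sgn_eq)
  have \<psi>m: "\<psi> \<in> borel_measurable lborel" using tame_measurable[OF tp(1)] by simp
  have F0: "continuous_on UNIV (\<lambda>s::real. \<bar>s\<bar> powr ?a)" using p by (intro abs_powr_continuous) simp
  have l0: "(\<lambda>n. \<integral>x. \<bar>v n x\<bar> powr ?a * pd i (pd i \<psi>) x \<partial>lborel) \<longlonglongrightarrow> (\<integral>x. \<bar>h x\<bar> powr ?a * pd i (pd i \<psi>) x \<partial>lborel)"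
    using m_cont[OF F0] lim_cont[OF F0] b0 tame_integrable[OF tp(2)]
    by (intro tendsto_integral_mult_L1(2)[where w="\<lambda>n. pd i (pd i \<psi>)"]) auto
  have prod_lim: "AE x in lborel. (\<lambda>n. F (v n x) * \<psi> x) \<longlonglongrightarrow> F (h x) * \<psi> x" if "continuous_on UNIV F" for F :: "real \<Rightarrow> real"
    using lim_cont[OF that] by eventually_elim (intro tendsto_mult tendsto_const)
  have l1: "integrable lborel (\<lambda>x. (?A (h x) * \<psi> x) * (g1 x)\<^sup>2)"
    "(\<lambda>n. \<integral>x. (?A (v n x) * \<psi> x) * (v1 n x)\<^sup>2 \<partial>lborel) \<longlonglongrightarrow> (\<integral>x. (?A (h x) * \<psi> x) * (g1 x)\<^sup>2 \<partial>lborel)"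
    by (rule tendsto_integral_mult_L1[OF borel_measurable_times[OF m_cont(1)[OF cA(1)] \<psi>m] borel_measurable_times[OF m_cont(2)[OF cA(1)] \<psi>m]
       prod_lim[OF cA(1)] bA tame_integrable[OF tsq] isq limsq])+
  have l2: "integrable lborel (\<lambda>x. (?B (h x) * \<psi> x) * g2 x)"
    "(\<lambda>n. \<integral>x. (?B (v n x) * \<psi> x) * v2 n x \<partial>lborel) \<longlonglongrightarrow> (\<integral>x. (?B (h x) * \<psi> x) * g2 x \<partial>lborel)"
    by (rule tendsto_integral_mult_L1[OF borel_measurable_times[OF m_cont(1)[OF cA(2)] \<psi>m] borel_measurable_times[OF m_cont(2)[OF cA(2)] \<psi>m]
       prod_lim[OF cA(2)] bB ti(3) i(3) limv2])+
  have eqn: "(\<integral>x. \<bar>v n x\<bar> powr ?a * pd i (pd i \<psi>) x \<partial>lborel) =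
     (\<integral>x. (?A (v n x) * \<psi> x) * (v1 n x)\<^sup>2 \<partial>lborel) + (\<integral>x. (?B (v n x) * \<psi> x) * v2 n x \<partial>lborel)" for n
  proof -
    have tA: "tame (\<lambda>x. ?A (v n x))" "tame (\<lambda>x. ?B (v n x))"
      by (rule tame_compose[OF t(1) cA(1)], simp, rule tame_compose[OF t(1) cA(2)], simp)
    have tt: "tame (\<lambda>x. (?A (v n x) * \<psi> x) * (v1 n x)\<^sup>2)" "tame (\<lambda>x. (?B (v n x) * \<psi> x) * v2 n x)"
      by (intro tame_mult_tame tA tp tsq t)+
    have "?a > 2" using p by simp
    then show ?thesis
      unfolding Bochner_Integration.integral_add[OF tt[THEN tame_integrable], symmetric]
      by (rule chain_rule_tame[OF t dd _ \<psi>])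
  qed
  have "(\<lambda>n. \<integral>x. \<bar>v n x\<bar> powr ?a * pd i (pd i \<psi>) x \<partial>lborel) \<longlonglongrightarrow>
     (\<integral>x. (?A (h x) * \<psi> x) * (g1 x)\<^sup>2 \<partial>lborel) + (\<integral>x. (?B (h x) * \<psi> x) * g2 x \<partial>lborel)"
    unfolding eqn by (intro tendsto_add l1 l2)
  then have "(\<integral>x. \<bar>h x\<bar> powr ?a * pd i (pd i \<psi>) x \<partial>lborel) =
     (\<integral>x. (?A (h x) * \<psi> x) * (g1 x)\<^sup>2 \<partial>lborel) + (\<integral>x. (?B (h x) * \<psi> x) * g2 x \<partial>lborel)"
    using l0 LIMSEQ_unique by blast
  also have "\<dots> = (\<integral>x. (?A (h x) * \<psi> x) * (g1 x)\<^sup>2 + (?B (h x) * \<psi> x) * g2 x \<partial>lborel)"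
    by (rule Bochner_Integration.integral_add[OF l1(1) l2(1), symmetric])
  also have "\<dots> = (\<integral>x. (?A (h x) * (g1 x)\<^sup>2 + ?B (h x) * g2 x) * \<psi> x \<partial>lborel)"
    by (intro Bochner_Integration.integral_cong) (auto simp: algebra_simps)
  finally show "(\<integral>x. \<bar>h x\<bar> powr (2*p) * pd i (pd i \<psi>) x \<partial>lborel) =
       (\<integral>x. (2*p * (2*p-1) * \<bar>h x\<bar> powr (2*p-2) * (g1 x)\<^sup>2 + 2*p * spow (2*p-1) (h x) * g2 x) * \<psi> x \<partial>lborel)" .
qed

section \<open>Pure second derivatives of powers of Sobolev functions\<close>

lemma loc_integrable_measurable:
  fixes f :: "real^'n::finite \<Rightarrow> real"
  assumes "loc_integrable f"
  shows "f \<in> borel_measurable lebesgue"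
proof (rule borel_measurable_LIMSEQ_real)
  show "(\<lambda>x. indicat_real (cball 0 (real n)) x * f x) \<in> borel_measurable lebesgue" for n
    using assms by (auto simp: loc_integrable_def set_integrable_def dest!: spec[of _ "cball 0 (real n)"] borel_measurable_integrable)
  fix x :: "real^'n"
  obtain n0 :: nat where n0: "norm x < real n0" using reals_Archimedean2 by blast
  show "(\<lambda>n. indicat_real (cball 0 (real n)) x * f x) \<longlonglongrightarrow> f x"
    by (rule tendsto_eventually, rule eventually_mono[OF eventually_ge_at_top[of n0]]) (use n0 in auto)
qed

lemma loc_integrable_diff: "loc_integrable f \<Longrightarrow> loc_integrable g \<Longrightarrow> loc_integrable (\<lambda>x. f x - g x)"
  by (simp add: loc_integrable_def)

lemma integrable_imp_loc_integrable: "integrable lebesgue f \<Longrightarrow> loc_integrable f"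
  unfolding loc_integrable_def set_integrable_def
  by (intro allI impI integrable_mult_indicator) (auto simp: compact_imp_closed)

text \<open>This makes the choice inside \<open>wd\<close> harmless: whatever is proved for one
  explicit weak derivative holds almost everywhere for the chosen one.\<close>

lemma weak_deriv_unique:
  assumes "weak_deriv f ks g" "weak_deriv f ks g'"
  shows "AE x in lebesgue. g x = g' x"
proof -
  have l: "loc_integrable g" "loc_integrable g'" using assms by (auto simp: weak_deriv_def)
  have "AE x in lebesgue. x \<in> UNIV \<longrightarrow> g x - g' x = 0"
  proof (rule AE_eq_0_on_open[OF loc_integrable_diff[OF l]])
    fix \<psi> :: "real^'a \<Rightarrow> real" assume \<psi>: "test_fun \<psi>"
    have "(\<integral>x. f x * iter_pd ks \<psi> x \<partial>lebesgue) = (-1) ^ length ks * (\<integral>x. g x * \<psi> x \<partial>lebesgue)"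
      "(\<integral>x. f x * iter_pd ks \<psi> x \<partial>lebesgue) = (-1) ^ length ks * (\<integral>x. g' x * \<psi> x \<partial>lebesgue)"
      using assms[unfolded weak_deriv_def] \<psi> by blast+
    then have "(-1) ^ length ks * (\<integral>x. g x * \<psi> x \<partial>lebesgue) = (-1) ^ length ks * (\<integral>x. g' x * \<psi> x \<partial>lebesgue)"
      by (rule trans[OF sym])
    then have "(\<integral>x. g x * \<psi> x \<partial>lebesgue) = (\<integral>x. g' x * \<psi> x \<partial>lebesgue)" by simp
    then show "(\<integral>x. (g x - g' x) * \<psi> x \<partial>lebesgue) = 0"
      using loc_integrable_test_fun[OF l(1) \<psi>] loc_integrable_test_fun[OF l(2) \<psi>] by (simp add: left_diff_distrib)
  qed auto
  then show ?thesis by simp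
qed

lemma weak_deriv_wd: "weak_deriv f ks g \<Longrightarrow> weak_deriv f ks (wd ks f)"
  unfolding wd_def by (rule someI[of "weak_deriv f ks"])

lemma iter_pd_support: "closure {x. iter_pd ks \<psi> x \<noteq> 0} \<subseteq> closure {x. \<psi> x \<noteq> 0}"
proof (induction ks)
  case (Cons i ks)
  have "closure {x. pd i (iter_pd ks \<psi>) x \<noteq> 0} \<subseteq> closure {x. iter_pd ks \<psi> x \<noteq> 0}"
    using pd_eq_0_off_support by (intro closure_minimal) auto
  then show ?case using Cons by auto
qed simp

text \<open>A test function supported off \<open>K\<close> has derivatives supported off
  \<open>K\<close>, so the pairing with \<open>f\<close> vanishes. It confines all derivatives to a
  bounded set, as mollification requires.\<close>

lemma weak_deriv_eq_0_off:
  fixes f :: "real^'n::finite \<Rightarrow> real"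
  assumes w: "weak_deriv f ks g" and K: "closed K" and f0: "AE x in lebesgue. x \<notin> K \<longrightarrow> f x = 0"
  shows "AE x in lebesgue. x \<notin> K \<longrightarrow> g x = 0"
proof -
  have l: "loc_integrable f" "loc_integrable g" using w by (auto simp: weak_deriv_def)
  have "AE x in lebesgue. x \<in> - K \<longrightarrow> g x = 0"
  proof (rule AE_eq_0_on_open[OF l(2)])
    fix \<psi> :: "real^'n \<Rightarrow> real" assume \<psi>: "test_fun \<psi>" and s: "closure {x. \<psi> x \<noteq> 0} \<subseteq> - K"
    have "(\<integral>x. f x * iter_pd ks \<psi> x \<partial>lebesgue) = 0"
    proof (rule integral_eq_zero_AE)
      show "AE x in lebesgue. f x * iter_pd ks \<psi> x = 0"
        using f0
      proof eventually_elim
        case (elim x)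
        have "x \<in> K \<Longrightarrow> iter_pd ks \<psi> x = 0"
          using iter_pd_support[of ks \<psi>] s closure_subset[of "{x. iter_pd ks \<psi> x \<noteq> 0}"] by auto
        then show ?case using elim by auto
      qed
    qed
    then show "(\<integral>x. g x * \<psi> x \<partial>lebesgue) = 0" using w \<psi> by (simp add: weak_deriv_def)
  qed (use K in auto)
  then show ?thesis by simp
qed

text \<open>A bridge from the completed measure to Borel functions, on which convolution is carried
  out. The representative vanishes everywhere outside the ball, not just almost everywhere.\<close>

lemma borel_representative:
  fixes f :: "real^'n::finite \<Rightarrow> real"
  assumes f: "loc_integrable f" and K: "K \<subseteq> cball 0 R" and f0: "AE x in lebesgue. x \<notin> K \<longrightarrow> f x = 0"
  obtains b where "integrable lborel b" "\<And>x. norm x > R \<Longrightarrow> b x = 0" "AE x in lebesgue. f x = b x"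
proof -
  define f1 where "f1 x = indicator (cball 0 R) x * f x" for x
  have f1: "integrable lebesgue f1"
    using f unfolding loc_integrable_def set_integrable_def f1_def[abs_def] by auto
  obtain g where g: "g \<in> borel_measurable lborel" "AE x in lborel. f1 x = g x"
    using completion_ex_borel_measurable_real[OF borel_measurable_integrable[OF f1]] by blast
  define b where "b x = indicator (cball 0 R) x * g x" for x
  have bm: "b \<in> borel_measurable lborel" unfolding b_def using g(1)
    by (intro borel_measurable_times borel_measurable_indicator) (auto intro: borel_closed)
  have ae: "AE x in lebesgue. f1 x = b x"
    using AE_completion[OF g(2)] by eventually_elim (auto simp: b_def f1_def indicator_def)
  show ?thesis
  proof
    show "integrable lborel b"
      using integrable_cong_AE[OF borel_measurable_integrable[OF f1] measurable_completion[OF bm] ae] f1 bm integrable_completion by blast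
    show "b x = 0" if "norm x > R" for x using that by (simp add: b_def)
    show "AE x in lebesgue. f x = b x"
      using ae f0
    proof eventually_elim
      case (elim x)
      then show ?case using K by (cases "x \<in> cball 0 R") (auto simp: f1_def)
    qed
  qed
qed

lemma integral_lebesgue_borel_cong:
  assumes f: "f \<in> borel_measurable lebesgue" and b: "b \<in> borel_measurable lborel" and ae: "AE x in lebesgue. f x = b x"
  shows "(\<integral>x. f x \<partial>lebesgue) = (\<integral>x. (b x :: real) \<partial>lborel)" and "integrable lebesgue f \<longleftrightarrow> integrable lborel b"
  using integral_cong_AE[OF f measurable_completion[OF b] ae] integral_completion[OF b]
    integrable_cong_AE[OF f measurable_completion[OF b] ae] integrable_completion[OF b] by auto

lemma wd_in_Lp:
  assumes "sobolev2 p h" "length ks \<le> 2"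
  shows "weak_deriv h ks (wd ks h)" "integrable lebesgue (\<lambda>x. \<bar>wd ks h x\<bar> powr p)"
proof -
  obtain g where g: "weak_deriv h ks g" "in_Lp p lebesgue g" using assms by (auto simp: sobolev2_def)
  show w: "weak_deriv h ks (wd ks h)" by (rule weak_deriv_wd[OF g(1)])
  have m: "wd ks h \<in> borel_measurable lebesgue" using w by (auto simp: weak_deriv_def intro: loc_integrable_measurable)
  have gm: "g \<in> borel_measurable lebesgue" and gi: "integrable lebesgue (\<lambda>x. \<bar>g x\<bar> powr p)" using g by (auto simp: in_Lp_def)
  have "AE x in lebesgue. \<bar>g x\<bar> powr p = \<bar>wd ks h x\<bar> powr p"
    using weak_deriv_unique[OF g(1) w] by eventually_elim simp
  then show "integrable lebesgue (\<lambda>x. \<bar>wd ks h x\<bar> powr p)"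
    using integrable_cong_AE[of "\<lambda>x. \<bar>g x\<bar> powr p" lebesgue "\<lambda>x. \<bar>wd ks h x\<bar> powr p"] gi gm m
    by (auto intro!: powr_real_measurable borel_measurable_abs)
qed

text \<open>Here \<open>g\<close> is a Borel representative of the first derivative in direction
  \<open>i\<close>. The chain rule has the coefficients \<open>2*p * (2*p-1)\<close> and
  \<open>2*p\<close>, both at most \<open>4 * p\<^sup>2\<close>.\<close>

lemma wd_power_estimate:
  fixes h :: "real^'n::finite \<Rightarrow> real" and i :: 'n
  assumes sob: "sobolev2 p h" and p: "p > 1" and K: "compact K"
    and h0: "AE x in lebesgue. x \<notin> K \<longrightarrow> h x = 0" and L: "AE x in lebesgue. \<bar>h x\<bar> \<le> L"
  defines "G \<equiv> wd [i, i] h" and "Z \<equiv> wd [i, i] (zeta_of p h)"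
  obtains g where "g \<in> borel_measurable lebesgue" "integrable lebesgue (\<lambda>x. \<bar>g x\<bar> powr (2*p))"
    "(\<integral>x. \<bar>g x\<bar> powr (2*p) \<partial>lebesgue) \<le> ((2*p-1)*L) powr p * (\<integral>x. \<bar>G x\<bar> powr p \<partial>lebesgue)"
    "AE x in lebesgue. \<bar>Z x\<bar> \<le> 4 * p\<^sup>2 * \<bar>h x\<bar> powr (2*p-2) * ((g x)\<^sup>2 + \<bar>h x\<bar> * \<bar>G x\<bar>)"
    "Z \<in> borel_measurable lebesgue"
proof -
  obtain R where "\<And>x. x \<in> K \<Longrightarrow> norm x \<le> R" using compact_imp_bounded[OF K] unfolding bounded_iff by blast
  then have R: "K \<subseteq> cball 0 R" by auto
  have clK: "closed K" using K by (rule compact_imp_closed)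
  obtain g1 where g1: "weak_deriv h [i] g1" using wd_in_Lp(1)[OF sob, of "[i]"] by auto
  have G: "weak_deriv h [i, i] G" "integrable lebesgue (\<lambda>x. \<bar>G x\<bar> powr p)"
    using wd_in_Lp[OF sob, of "[i, i]"] by (auto simp: G_def)
  have l: "loc_integrable h" "loc_integrable g1" "loc_integrable G" using g1 G by (auto simp: weak_deriv_def)
  note lm = l[THEN loc_integrable_measurable]
  note z1 = weak_deriv_eq_0_off[OF g1 clK h0] and zG = weak_deriv_eq_0_off[OF G(1) clK h0]
  obtain b where b: "integrable lborel b" "\<And>x. norm x > R \<Longrightarrow> b x = 0" "AE x in lebesgue. h x = b x"
    using borel_representative[OF l(1) R h0] by blast
  obtain b1 where b1: "integrable lborel b1" "\<And>x. norm x > R \<Longrightarrow> b1 x = 0" "AE x in lebesgue. g1 x = b1 x"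
    using borel_representative[OF l(2) R z1] by blast
  obtain b2 where b2: "integrable lborel b2" "\<And>x. norm x > R \<Longrightarrow> b2 x = 0" "AE x in lebesgue. G x = b2 x"
    using borel_representative[OF l(3) R zG] by blast
  note bm = b(1)[THEN borel_measurable_integrable] b1(1)[THEN borel_measurable_integrable] b2(1)[THEN borel_measurable_integrable]
  have swap: "(\<integral>x. f x * \<psi> x \<partial>lebesgue) = (\<integral>x. c x * \<psi> x \<partial>lborel)"
    if "f \<in> borel_measurable lebesgue" "c \<in> borel_measurable lborel" "AE x in lebesgue. f x = c x" "test_fun \<psi>"
    for f c \<psi> :: "real^'n \<Rightarrow> real"
  proof -
    have \<psi>: "\<psi> \<in> borel_measurable lborel" using tame_measurable[OF test_fun_tame[OF that(4)]] by simp
    show ?thesis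
      by (rule integral_lebesgue_borel_cong(1)[OF borel_measurable_times[OF that(1) measurable_completion[OF \<psi>]] borel_measurable_times[OF that(2) \<psi>]])
        (use that(3) in eventually_elim, simp)
  qed
  have w1: "weak_pd i b b1"
    unfolding weak_pd_def
  proof (intro allI impI)
    fix \<psi> :: "real^'n \<Rightarrow> real" assume \<psi>: "test_fun \<psi>"
    have "(\<integral>x. h x * pd i \<psi> x \<partial>lebesgue) = - (\<integral>x. g1 x * \<psi> x \<partial>lebesgue)"
      using g1 \<psi> by (auto simp: weak_deriv_def)
    then show "(\<integral>x. b x * pd i \<psi> x \<partial>lborel) = - (\<integral>x. b1 x * \<psi> x \<partial>lborel)"
      using swap[OF lm(1) bm(1) b(3) test_fun_pd[OF \<psi>]] swap[OF lm(2) bm(2) b1(3) \<psi>] by simp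
  qed
  \<comment> \<open>\<open>G\<close> is given only as a second derivative of \<open>h\<close>.
    Applying \<open>w1\<close> to the test function \<open>pd i \<psi>\<close> shows that
    \<open>b2\<close> is the derivative of \<open>b1\<close>.\<close>
  have w2: "weak_pd i b1 b2"
    unfolding weak_pd_def
  proof (intro allI impI)
    fix \<psi> :: "real^'n \<Rightarrow> real" assume \<psi>: "test_fun \<psi>"
    have "(\<integral>x. h x * pd i (pd i \<psi>) x \<partial>lebesgue) = (\<integral>x. G x * \<psi> x \<partial>lebesgue)"
      using G(1) \<psi> by (auto simp: weak_deriv_def)
    moreover have "(\<integral>x. b x * pd i (pd i \<psi>) x \<partial>lborel) = - (\<integral>x. b1 x * pd i \<psi> x \<partial>lborel)"
      using w1 test_fun_pd[OF \<psi>, of i] by (simp add: weak_pd_def)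
    ultimately show "(\<integral>x. b1 x * pd i \<psi> x \<partial>lborel) = - (\<integral>x. b2 x * \<psi> x \<partial>lborel)"
      using swap[OF lm(1) bm(1) b(3) test_fun_pd[OF test_fun_pd[OF \<psi>]], of i i] swap[OF lm(3) bm(3) b2(3) \<psi>] by simp
  qed
  have bL: "AE x in lborel. \<bar>b x\<bar> \<le> L"
  proof -
    have "AE x in lebesgue. \<bar>b x\<bar> \<le> L" using L b(3) by eventually_elim simp
    then show ?thesis by (simp add: AE_completion_iff)
  qed
  have b2pm: "(\<lambda>x. \<bar>b2 x\<bar> powr p) \<in> borel_measurable lborel"
    by (intro powr_real_measurable borel_measurable_abs bm) auto
  have Gpm: "(\<lambda>x. \<bar>G x\<bar> powr p) \<in> borel_measurable lebesgue"
    by (intro powr_real_measurable borel_measurable_abs lm) auto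
  have Gb2: "AE x in lebesgue. \<bar>G x\<bar> powr p = \<bar>b2 x\<bar> powr p" using b2(3) by eventually_elim simp
  have b2p: "integrable lborel (\<lambda>x. \<bar>b2 x\<bar> powr p)"
    using integral_lebesgue_borel_cong(2)[OF Gpm b2pm Gb2] G(2) by simp
  have wpr: "(\<integral>\<^sup>+x. ennreal (\<bar>b1 x\<bar> powr (2*p)) \<partial>lborel) \<le> ennreal (((2*p-1)*L) powr p * (\<integral>x. \<bar>b2 x\<bar> powr p \<partial>lborel))"
    "test_fun \<psi> \<Longrightarrow> (\<integral>x. \<bar>b x\<bar> powr (2*p) * pd i (pd i \<psi>) x \<partial>lborel) =
       (\<integral>x. (2*p * (2*p-1) * \<bar>b x\<bar> powr (2*p-2) * (b1 x)\<^sup>2 + 2*p * spow (2*p-1) (b x) * b2 x) * \<psi> x \<partial>lborel)" for \<psi>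
    by (rule weak_power_rule[OF b(1) b1(1) b2(1) _ _ _ bL w1 w2 p b2p]; (rule b(2) b1(2) b2(2) | assumption); assumption?)+
  have b1pm: "(\<lambda>x. \<bar>b1 x\<bar> powr (2*p)) \<in> borel_measurable lborel"
    by (intro powr_real_measurable borel_measurable_abs bm) auto
  have b1p: "integrable lborel (\<lambda>x. \<bar>b1 x\<bar> powr (2*p))"
    using b1pm le_less_trans[OF wpr(1) ennreal_less_top] by (intro integrableI_bounded) auto
  have b1le: "(\<integral>x. \<bar>b1 x\<bar> powr (2*p) \<partial>lborel) \<le> ((2*p-1)*L) powr p * (\<integral>x. \<bar>b2 x\<bar> powr p \<partial>lborel)"
  proof -
    have "0 \<le> ((2*p-1)*L) powr p * (\<integral>x. \<bar>b2 x\<bar> powr p \<partial>lborel)"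
      by (intro mult_nonneg_nonneg integral_nonneg_AE) auto
    then show ?thesis using wpr(1) b1p by (simp add: nn_integral_eq_integral ennreal_le_iff)
  qed
  have iball: "integrable lborel (\<lambda>x::real^'n. C * indicator (cball 0 R) x)" for C :: real
    by (intro integrable_mult_right integrable_real_indicator) (auto simp: emeasure_bounded_finite[unfolded infinity_ennreal_def])
  \<comment> \<open>As \<open>2*p > 2\<close>, the square is at most
    \<open>1 + \<bar>b1 x\<bar> powr (2*p)\<close>; the constant is integrable because
    \<open>b1\<close> vanishes off the ball.\<close>
  have b1sq: "integrable lborel (\<lambda>x. (b1 x)\<^sup>2)"
  proof (rule Bochner_Integration.integrable_bound[OF Bochner_Integration.integrable_add[OF iball[of 1] b1p]])
    show "(\<lambda>x. (b1 x)\<^sup>2) \<in> borel_measurable lborel" using bm by auto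
    show "AE x in lborel. norm ((b1 x)\<^sup>2) \<le> norm (1 * indicator (cball 0 R) x + \<bar>b1 x\<bar> powr (2*p))"
    proof (intro AE_I2)
      fix x
      have "(b1 x)\<^sup>2 \<le> 1 + \<bar>b1 x\<bar> powr (2*p)"
      proof (cases "\<bar>b1 x\<bar> \<le> 1")
        case True
        then have "(b1 x)\<^sup>2 \<le> 1" by (simp add: abs_square_le_1)
        then show ?thesis by (simp add: add_increasing2)
      next
        case False
        have "(b1 x)\<^sup>2 = \<bar>b1 x\<bar> powr 2" using False by simp
        also have "\<dots> \<le> \<bar>b1 x\<bar> powr (2*p)" using False p by (intro powr_mono) auto
        finally show ?thesis by simp
      qed
      then show "norm ((b1 x)\<^sup>2) \<le> norm (1 * indicator (cball 0 R) x + \<bar>b1 x\<bar> powr (2*p))"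
        using b1(2)[of x] by (cases "norm x > R") (auto simp: indicator_def)
    qed
  qed
  have L0: "L \<ge> 0"
  proof (rule ccontr)
    assume "\<not> L \<ge> 0"
    then have "AE x in (lborel :: (real^'n) measure). False" using bL by (auto elim!: eventually_mono)
    then show False by (simp add: AE_iff_null null_sets_def emeasure_lborel_UNIV)
  qed
  define W where "W x = 2*p * (2*p-1) * \<bar>b x\<bar> powr (2*p-2) * (b1 x)\<^sup>2 + 2*p * spow (2*p-1) (b x) * b2 x" for x
  have bdm: "(\<lambda>x. 2*p * (2*p-1) * \<bar>b x\<bar> powr (2*p-2)) \<in> borel_measurable lborel" "(\<lambda>x. 2*p * spow (2*p-1) (b x)) \<in> borel_measurable lborel"
  proof -
    show "(\<lambda>x. 2*p * (2*p-1) * \<bar>b x\<bar> powr (2*p-2)) \<in> borel_measurable lborel"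
      by (intro borel_measurable_times powr_real_measurable borel_measurable_abs bm borel_measurable_const)
    have "spow (2*p-1) \<in> borel_measurable borel" using p by (intro borel_measurable_continuous_onI spow_continuous) simp
    then show "(\<lambda>x. 2*p * spow (2*p-1) (b x)) \<in> borel_measurable lborel"
      by (intro borel_measurable_times borel_measurable_const measurable_compose[OF bm(1)])
  qed
  have iW: "integrable lborel W"
    unfolding W_def
  proof (rule Bochner_Integration.integrable_add)
    show "integrable lborel (\<lambda>x. 2*p * (2*p-1) * \<bar>b x\<bar> powr (2*p-2) * (b1 x)\<^sup>2)"
    proof (rule Bochner_Integration.integrable_bound)
      show "integrable lborel (\<lambda>x. 2*p * (2*p-1) * L powr (2*p-2) * (b1 x)\<^sup>2)" using b1sq by simp
      show "AE x in lborel. norm (2*p * (2*p-1) * \<bar>b x\<bar> powr (2*p-2) * (b1 x)\<^sup>2) \<le> norm (2*p * (2*p-1) * L powr (2*p-2) * (b1 x)\<^sup>2)"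
        using bL
      proof eventually_elim
        case (elim x)
        then have "\<bar>b x\<bar> powr (2*p-2) \<le> L powr (2*p-2)" using p by (intro powr_mono2) auto
        then have "2*p * (2*p-1) * \<bar>b x\<bar> powr (2*p-2) * (b1 x)\<^sup>2 \<le> 2*p * (2*p-1) * L powr (2*p-2) * (b1 x)\<^sup>2"
          using p by (intro mult_right_mono mult_left_mono) auto
        then show ?case using p by simp
      qed
    qed (use borel_measurable_times[OF bdm(1) borel_measurable_integrable[OF b1sq]] in simp)
    show "integrable lborel (\<lambda>x. 2*p * spow (2*p-1) (b x) * b2 x)"
    proof (rule Bochner_Integration.integrable_bound)
      show "integrable lborel (\<lambda>x. 2*p * L powr (2*p-1) * b2 x)" using b2 by simp
      show "AE x in lborel. norm (2*p * spow (2*p-1) (b x) * b2 x) \<le> norm (2*p * L powr (2*p-1) * b2 x)"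
        using bL
      proof eventually_elim
        case (elim x)
        then have "\<bar>spow (2*p-1) (b x)\<bar> \<le> L powr (2*p-1)" using p L0
          by (auto simp: spow_def abs_mult abs_sgn_eq intro: powr_mono2)
        then show ?case using p by (auto simp: abs_mult intro!: mult_right_mono)
      qed
    qed (use borel_measurable_times[OF bdm(2) bm(3)] in simp)
  qed
  have hp: "integrable lborel (\<lambda>x. \<bar>b x\<bar> powr (2*p))"
  proof (rule Bochner_Integration.integrable_bound[OF iball])
    show "(\<lambda>x. \<bar>b x\<bar> powr (2*p)) \<in> borel_measurable lborel"
      by (intro powr_real_measurable borel_measurable_abs bm) auto
    show "AE x in lborel. norm (\<bar>b x\<bar> powr (2*p)) \<le> norm (L powr (2*p) * indicator (cball 0 R) x)"
      using bL
    proof eventually_elim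
      case (elim x)
      then have "\<bar>b x\<bar> powr (2*p) \<le> L powr (2*p)" using p by (intro powr_mono2) auto
      then show ?case using b(2)[of x] by (cases "norm x > R") auto
    qed
  qed
  have zm: "zeta_of p h \<in> borel_measurable lebesgue"
    unfolding zeta_of_def[abs_def] by (intro powr_real_measurable borel_measurable_abs lm) auto
  have zae: "AE x in lebesgue. zeta_of p h x = \<bar>b x\<bar> powr (2*p)"
    using b(3) by eventually_elim (simp add: zeta_of_def)
  have iWl: "integrable lebesgue W" using iW borel_measurable_integrable[OF iW] integrable_completion by blast
  \<comment> \<open>Exhibiting one weak derivative is what guarantees that \<open>Z\<close>, chosen
    by \<open>SOME\<close>, is a weak derivative as well.\<close>
  have wW: "weak_deriv (zeta_of p h) [i, i] W"
    unfolding weak_deriv_def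
  proof (intro conjI allI impI)
    show "loc_integrable (zeta_of p h)"
      using integral_lebesgue_borel_cong(2)[OF zm borel_measurable_integrable[OF hp] zae] hp
      by (intro integrable_imp_loc_integrable) simp
    show "loc_integrable W" by (rule integrable_imp_loc_integrable[OF iWl])
    fix \<psi> :: "real^'n \<Rightarrow> real" assume \<psi>: "test_fun \<psi>"
    have "(\<integral>x. zeta_of p h x * pd i (pd i \<psi>) x \<partial>lebesgue) = (\<integral>x. \<bar>b x\<bar> powr (2*p) * pd i (pd i \<psi>) x \<partial>lborel)"
      by (rule swap[OF zm borel_measurable_integrable[OF hp] zae test_fun_pd[OF test_fun_pd[OF \<psi>]]])
    also have "\<dots> = (\<integral>x. W x * \<psi> x \<partial>lborel)" unfolding W_def by (rule wpr(2)[OF \<psi>])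
    also have "\<dots> = (\<integral>x. W x * \<psi> x \<partial>lebesgue)"
      by (rule swap[OF borel_measurable_integrable[OF iWl] borel_measurable_integrable[OF iW] _ \<psi>, symmetric]) simp
    finally show "(\<integral>x. zeta_of p h x * iter_pd [i, i] \<psi> x \<partial>lebesgue) = (-1) ^ length [i, i] * (\<integral>x. W x * \<psi> x \<partial>lebesgue)"
      by simp
  qed
  have wZ: "weak_deriv (zeta_of p h) [i, i] Z" unfolding Z_def by (rule weak_deriv_wd[OF wW])
  note ZW = weak_deriv_unique[OF wZ wW]
  show ?thesis
  proof
    show "b1 \<in> borel_measurable lebesgue" using measurable_completion[OF bm(2)] .
    show "integrable lebesgue (\<lambda>x. \<bar>b1 x\<bar> powr (2*p))" using b1p integrable_completion[OF b1pm] by simp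
    have "(\<integral>x. \<bar>G x\<bar> powr p \<partial>lebesgue) = (\<integral>x. \<bar>b2 x\<bar> powr p \<partial>lborel)"
      by (rule integral_lebesgue_borel_cong(1)[OF Gpm b2pm Gb2])
    then show "(\<integral>x. \<bar>b1 x\<bar> powr (2*p) \<partial>lebesgue) \<le> ((2*p-1)*L) powr p * (\<integral>x. \<bar>G x\<bar> powr p \<partial>lebesgue)"
      using b1le integral_completion[OF b1pm] by simp
    show "Z \<in> borel_measurable lebesgue" using wZ by (auto simp: weak_deriv_def intro: loc_integrable_measurable)
    show "AE x in lebesgue. \<bar>Z x\<bar> \<le> 4 * p\<^sup>2 * \<bar>h x\<bar> powr (2*p-2) * ((b1 x)\<^sup>2 + \<bar>h x\<bar> * \<bar>G x\<bar>)"
      using ZW b(3) b2(3)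
    proof eventually_elim
      case (elim x)
      define P where "P = \<bar>h x\<bar> powr (2*p-2)"
      have P0: "P \<ge> 0" by (simp add: P_def)
      have sp: "\<bar>spow (2*p-1) (h x)\<bar> = P * \<bar>h x\<bar>"
        using powr_mult_base[of "\<bar>h x\<bar>" "2*p-2"] by (auto simp: spow_def abs_mult abs_sgn_eq P_def mult.commute)
      have "\<bar>Z x\<bar> = \<bar>2*p * (2*p-1) * P * (b1 x)\<^sup>2 + 2*p * spow (2*p-1) (h x) * G x\<bar>"
        using elim by (simp add: W_def P_def)
      also have "\<dots> \<le> \<bar>2*p * (2*p-1) * P * (b1 x)\<^sup>2\<bar> + \<bar>2*p * spow (2*p-1) (h x) * G x\<bar>" by (rule abs_triangle_ineq)
      also have "\<dots> = 2*p * (2*p-1) * (P * (b1 x)\<^sup>2) + 2*p * (P * (\<bar>h x\<bar> * \<bar>G x\<bar>))"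
        using p P0 sp by (simp add: abs_mult)
      also have "\<dots> \<le> 4 * p\<^sup>2 * (P * (b1 x)\<^sup>2) + 4 * p\<^sup>2 * (P * (\<bar>h x\<bar> * \<bar>G x\<bar>))"
      proof (intro add_mono mult_right_mono)
        show "2*p * (2*p-1) \<le> 4 * p\<^sup>2" using p by (simp add: power2_eq_square algebra_simps)
        have "2 * p * 1 \<le> 2 * p * (2 * p)" using p by (intro mult_left_mono) auto
        then show "2*p \<le> 4 * p\<^sup>2" by (simp add: power2_eq_square)
      qed (use P0 in auto)
      finally show ?case by (simp add: P_def algebra_simps)
    qed
  qed
qed

section \<open>Second-order multi-indices and the size of the second derivatives\<close>

lemma finite_multi_idx2: "finite (multi_idx2 :: ('n::finite \<Rightarrow> nat) set)"
proof (rule finite_subset)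
  show "(multi_idx2 :: ('n \<Rightarrow> nat) set) \<subseteq> PiE UNIV (\<lambda>_. {..2})"
  proof
    fix \<alpha> :: "'n \<Rightarrow> nat" assume "\<alpha> \<in> multi_idx2"
    then have s: "(\<Sum>i\<in>UNIV. \<alpha> i) = 2" by (simp add: multi_idx2_def)
    have "\<alpha> i \<le> 2" for i using member_le_sum[of i UNIV \<alpha>] s by simp
    then show "\<alpha> \<in> PiE UNIV (\<lambda>_. {..2})" by auto
  qed
qed (simp add: finite_PiE)

lemma count_list_ks_of: "count_list (ks_of \<alpha>) i = \<alpha> i"
proof -
  have cnt: "count (\<Sum>i\<in>UNIV. replicate_mset (\<alpha> i) i) j = \<alpha> j" for j
    by (simp add: count_sum)
  obtain ks where "mset ks = (\<Sum>i\<in>UNIV. replicate_mset (\<alpha> i) i)" using ex_mset by blast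
  then have "\<forall>i. count_list ks i = \<alpha> i" using cnt by (metis count_mset)
  then have "\<forall>i. count_list (ks_of \<alpha>) i = \<alpha> i" unfolding ks_of_def by (rule someI[of "\<lambda>ks. \<forall>i. count_list ks i = \<alpha> i"])
  then show ?thesis by blast
qed

lemma length_ks_of:
  assumes "\<alpha> \<in> multi_idx2"
  shows "length (ks_of \<alpha>) = 2"
proof -
  have "sum (count_list (ks_of \<alpha>)) UNIV = length (ks_of \<alpha>)" by (rule sum_count_set) auto
  then show ?thesis using assms by (simp add: count_list_ks_of multi_idx2_def)
qed

text \<open>The multi-index with the single entry 2 at \<open>i\<close> is realised by the list
  \<open>[i, i]\<close> only, so the choice in \<open>ks_of\<close> is forced and the pure
  derivative is one of the summands.\<close>

lemma wd_le_absD2: "\<bar>wd [i, i] h x\<bar> \<le> absD2 h x"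
proof -
  define \<alpha> where "\<alpha> j = (if j = i then 2 else 0 :: nat)" for j
  have mem: "\<alpha> \<in> multi_idx2" by (simp add: multi_idx2_def \<alpha>_def)
  have len: "length (ks_of \<alpha>) = 2" by (rule length_ks_of[OF mem])
  have "j = i" if "j \<in> set (ks_of \<alpha>)" for j
    using that count_list_ks_of[of \<alpha> j] by (auto simp: \<alpha>_def count_list_0_iff split: if_splits)
  then have "ks_of \<alpha> = replicate 2 i" using len by (metis replicate_eqI)
  then have "Dalpha \<alpha> h = wd [i, i] h" by (simp add: Dalpha_def numeral_2_eq_2)
  then show ?thesis
    unfolding absD2_def using member_le_sum[OF mem, of "\<lambda>\<alpha>. \<bar>Dalpha \<alpha> h x\<bar>"] finite_multi_idx2 by auto
qed

text \<open>Each term is bounded by the largest. The factor is cruder than the one from convexity,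
  but every \<open>p > 0\<close> is covered.\<close>

lemma sum_powr_le:
  fixes a :: "'i \<Rightarrow> real"
  assumes "finite J" "\<And>j. j \<in> J \<Longrightarrow> a j \<ge> 0" "p > 0"
  shows "(\<Sum>j\<in>J. a j) powr p \<le> real (card J) powr p * (\<Sum>j\<in>J. a j powr p)"
proof (cases "J = {}")
  case False
  define m where "m = Max (a ` J)"
  have "m \<in> a ` J" unfolding m_def using assms False by (intro Max_in) auto
  then obtain k where k: "k \<in> J" "a k = m" by blast
  have "(\<Sum>j\<in>J. a j) \<le> (\<Sum>j\<in>J. m)" using assms by (intro sum_mono) (auto simp: m_def)
  then have "(\<Sum>j\<in>J. a j) powr p \<le> (real (card J) * m) powr p"
    using assms by (intro powr_mono2 sum_nonneg) auto
  also have "\<dots> = real (card J) powr p * a k powr p" using k assms by (simp add: powr_mult)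
  also have "a k powr p \<le> (\<Sum>j\<in>J. a j powr p)" using assms k by (intro member_le_sum) auto
  finally show ?thesis by (simp add: mult_left_mono)
qed simp

lemma absD2_Lp:
  assumes "sobolev2 p h" "p > 0"
  shows "integrable lebesgue (\<lambda>x. \<bar>absD2 h x\<bar> powr p)" "absD2 h \<in> borel_measurable lebesgue"
proof -
  have D: "integrable lebesgue (\<lambda>x. \<bar>Dalpha \<alpha> h x\<bar> powr p)" "Dalpha \<alpha> h \<in> borel_measurable lebesgue"
    if "\<alpha> \<in> multi_idx2" for \<alpha>
    using wd_in_Lp[OF assms(1), of "ks_of \<alpha>"] length_ks_of[OF that]
    by (auto simp: Dalpha_def weak_deriv_def loc_integrable_measurable)
  show m: "absD2 h \<in> borel_measurable lebesgue"
    unfolding absD2_def[abs_def] by (intro borel_measurable_sum borel_measurable_abs D)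
  show "integrable lebesgue (\<lambda>x. \<bar>absD2 h x\<bar> powr p)"
  proof (rule Bochner_Integration.integrable_bound)
    let ?c = "real (card (multi_idx2 :: ('a \<Rightarrow> nat) set)) powr p"
    show "integrable lebesgue (\<lambda>x. ?c * (\<Sum>\<alpha>\<in>multi_idx2. \<bar>Dalpha \<alpha> h x\<bar> powr p))"
      by (intro integrable_mult_right Bochner_Integration.integrable_sum D)
    show "(\<lambda>x. \<bar>absD2 h x\<bar> powr p) \<in> borel_measurable lebesgue"
      using m by (intro powr_real_measurable borel_measurable_abs) auto
    show "AE x in lebesgue. norm (\<bar>absD2 h x\<bar> powr p) \<le> norm (?c * (\<Sum>\<alpha>\<in>multi_idx2. \<bar>Dalpha \<alpha> h x\<bar> powr p))"
    proof (intro AE_I2)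
      fix x
      have "\<bar>absD2 h x\<bar> = (\<Sum>\<alpha>\<in>multi_idx2. \<bar>Dalpha \<alpha> h x\<bar>)" by (simp add: absD2_def sum_nonneg)
      then have "\<bar>absD2 h x\<bar> powr p \<le> ?c * (\<Sum>\<alpha>\<in>multi_idx2. \<bar>Dalpha \<alpha> h x\<bar> powr p)"
        using sum_powr_le[OF finite_multi_idx2, of "\<lambda>\<alpha>. \<bar>Dalpha \<alpha> h x\<bar>" p] assms by simp
      then show "norm (\<bar>absD2 h x\<bar> powr p) \<le> norm (?c * (\<Sum>\<alpha>\<in>multi_idx2. \<bar>Dalpha \<alpha> h x\<bar> powr p))" by simp
    qed
  qed
qed

section \<open>The estimates\<close>

text \<open>The infimum is attained: the bounds \<open>Inf A + 1/(n+1)\<close> involve only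
  countably many null sets.\<close>

lemma Linf_norm_on_bound:
  assumes "in_Linf h"
  shows "Linf_norm_on D h \<ge> 0" and "AE x in lebesgue. x \<in> D \<longrightarrow> \<bar>h x\<bar> \<le> Linf_norm_on D h"
proof -
  define A where "A = {M. 0 \<le> M \<and> (AE x in lebesgue. x \<in> D \<longrightarrow> \<bar>h x\<bar> \<le> M)}"
  have L: "Linf_norm_on D h = Inf A" by (simp add: Linf_norm_on_def A_def)
  obtain M where M: "AE x in lebesgue. \<bar>h x\<bar> \<le> M" using assms by (auto simp: in_Linf_def)
  have "AE x in lebesgue. x \<in> D \<longrightarrow> \<bar>h x\<bar> \<le> max M 0" using M by eventually_elim auto
  then have "max M 0 \<in> A" by (simp add: A_def)
  then have ne: "A \<noteq> {}" by blast
  show "Linf_norm_on D h \<ge> 0" unfolding L using ne by (intro cInf_greatest) (auto simp: A_def)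
  have "AE x in lebesgue. x \<in> D \<longrightarrow> \<bar>h x\<bar> \<le> Inf A + inverse (real (Suc n))" for n
  proof -
    obtain m where m: "m \<in> A" "m < Inf A + inverse (real (Suc n))"
      using cInf_lessD[OF ne, of "Inf A + inverse (real (Suc n))"] by auto
    then have "AE x in lebesgue. x \<in> D \<longrightarrow> \<bar>h x\<bar> \<le> m" by (simp add: A_def)
    then show ?thesis by eventually_elim (use m in auto)
  qed
  then have "AE x in lebesgue. \<forall>n. x \<in> D \<longrightarrow> \<bar>h x\<bar> \<le> Inf A + inverse (real (Suc n))"
    by (simp only: AE_all_countable) blast
  then show "AE x in lebesgue. x \<in> D \<longrightarrow> \<bar>h x\<bar> \<le> Linf_norm_on D h"
  proof eventually_elim
    case (elim x)
    show ?case
    proof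
      assume "x \<in> D"
      then have le: "\<bar>h x\<bar> \<le> Inf A + inverse (real (Suc n))" for n using elim by blast
      have "(\<lambda>n. Inf A + inverse (real (Suc n))) \<longlonglongrightarrow> Inf A + 0"
        by (intro tendsto_add tendsto_const LIMSEQ_inverse_real_of_nat)
      then have "\<bar>h x\<bar> \<le> Inf A + 0" by (rule LIMSEQ_le_const) (use le in blast)
      then show "\<bar>h x\<bar> \<le> Linf_norm_on D h" by (simp add: L)
    qed
  qed
qed

text \<open>\<open>\<beta>\<close> sums the brackets of \<open>wd_power_estimate\<close> over all
  directions. Its \<open>2 * CARD('n)\<close> summands give the first factor by
  \<open>sum_powr_le\<close>; each integral is at most \<open>((2*p-1)*L) powr p * S\<close>, which
  gives the rest.\<close>

lemma laplacian_power_estimate: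
  fixes h :: "real^'n::finite \<Rightarrow> real"
  assumes sob: "sobolev2 p h" and p: "p > 1" and K: "compact K" "K \<subseteq> D" and D: "D \<in> sets lebesgue"
    and h0: "AE x in lebesgue. x \<notin> K \<longrightarrow> h x = 0" and L: "AE x in lebesgue. \<bar>h x\<bar> \<le> L" "L \<ge> 0"
  obtains \<beta> where "\<And>x. \<beta> x \<ge> 0" "\<beta> \<in> borel_measurable (lebesgue_on D)" "integrable (lebesgue_on D) (\<lambda>x. \<beta> x powr p)"
    "(\<integral>x. \<beta> x powr p \<partial>lebesgue_on D) \<le> (2 * real CARD('n)) powr p * (2 * real CARD('n) * (2*p-1) powr p) * (L * Lp_norm p (lebesgue_on D) (absD2 h)) powr p"
    "AE x in lebesgue_on D. \<bar>wlap (zeta_of p h) x\<bar> \<le> 4 * p\<^sup>2 * \<bar>h x\<bar> powr (2*p-2) * \<beta> x"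
    "wlap (zeta_of p h) \<in> borel_measurable (lebesgue_on D)"
proof -
  let ?M = "lebesgue_on D"
  let ?G = "\<lambda>i. wd [i, i] h" and ?Z = "\<lambda>i. wd [i, i] (zeta_of p h)"
  have UD: "D \<inter> space lebesgue \<in> sets lebesgue" using D by simp
  have clK: "closed K" using K(1) by (rule compact_imp_closed)
  define Q where "Q i g \<longleftrightarrow> g \<in> borel_measurable lebesgue \<and> integrable lebesgue (\<lambda>x. \<bar>g x\<bar> powr (2*p)) \<and>
    (\<integral>x. \<bar>g x\<bar> powr (2*p) \<partial>lebesgue) \<le> ((2*p-1)*L) powr p * (\<integral>x. \<bar>?G i x\<bar> powr p \<partial>lebesgue) \<and>
    (AE x in lebesgue. \<bar>?Z i x\<bar> \<le> 4 * p\<^sup>2 * \<bar>h x\<bar> powr (2*p-2) * ((g x)\<^sup>2 + \<bar>h x\<bar> * \<bar>?G i x\<bar>)) \<and>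
    ?Z i \<in> borel_measurable lebesgue" for i g
  have "\<exists>g. Q i g" for i
    unfolding Q_def by (rule wd_power_estimate[OF sob p K(1) h0 L(1), of i]) (intro exI conjI)
  then have "\<exists>g. \<forall>i. Q i (g i)" by (intro choice allI)
  then obtain g where "\<And>i. Q i (g i)" by blast
  then have g: "\<And>i. g i \<in> borel_measurable lebesgue"
    "\<And>i. integrable lebesgue (\<lambda>x. \<bar>g i x\<bar> powr (2*p))"
    "\<And>i. (\<integral>x. \<bar>g i x\<bar> powr (2*p) \<partial>lebesgue) \<le> ((2*p-1)*L) powr p * (\<integral>x. \<bar>?G i x\<bar> powr p \<partial>lebesgue)"
    "\<And>i. AE x in lebesgue. \<bar>?Z i x\<bar> \<le> 4 * p\<^sup>2 * \<bar>h x\<bar> powr (2*p-2) * ((g i x)\<^sup>2 + \<bar>h x\<bar> * \<bar>?G i x\<bar>)"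
    "\<And>i. ?Z i \<in> borel_measurable lebesgue"
    unfolding Q_def by blast+
  have G: "weak_deriv h [i, i] (?G i)" "integrable lebesgue (\<lambda>x. \<bar>?G i x\<bar> powr p)" for i
    using wd_in_Lp[OF sob, of "[i, i]"] by auto
  have hm: "h \<in> borel_measurable lebesgue" using G(1) by (auto simp: weak_deriv_def loc_integrable_measurable)
  have Gm: "?G i \<in> borel_measurable lebesgue" for i using G(1)[of i] by (auto simp: weak_deriv_def loc_integrable_measurable)
  define \<beta> where "\<beta> x = (\<Sum>i\<in>UNIV. (g i x)\<^sup>2 + \<bar>h x\<bar> * \<bar>?G i x\<bar>)" for x
  define \<gamma> where "\<gamma> x = (\<Sum>i\<in>UNIV. \<bar>g i x\<bar> powr (2*p) + L powr p * \<bar>?G i x\<bar> powr p)" for x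
  define S where "S = (\<integral>x. \<bar>absD2 h x\<bar> powr p \<partial>?M)"
  have S0: "S \<ge> 0" unfolding S_def by (intro integral_nonneg_AE) auto
  have \<beta>0: "\<beta> x \<ge> 0" for x unfolding \<beta>_def by (intro sum_nonneg add_nonneg_nonneg) auto
  have \<beta>m: "\<beta> \<in> borel_measurable lebesgue"
    unfolding \<beta>_def by (intro borel_measurable_sum borel_measurable_add borel_measurable_times borel_measurable_power borel_measurable_abs g hm Gm)
  have \<gamma>i: "integrable lebesgue \<gamma>" unfolding \<gamma>_def
    by (intro Bochner_Integration.integrable_sum Bochner_Integration.integrable_add integrable_mult_right g G)
  \<comment> \<open>Off \<open>K\<close>, a subset of \<open>D\<close>, the derivative vanishes
    almost everywhere, so the integral over the whole space is one over \<open>D\<close>, where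
    \<open>absD2\<close> dominates.\<close>
  have GS: "(\<integral>x. \<bar>?G i x\<bar> powr p \<partial>lebesgue) \<le> S" for i
  proof -
    have "AE x in lebesgue. x \<notin> K \<longrightarrow> ?G i x = 0" by (rule weak_deriv_eq_0_off[OF G(1) clK h0])
    then have "(\<integral>x. \<bar>?G i x\<bar> powr p \<partial>lebesgue) = (\<integral>x. indicator D x *\<^sub>R \<bar>?G i x\<bar> powr p \<partial>lebesgue)"
      using Gm D K(2) p
      by (intro integral_cong_AE powr_real_measurable borel_measurable_abs borel_measurable_scaleR borel_measurable_indicator)
        (auto elim!: eventually_mono split: split_indicator)
    also have "\<dots> = (\<integral>x. \<bar>?G i x\<bar> powr p \<partial>?M)" by (rule integral_restrict_space[OF UD, symmetric])
    also have "\<dots> \<le> S"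
      unfolding S_def
    proof (rule integral_mono)
      show "integrable ?M (\<lambda>x. \<bar>?G i x\<bar> powr p)"
        unfolding integrable_restrict_space[OF UD] by (rule integrable_mult_indicator[OF D G(2)])
      show "integrable ?M (\<lambda>x. \<bar>absD2 h x\<bar> powr p)"
        unfolding integrable_restrict_space[OF UD] using p by (intro integrable_mult_indicator[OF D absD2_Lp(1)[OF sob]]) simp
      show "\<bar>?G i x\<bar> powr p \<le> \<bar>absD2 h x\<bar> powr p" for x
        using wd_le_absD2[of i h x] p by (intro powr_mono2) auto
    qed
    finally show ?thesis .
  qed
  have pb: "\<beta> x powr p \<le> (2 * real CARD('n)) powr p * \<gamma> x" if "\<bar>h x\<bar> \<le> L" for x
  proof -
    \<comment> \<open>The boolean tag turns the two kinds of terms into one family, to which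
      \<open>sum_powr_le\<close> applies.\<close>
    let ?a = "\<lambda>(i, b). if b then (g i x)\<^sup>2 else \<bar>h x\<bar> * \<bar>?G i x\<bar>"
    have "\<beta> x = (\<Sum>j\<in>UNIV \<times> UNIV. ?a j)"
      by (simp add: \<beta>_def UNIV_bool add.commute flip: sum.cartesian_product)
    then have "\<beta> x powr p \<le> real (card (UNIV \<times> UNIV :: ('n \<times> bool) set)) powr p * (\<Sum>j\<in>UNIV \<times> UNIV. ?a j powr p)"
      using p by (simp only:) (intro sum_powr_le, auto)
    also have "real (card (UNIV \<times> UNIV :: ('n \<times> bool) set)) = 2 * real CARD('n)"
      by (simp add: card_cartesian_product)
    also have "(\<Sum>j\<in>UNIV \<times> UNIV. ?a j powr p) = (\<Sum>i\<in>UNIV. (g i x)\<^sup>2 powr p + (\<bar>h x\<bar> * \<bar>?G i x\<bar>) powr p)"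
    proof -
      have "(\<Sum>j\<in>UNIV \<times> UNIV. ?a j powr p) = (\<Sum>i\<in>UNIV. \<Sum>b\<in>UNIV. ?a (i, b) powr p)"
        by (simp only: sum.cartesian_product) (simp only: case_prod_unfold prod.collapse)
      then show ?thesis by (simp add: UNIV_bool add.commute)
    qed
    also have "\<dots> \<le> \<gamma> x"
      unfolding \<gamma>_def
    proof (intro sum_mono add_mono)
      fix i
      have "(g i x)\<^sup>2 = \<bar>g i x\<bar> powr 2" by simp
      then have "(g i x)\<^sup>2 powr p = (\<bar>g i x\<bar> powr 2) powr p" by (simp only:)
      then show "(g i x)\<^sup>2 powr p \<le> \<bar>g i x\<bar> powr (2*p)" by (simp only: powr_powr)
      have "(\<bar>h x\<bar> * \<bar>?G i x\<bar>) powr p = \<bar>h x\<bar> powr p * \<bar>?G i x\<bar> powr p" by (simp add: powr_mult)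
      also have "\<dots> \<le> L powr p * \<bar>?G i x\<bar> powr p"
        using that p by (intro mult_right_mono powr_mono2) auto
      finally show "(\<bar>h x\<bar> * \<bar>?G i x\<bar>) powr p \<le> L powr p * \<bar>?G i x\<bar> powr p" .
    qed
    finally show ?thesis by (simp add: mult_left_mono)
  qed
  let ?c = "(2 * real CARD('n)) powr p"
  have \<gamma>0: "\<gamma> x \<ge> 0" for x unfolding \<gamma>_def by (intro sum_nonneg add_nonneg_nonneg) auto
  have \<beta>pm: "(\<lambda>x. \<beta> x powr p) \<in> borel_measurable lebesgue"
    by (intro powr_real_measurable \<beta>m borel_measurable_const)
  have \<beta>p: "integrable lebesgue (\<lambda>x. \<beta> x powr p)"
  proof (rule Bochner_Integration.integrable_bound[OF integrable_mult_right[OF \<gamma>i, of ?c] \<beta>pm])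
    show "AE x in lebesgue. norm (\<beta> x powr p) \<le> norm (?c * \<gamma> x)"
      using L(1) by eventually_elim (use pb \<gamma>0 in simp)
  qed
  have "(\<integral>x. \<beta> x powr p \<partial>?M) = (\<integral>x. indicator D x *\<^sub>R \<beta> x powr p \<partial>lebesgue)"
    by (rule integral_restrict_space[OF UD])
  also have "\<dots> \<le> (\<integral>x. ?c * \<gamma> x \<partial>lebesgue)"
  proof (rule integral_mono_AE)
    show "integrable lebesgue (\<lambda>x. indicat_real D x *\<^sub>R \<beta> x powr p)" using \<beta>p D by (intro integrable_mult_indicator)
    show "AE x in lebesgue. indicat_real D x *\<^sub>R \<beta> x powr p \<le> ?c * \<gamma> x"
      using L(1) by eventually_elim (use pb \<gamma>0 in \<open>auto split: split_indicator\<close>)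
  qed (use \<gamma>i in simp)
  also have "\<dots> = ?c * (\<Sum>i\<in>UNIV. (\<integral>x. \<bar>g i x\<bar> powr (2*p) \<partial>lebesgue) + L powr p * (\<integral>x. \<bar>?G i x\<bar> powr p \<partial>lebesgue))"
    unfolding \<gamma>_def using g(2) G(2) by (simp add: Bochner_Integration.integral_sum)
  also have "\<dots> \<le> ?c * (\<Sum>i\<in>(UNIV::'n set). ((2*p-1)*L) powr p * S + ((2*p-1)*L) powr p * S)"
  proof (intro mult_left_mono sum_mono add_mono)
    fix i :: 'n
    have "((2*p-1)*L) powr p * (\<integral>x. \<bar>?G i x\<bar> powr p \<partial>lebesgue) \<le> ((2*p-1)*L) powr p * S"
      by (intro mult_left_mono GS) auto
    then show "(\<integral>x. \<bar>g i x\<bar> powr (2*p) \<partial>lebesgue) \<le> ((2*p-1)*L) powr p * S" using g(3)[of i] by linarith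
    \<comment> \<open>Enlarging \<open>L powr p\<close> lets the zero-order terms and the gradient
      terms share one constant.\<close>
    have "1 * L \<le> (2*p-1) * L" using p L(2) by (intro mult_right_mono) auto
    then have "L powr p \<le> ((2*p-1)*L) powr p" using p L(2) by (intro powr_mono2) auto
    then show "L powr p * (\<integral>x. \<bar>?G i x\<bar> powr p \<partial>lebesgue) \<le> ((2*p-1)*L) powr p * S"
      using GS[of i] by (intro mult_mono) (auto intro: integral_nonneg_AE)
  qed auto
  also have "((2*p-1)*L) powr p = (2*p-1) powr p * L powr p" using p L(2) by (subst powr_mult) auto
  also have "?c * (\<Sum>i\<in>(UNIV::'n set). (2*p-1) powr p * L powr p * S + (2*p-1) powr p * L powr p * S)
      = ?c * (2 * real CARD('n) * (2*p-1) powr p) * (L powr p * S)" by simp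
  also have "L powr p * S = (L * Lp_norm p ?M (absD2 h)) powr p"
    using p L(2) S0 by (simp add: Lp_norm_def S_def[symmetric] powr_mult powr_powr)
  finally have bound: "(\<integral>x. \<beta> x powr p \<partial>?M) \<le> ?c * (2 * real CARD('n) * (2*p-1) powr p) * (L * Lp_norm p ?M (absD2 h)) powr p" .
  have "AE x in lebesgue. \<forall>i\<in>UNIV. \<bar>?Z i x\<bar> \<le> 4 * p\<^sup>2 * \<bar>h x\<bar> powr (2*p-2) * ((g i x)\<^sup>2 + \<bar>h x\<bar> * \<bar>?G i x\<bar>)"
    using g(4) by (intro AE_finite_allI) auto
  then have "AE x in lebesgue. \<bar>wlap (zeta_of p h) x\<bar> \<le> 4 * p\<^sup>2 * \<bar>h x\<bar> powr (2*p-2) * \<beta> x"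
  proof eventually_elim
    case (elim x)
    have "\<bar>wlap (zeta_of p h) x\<bar> \<le> (\<Sum>i\<in>UNIV. \<bar>?Z i x\<bar>)" unfolding wlap_def by (rule sum_abs)
    also have "\<dots> \<le> (\<Sum>i\<in>UNIV. 4 * p\<^sup>2 * \<bar>h x\<bar> powr (2*p-2) * ((g i x)\<^sup>2 + \<bar>h x\<bar> * \<bar>?G i x\<bar>))"
      using elim by (intro sum_mono) auto
    finally show ?case by (simp add: \<beta>_def sum_distrib_left)
  qed
  then have ae: "AE x in ?M. \<bar>wlap (zeta_of p h) x\<bar> \<le> 4 * p\<^sup>2 * \<bar>h x\<bar> powr (2*p-2) * \<beta> x"
    by (subst AE_restrict_space_iff[OF UD]) (auto elim: eventually_mono)
  have wm: "wlap (zeta_of p h) \<in> borel_measurable lebesgue"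
    unfolding wlap_def[abs_def] by (intro borel_measurable_sum g(5))
  show ?thesis
  proof (rule that[of \<beta>, OF \<beta>0 _ _ bound ae])
    show "\<beta> \<in> borel_measurable ?M" "wlap (zeta_of p h) \<in> borel_measurable ?M"
      using \<beta>m wm by (auto intro: measurable_restrict_space1)
    show "integrable ?M (\<lambda>x. \<beta> x powr p)"
      unfolding integrable_restrict_space[OF UD] by (rule integrable_mult_indicator[OF D \<beta>p])
  qed
qed

text \<open>The closure of the fine support is a compact subset of \<open>D\<close> off which
  \<open>h\<close> vanishes almost everywhere. Hence the essential bound on \<open>D\<close> holds
  on the whole space.\<close>

lemma W0inf_test:
  fixes q :: real and h :: "real^'n::finite \<Rightarrow> real"
  defines "p \<equiv> q / (q - 1)"
  assumes N2: "real CARD('n) > 2" and q: "q \<ge> real CARD('n) / (real CARD('n)-2)"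
    and D: "D \<in> sets lebesgue" and h: "nonneg_W0inf p D h"
  obtains \<beta> where "\<And>x. \<beta> x \<ge> 0" "\<beta> \<in> borel_measurable (lebesgue_on D)" "integrable (lebesgue_on D) (\<lambda>x. \<beta> x powr p)"
    "(\<integral>x. \<beta> x powr p \<partial>lebesgue_on D) \<le> (2 * real CARD('n)) powr p * (2 * real CARD('n) * (2*p-1) powr p) *
       (Linf_norm_on D h * Lp_norm p (lebesgue_on D) (absD2 h)) powr p"
    "AE x in lebesgue_on D. \<bar>wlap (zeta_of p h) x\<bar> \<le> 4 * p\<^sup>2 * \<bar>h x\<bar> powr (2*p-2) * \<beta> x"
    "wlap (zeta_of p h) \<in> borel_measurable (lebesgue_on D)"
proof -
  have "real CARD('n) / (real CARD('n)-2) > 1" using N2 by simp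
  with q have q1: "q > 1" by linarith
  then have p1: "p > 1" by (simp add: p_def field_simps)
  let ?K = "closure (fine_supp p h)"
  have W: "sobolev2 p h" "in_Linf h" "compact ?K" "?K \<subseteq> D"
    using h by (auto simp: nonneg_W0inf_def W0inf_def)
  have h0: "AE x in lebesgue. x \<notin> ?K \<longrightarrow> h x = 0"
    using AE_eq_0_off_fine_supp[OF N2 q, of h] closure_subset[of "fine_supp p h"]
    unfolding p_def[symmetric] by (auto elim!: eventually_mono)
  have L: "AE x in lebesgue. \<bar>h x\<bar> \<le> Linf_norm_on D h"
    using h0 Linf_norm_on_bound(2)[OF W(2), of D]
    by eventually_elim (use W(4) Linf_norm_on_bound(1)[OF W(2), of D] in auto)
  show ?thesis
    by (rule laplacian_power_estimate[OF W(1) p1 W(3,4) D h0 L Linf_norm_on_bound(1)[OF W(2)]]) (rule that)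
qed

lemma young_absorb:
  fixes p q c :: real
  assumes q: "q > 1" and p: "p = q / (q - 1)" and c: "c > 0"
  obtains C where "C > 0" "\<And>a b. a \<ge> 0 \<Longrightarrow> b \<ge> 0 \<Longrightarrow> a * (c * b) \<le> a powr q / 2 + C * b powr p"
proof
  have "p - 1 = q / (q-1) - (q-1) / (q-1)" using q by (simp add: p)
  also have "\<dots> = 1 / (q-1)" unfolding diff_divide_distrib[symmetric] by simp
  finally have "p - 1 = 1 / (q-1)" .
  moreover have "1 / (q-1) > 0" using q by simp
  ultimately have p1: "p > 1" by linarith
  have pq: "1/q + 1/p = 1" using q by (simp_all add: p flip: add_divide_distrib)
  \<comment> \<open>This weight satisfies \<open>s powr q = q / 2\<close>, so the first term of
    Young's inequality becomes exactly half of \<open>a powr q\<close>.\<close>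
  define s where "s = (q/2) powr (1/q)"
  have s: "s > 0" using q by (simp add: s_def)
  have sq: "s powr q = q/2" using q by (simp add: s_def powr_powr)
  let ?C = "(c / s) powr p / p"
  show "?C > 0" using c s p1 by simp
  fix a b :: real assume ab: "a \<ge> 0" "b \<ge> 0"
  have "a * (c * b) = (s * a) * (c / s * b)" using s by simp
  also have "\<dots> \<le> (s * a) powr q / q + (c / s * b) powr p / p"
    using q p1 pq ab s c by (intro Youngs_inequality) auto
  also have "(s * a) powr q / q = a powr q / 2" using s ab q by (simp add: powr_mult sq)
  also have "(c / s * b) powr p = (c / s) powr p * b powr p" using c s ab by (subst powr_mult) auto
  also have "(c / s) powr p * b powr p / p = ?C * b powr p" by simp
  finally show "a * (c * b) \<le> a powr q / 2 + ?C * b powr p" .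
qed

theorem theorem6p4:
  fixes q :: real
  assumes N3: "CARD('n::finite) \<ge> 3"
    and q_ge: "q \<ge> real CARD('n) / (real CARD('n) - 2)"
  shows
    "(\<forall>(F :: (real^'n) set) u.
        finely_closed (q / (q - 1)) F \<and> F \<subseteq> ball 0 1 \<and>
        u \<in> borel_measurable (lebesgue_on (ball 0 2 - F)) \<and> (\<forall>x\<in>ball 0 2 - F. 0 \<le> u x) \<and>
        (\<forall>h. nonneg_W0inf (q / (q - 1)) (ball 0 2 - F) h \<longrightarrow>
             integrable (lebesgue_on (ball 0 2 - F))
               (\<lambda>x. u x powr q * zeta_of (q / (q - 1)) h x))
      \<longrightarrow> (\<forall>h. nonneg_W0inf (q / (q - 1)) (ball 0 2 - F) h \<longrightarrow>
             integrable (lebesgue_on (ball 0 2 - F))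
               (\<lambda>x. u x * wlap (zeta_of (q / (q - 1)) h) x)))
   \<and>
    (\<exists>c::real. \<forall>(F :: (real^'n) set) u.
        finely_closed (q / (q - 1)) F \<and> F \<subseteq> ball 0 1 \<and>
        very_weak_subsol q (ball 0 2 - F) u
      \<longrightarrow> (\<forall>h. nonneg_W0inf (q / (q - 1)) (ball 0 2 - F) h \<longrightarrow>
             (\<integral>x. u x * \<bar>wlap (zeta_of (q / (q - 1)) h) x\<bar> \<partial>lebesgue_on (ball 0 2 - F))
             + (\<integral>x. u x powr q * zeta_of (q / (q - 1)) h x \<partial>lebesgue_on (ball 0 2 - F))
             \<le> c * (Linf_norm_on (ball 0 2 - F) h
                    * Lp_norm (q / (q - 1)) (lebesgue_on (ball 0 2 - F)) (absD2 h)) powr (q / (q - 1))))"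
proof -
  define p where "p = q / (q - 1)"
  have N2: "real CARD('n) > 2" using N3 by simp
  have "real CARD('n) / (real CARD('n)-2) > 1" using N2 by simp
  with q_ge have q1: "q > 1" by linarith
  then have p1: "p > 1" by (simp add: p_def field_simps)
  have pq: "(2*p-2) * q = 2 * p" using q1 by (simp add: p_def field_simps)
  have "4 * p\<^sup>2 > 0" using p1 by simp
  then obtain C where C: "C > 0" "\<And>a b. a \<ge> 0 \<Longrightarrow> b \<ge> 0 \<Longrightarrow> a * (4 * p\<^sup>2 * b) \<le> a powr q / 2 + C * b powr p"
    using young_absorb[OF q1 p_def] by blast
  define k where "k = (2 * real CARD('n)) powr p * (2 * real CARD('n) * (2*p-1) powr p)"
  have main: "integrable (lebesgue_on D) (\<lambda>x. u x * wlap (zeta_of p h) x)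
     \<and> (\<integral>x. u x * \<bar>wlap (zeta_of p h) x\<bar> \<partial>lebesgue_on D)
       \<le> (\<integral>x. u x powr q * zeta_of p h x \<partial>lebesgue_on D) / 2 + C * k * (Linf_norm_on D h * Lp_norm p (lebesgue_on D) (absD2 h)) powr p"
    if F: "finely_closed p F" "F \<subseteq> ball 0 1" and D: "D = ball 0 2 - F"
      and u: "u \<in> borel_measurable (lebesgue_on D)" "\<forall>x\<in>D. 0 \<le> u x"
      and h: "nonneg_W0inf p D h" and i: "integrable (lebesgue_on D) (\<lambda>x. u x powr q * zeta_of p h x)"
    for F D :: "(real^'n) set" and u h :: "real^'n \<Rightarrow> real"
  proof -
    \<comment> \<open>Integrals over \<open>lebesgue_on D\<close> reduce to integrals with an
      indicator only for measurable \<open>D\<close>.\<close>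
    have "F \<in> sets lebesgue" using finely_closed_imp_lebesgue_measurable[OF N2 q_ge] F unfolding p_def by blast
    then have Dm: "D \<in> sets lebesgue" unfolding D by (intro sets.Diff) auto
    obtain \<beta> where \<beta>: "\<And>x. \<beta> x \<ge> 0" "\<beta> \<in> borel_measurable (lebesgue_on D)" "integrable (lebesgue_on D) (\<lambda>x. \<beta> x powr p)"
      "(\<integral>x. \<beta> x powr p \<partial>lebesgue_on D) \<le> k * (Linf_norm_on D h * Lp_norm p (lebesgue_on D) (absD2 h)) powr p"
      "AE x in lebesgue_on D. \<bar>wlap (zeta_of p h) x\<bar> \<le> 4 * p\<^sup>2 * \<bar>h x\<bar> powr (2*p-2) * \<beta> x"
      "wlap (zeta_of p h) \<in> borel_measurable (lebesgue_on D)"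
      by (rule W0inf_test[OF N2 q_ge Dm h[unfolded p_def], folded p_def]) (rule that; (unfold k_def)?; assumption)
    have ae: "AE x in lebesgue_on D. u x * \<bar>wlap (zeta_of p h) x\<bar> \<le> (u x powr q * zeta_of p h x) / 2 + C * \<beta> x powr p \<and> 0 \<le> u x"
      using \<beta>(5) AE_space
    proof eventually_elim
      case (elim x)
      then have "x \<in> D" using Dm by simp
      then have u0: "u x \<ge> 0" using u by simp
      have "u x * \<bar>wlap (zeta_of p h) x\<bar> \<le> u x * (4 * p\<^sup>2 * \<bar>h x\<bar> powr (2*p-2) * \<beta> x)"
        using elim u0 by (intro mult_left_mono) auto
      also have "\<dots> = (u x * \<bar>h x\<bar> powr (2*p-2)) * (4 * p\<^sup>2 * \<beta> x)" by simp
      also have "\<dots> \<le> (u x * \<bar>h x\<bar> powr (2*p-2)) powr q / 2 + C * \<beta> x powr p"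
        using u0 \<beta>(1) by (intro C(2)) auto
      also have "(u x * \<bar>h x\<bar> powr (2*p-2)) powr q = u x powr q * zeta_of p h x"
        using u0 pq by (simp add: powr_mult powr_powr zeta_of_def)
      finally show ?case using u0 by simp
    qed
    have im: "integrable (lebesgue_on D) (\<lambda>x. (u x powr q * zeta_of p h x) / 2 + C * \<beta> x powr p)"
      using i \<beta>(3) by simp
    have int: "integrable (lebesgue_on D) (\<lambda>x. u x * wlap (zeta_of p h) x)"
    proof (rule Bochner_Integration.integrable_bound[OF im])
      show "(\<lambda>x. u x * wlap (zeta_of p h) x) \<in> borel_measurable (lebesgue_on D)"
        by (intro borel_measurable_times u \<beta>(6))
      show "AE x in lebesgue_on D. norm (u x * wlap (zeta_of p h) x) \<le> norm ((u x powr q * zeta_of p h x) / 2 + C * \<beta> x powr p)"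
        using ae by eventually_elim (auto simp: abs_mult)
    qed
    have "integrable (lebesgue_on D) (\<lambda>x. u x * \<bar>wlap (zeta_of p h) x\<bar>)"
    proof (rule Bochner_Integration.integrable_bound[OF im])
      show "(\<lambda>x. u x * \<bar>wlap (zeta_of p h) x\<bar>) \<in> borel_measurable (lebesgue_on D)"
        by (intro borel_measurable_times borel_measurable_abs u \<beta>(6))
      show "AE x in lebesgue_on D. norm (u x * \<bar>wlap (zeta_of p h) x\<bar>) \<le> norm ((u x powr q * zeta_of p h x) / 2 + C * \<beta> x powr p)"
        using ae by eventually_elim (auto simp: abs_mult)
    qed
    then have "(\<integral>x. u x * \<bar>wlap (zeta_of p h) x\<bar> \<partial>lebesgue_on D) \<le> (\<integral>x. (u x powr q * zeta_of p h x) / 2 + C * \<beta> x powr p \<partial>lebesgue_on D)"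
      using ae im by (intro integral_mono_AE) (auto elim: eventually_mono)
    also have "\<dots> = (\<integral>x. u x powr q * zeta_of p h x \<partial>lebesgue_on D) / 2 + C * (\<integral>x. \<beta> x powr p \<partial>lebesgue_on D)"
      using i \<beta>(3) by simp
    also have "\<dots> \<le> (\<integral>x. u x powr q * zeta_of p h x \<partial>lebesgue_on D) / 2 + C * (k * (Linf_norm_on D h * Lp_norm p (lebesgue_on D) (absD2 h)) powr p)"
      using C(1) \<beta>(4) by (intro add_left_mono mult_left_mono) auto
    finally show ?thesis using int by (simp add: mult.assoc)
  qed
  show ?thesis
    unfolding p_def[symmetric]
  \<comment> \<open>Let \<open>X\<close> be the integral of \<open>u powr q\<close> against
    \<open>\<zeta>\<close>, \<open>Y\<close> that of \<open>u\<close> against the modulus of the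
    Laplacian, and \<open>T\<close> the power on the right. The subsolution property gives
    \<open>X \<le> Y\<close> and \<open>main\<close> gives \<open>Y \<le> X / 2 + C * k * T\<close>,
    so \<open>X\<close> and \<open>Y\<close> are each at most \<open>2 * C * k * T\<close>.\<close>
  proof (intro conjI exI[of _ "4 * C * k"] allI impI; (elim conjE)?)
    fix F :: "(real^'n) set" and u h :: "real^'n \<Rightarrow> real"
    assume "finely_closed p F" "F \<subseteq> ball 0 1" "u \<in> borel_measurable (lebesgue_on (ball 0 2 - F))" "\<forall>x\<in>ball 0 2 - F. 0 \<le> u x"
      "\<forall>h. nonneg_W0inf p (ball 0 2 - F) h \<longrightarrow> integrable (lebesgue_on (ball 0 2 - F)) (\<lambda>x. u x powr q * zeta_of p h x)"
      "nonneg_W0inf p (ball 0 2 - F) h"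
    then show "integrable (lebesgue_on (ball 0 2 - F)) (\<lambda>x. u x * wlap (zeta_of p h) x)"
      using main[of F "ball 0 2 - F" u h] by blast
  next
    fix F :: "(real^'n) set" and u h :: "real^'n \<Rightarrow> real"
    assume F: "finely_closed p F" "F \<subseteq> ball 0 1" and sub: "very_weak_subsol q (ball 0 2 - F) u" and h: "nonneg_W0inf p (ball 0 2 - F) h"
    let ?M = "lebesgue_on (ball 0 2 - F)"
    have u: "u \<in> borel_measurable ?M" "\<forall>x\<in>ball 0 2 - F. 0 \<le> u x"
      and i: "integrable ?M (\<lambda>x. u x powr q * zeta_of p h x)"
      and le: "(\<integral>x. u x powr q * zeta_of p h x \<partial>?M) \<le> (\<integral>x. u x * wlap (zeta_of p h) x \<partial>?M)"
      using sub h unfolding very_weak_subsol_def p_def[symmetric] Let_def by auto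
    have "(\<integral>x. u x * wlap (zeta_of p h) x \<partial>?M) \<le> (\<integral>x. \<bar>u x * wlap (zeta_of p h) x\<bar> \<partial>?M)"
      using integral_abs_bound[of ?M "\<lambda>x. u x * wlap (zeta_of p h) x"] by linarith
    also have "\<dots> = (\<integral>x. u x * \<bar>wlap (zeta_of p h) x\<bar> \<partial>?M)"
    proof (rule Bochner_Integration.integral_cong[OF refl])
      fix x assume "x \<in> space ?M"
      then show "\<bar>u x * wlap (zeta_of p h) x\<bar> = u x * \<bar>wlap (zeta_of p h) x\<bar>"
        using u(2) by (simp add: space_restrict_space abs_mult)
    qed
    finally show "(\<integral>x. u x * \<bar>wlap (zeta_of p h) x\<bar> \<partial>?M) + (\<integral>x. u x powr q * zeta_of p h x \<partial>?M)
        \<le> 4 * C * k * (Linf_norm_on (ball 0 2 - F) h * Lp_norm p ?M (absD2 h)) powr p"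
      using main[OF F refl u h i] le by linarith
  qed
qed

end
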